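(* Let $V\subset\mathbb{G}_{\rm m}^k=(\mathbb{C}^\times)^k$ be an algebraic subvariety. There is a positive integer $n(V)$ with the following property. Suppose $P=(u_1,\ldots,u_k)\in V$ and, for each $i=1,\ldots,k$, there is a positive integer $n_i$ with $u_i^{n_i}=x_i$ where $x_i\in\mathbb{Q}^\times$ and $x_i\notin(\mathbb{Q}^\times)^p$ for every prime $p\mid n_i$. Suppose $\max\{n_1,\ldots,n_k\}\ge n(V)$. Then $P$ lies in a positive-dimensional weakly special subvariety of $\mathbb{G}_{\rm m}^k$ contained in $V$.
   Context: A weakly special subvariety of $\mathbb{G}_{\rm m}^k$ is a coset (translate by an arbitrary point) of an algebraic subtorus of $\mathbb{G}_{\rm m}^k$. *)

theory Defs
  imports
    Complex_Main
    "HOL-Library.Poly_Mapping"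
    "HOL-Computational_Algebra.Primes"
    "HOL-Algebra.Product_Groups"
begin

text \<open>
  Points of \<open>G\<^sub>m\<^sup>k\<close> are extensional functions on \<open>{..<k}\<close>. The dimension is an explicit natural number
  rather than a type because the dimension of a subtorus is existentially quantified.
\<close>

definition Cstar :: "complex monoid" where
  "Cstar = \<lparr>carrier = UNIV - {0}, mult = (*), one = 1\<rparr>"

definition Gm :: "nat \<Rightarrow> (nat \<Rightarrow> complex) monoid" where
  "Gm k = product_group {..<k} (\<lambda>_. Cstar)"

text \<open>
  The coordinate ring of \<open>G\<^sub>m\<^sup>k\<close>: Laurent polynomials in the variables with index below \<open>k\<close>, as finitely
  supported maps from exponent vectors to coefficients.
\<close>

type_synonym laurent = "(nat \<Rightarrow>\<^sub>0 int) \<Rightarrow>\<^sub>0 complex"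

definition laurent_polys :: "nat \<Rightarrow> laurent set" where
  "laurent_polys k = {p. \<forall>a \<in> Poly_Mapping.keys p. Poly_Mapping.keys a \<subseteq> {..<k}}"

definition laurent_eval :: "laurent \<Rightarrow> (nat \<Rightarrow> complex) \<Rightarrow> complex" where
  "laurent_eval p u = (\<Sum>a \<in> Poly_Mapping.keys p. Poly_Mapping.lookup p a * (\<Prod>i \<in> Poly_Mapping.keys a. u i powi Poly_Mapping.lookup a i))"

text \<open>Subvarieties are Zariski closed subsets; they need not be irreducible.\<close>

definition subvariety :: "nat \<Rightarrow> (nat \<Rightarrow> complex) set \<Rightarrow> bool" where
  "subvariety k V \<longleftrightarrow>
    (\<exists>S. finite S \<and> S \<subseteq> laurent_polys k \<and>
         V = {u \<in> carrier (Gm k). \<forall>p \<in> S. laurent_eval p u = 0})"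

text \<open>
  A regular map from a closed subset \<open>X\<close> of \<open>G\<^sub>m\<^sup>k\<close> to \<open>G\<^sub>m\<^sup>d\<close>. As \<open>G\<^sub>m\<^sup>k\<close> is affine, the regular functions
  on \<open>X\<close> are the restrictions of Laurent polynomials.
\<close>

definition regular_map ::
  "nat \<Rightarrow> nat \<Rightarrow> (nat \<Rightarrow> complex) set \<Rightarrow> ((nat \<Rightarrow> complex) \<Rightarrow> (nat \<Rightarrow> complex)) \<Rightarrow> bool" where
  "regular_map k d X f \<longleftrightarrow>
    f ` X \<subseteq> carrier (Gm d) \<and>
    (\<forall>j<d. \<exists>p \<in> laurent_polys k. \<forall>u \<in> X. f u j = laurent_eval p u)"

text \<open>
  A \<open>d\<close>-dimensional algebraic subtorus is a closed subgroup isomorphic, as an algebraic group, to \<open>G\<^sub>m\<^sup>d\<close>.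
\<close>

definition subtorus :: "nat \<Rightarrow> nat \<Rightarrow> (nat \<Rightarrow> complex) set \<Rightarrow> bool" where
  "subtorus k d T \<longleftrightarrow>
    subvariety k T \<and> subgroup T (Gm k) \<and>
    (\<exists>\<phi> \<in> iso (Gm d) ((Gm k)\<lparr>carrier := T\<rparr>).
       regular_map d k (carrier (Gm d)) \<phi> \<and>
       regular_map k d T (inv_into (carrier (Gm d)) \<phi>))"

definition weakly_special :: "nat \<Rightarrow> nat \<Rightarrow> (nat \<Rightarrow> complex) set \<Rightarrow> bool" where
  "weakly_special k d W \<longleftrightarrow>
    (\<exists>T g. subtorus k d T \<and> g \<in> carrier (Gm k) \<and> W = g <#\<^bsub>Gm k\<^esub> T)"

end

theory Submission
  imports
    Defs
    "HOL-Number_Theory.Number_Theory"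
    "HOL-Real_Asymp.Real_Asymp"
    "HOL-Computational_Algebra.Fundamental_Theorem_Algebra"
    "HOL-Library.Function_Algebras"
begin

text \<open>
  The coordinates of \<open>P\<close> are radicals of rational numbers, and so are the monomials \<open>P\<^sup>a\<close>. A Laurent
  polynomial vanishing at \<open>P\<close> is thus a linear relation among radicals with fixed complex coefficients.
  The key fact is a Mann-type theorem: there is an exponent \<open>M\<close>, depending only on the coefficients,
  such that the relation splits into partial sums that vanish separately, two monomials belonging to
  the same partial sum if and only if the \<open>M\<close>-th power of their quotient is rational.

  If some nonzero integer vector \<open>m\<close> is orthogonal to all differences of exponents lying in the same
  partial sum, then \<open>t \<mapsto> P \<cdot> (t^m\<^sub>1, ..., t^m\<^sub>k)\<close> stays in \<open>V\<close> and gives the coset. Otherwise these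
  differences span a subgroup of finite index \<open>D\<close> in the group of exponents, each \<open>u\<^sub>i ^ (D M)\<close> is rational, and the
  condition on \<open>x\<^sub>i\<close> forces \<open>n\<^sub>i\<close> to divide \<open>D M\<close>.

  The Mann-type theorem is proved by Kummer theory over the maximal cyclotomic field, which reduces to
  relations inside that field, where the real radicals are square roots. Over the stabilizer of these
  square roots in a cyclotomic Galois group one is left with relations among roots of unity, to which
  character sum bounds apply.
\<close>

text \<open>The obstacle is uniformity in P. After Kummer theory the roots of unity carry
  coefficients \<open>q * r\<close> with \<open>r\<close> a real square root depending on P, so no
  fixed coefficient field is available. Only the index of the stabilizer of these \<open>r\<close>
  is controlled: at most \<open>2 ^ l\<close> for \<open>l\<close> terms. Hence relations among
  roots of unity are bounded by \<open>l\<close> and an index \<open>c\<close> alone: the mean of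
  \<open>\<omega> ^ s\<close> over a subgroup of index at most \<open>c\<close> has size at most
  \<open>c * sqrt d / totient d\<close> for \<open>\<omega>\<close> of order \<open>d\<close>, which
  tends to 0. The coefficients of the polynomials are arbitrary. Expanding them over a subfamily
  independent over the ring spanned by radicals turns one relation into several with rational
  coefficients, with a number of terms independent of P. Partial sums run over equivalence classes
  instead of minimal vanishing subsums: classes can be refined from field to field, coarsened when
  exponents grow, and followed when terms merge. The differences inside classes form one of finitely
  many sets, so finitely many indices \<open>D\<close> occur.\<close>

section \<open>Splitting a relation into classes\<close>

text \<open>The division form covers multiplicative groups as well as subfields and other sets
  containing 0, where \<open>x / 0 = 0\<close>. On nonzero values, \<open>v i / v j \<in> G\<close>
  is then an equivalence relation.\<close>

definition div_closed :: "complex set \<Rightarrow> bool" where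
  "div_closed G \<longleftrightarrow> 1 \<in> G \<and> (\<forall>x\<in>G. \<forall>y\<in>G. x / y \<in> G)"

text \<open>The weights \<open>f\<close> are kept apart from \<open>v\<close> because merging two
  terms changes weights while the classes stay those of \<open>v\<close>.\<close>

definition class_sums_vanish ::
  "complex set \<Rightarrow> 'i set \<Rightarrow> ('i \<Rightarrow> complex) \<Rightarrow> ('i \<Rightarrow> complex) \<Rightarrow> bool" where
  "class_sums_vanish G I v f \<longleftrightarrow> (\<forall>j\<in>I. (\<Sum>i\<in>{i\<in>I. v i / v j \<in> G}. f i) = 0)"

lemma quotient_trans:
  assumes "div_closed G" "b \<noteq> 0" "a / b \<in> G" "b / c \<in> G"
  shows "a / c \<in> G"
proof -
  have "1 / (b / c) \<in> G" using assms unfolding div_closed_def by blast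
  then have "(a / b) / (1 / (b / c)) \<in> G" using assms unfolding div_closed_def by blast
  then show ?thesis using assms by simp
qed

lemma quotient_sym:
  assumes "div_closed G" "a / b \<in> G"
  shows "b / a \<in> G"
proof -
  have "1 / (a / b) \<in> G" using assms unfolding div_closed_def by blast
  then show ?thesis by simp
qed

lemma quotient_refl:
  "div_closed G \<Longrightarrow> a \<noteq> 0 \<Longrightarrow> a / a \<in> G"
  by (simp add: div_closed_def)

text \<open>Such an \<open>A\<close> is a disjoint union of classes; the induction removes the class
  of one element at a time.\<close>

lemma class_sums_vanish_saturated:
  assumes I: "finite I" and G: "div_closed G" and nz: "\<And>i. i \<in> I \<Longrightarrow> v i \<noteq> 0"
    and cs: "class_sums_vanish G I v f"
    and A: "A \<subseteq> I" "\<And>a i. a \<in> A \<Longrightarrow> i \<in> I \<Longrightarrow> v i / v a \<in> G \<Longrightarrow> i \<in> A"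
  shows "sum f A = 0"
  using A
proof (induction "card A" arbitrary: A rule: less_induct)
  case less
  show ?case
  proof (cases "A = {}")
    case False
    then obtain a where a: "a \<in> A" by blast
    let ?C = "{i\<in>I. v i / v a \<in> G}"
    have finA: "finite A" using less.prems I finite_subset by blast
    have C: "?C \<subseteq> A" using less.prems a by blast
    have aC: "a \<in> ?C" using a less.prems nz G quotient_refl by blast
    have "sum f (A - ?C) = 0"
    proof (rule less.hyps)
      show "card (A - ?C) < card A"
        by (rule psubset_card_mono[OF finA]) (use aC a in blast)
      show "A - ?C \<subseteq> I" using less.prems by blast
      fix b i assume b: "b \<in> A - ?C" and i: "i \<in> I" "v i / v b \<in> G"
      have "i \<in> A" using b i less.prems by blast
      moreover have "i \<notin> ?C"
      proof
        assume "i \<in> ?C"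
        then have "v b / v a \<in> G"
          using quotient_trans[OF G nz[OF i(1)] quotient_sym[OF G i(2)]] by blast
        then show False using b less.prems by blast
      qed
      ultimately show "i \<in> A - ?C" by blast
    qed
    moreover have "sum f ?C = 0" using cs a less.prems unfolding class_sums_vanish_def by blast
    ultimately show ?thesis using sum.subset_diff[OF C finA, of f] by simp
  qed simp
qed

text \<open>Each class for the larger \<open>G'\<close> is a union of classes for
  \<open>G\<close>.\<close>

lemma class_sums_vanish_coarsen:
  assumes "finite I" "div_closed G" "div_closed G'" "G \<subseteq> G'" "\<And>i. i \<in> I \<Longrightarrow> v i \<noteq> 0"
    and "class_sums_vanish G I v f"
  shows "class_sums_vanish G' I v f"
  unfolding class_sums_vanish_def
proof
  fix j assume "j \<in> I"
  show "(\<Sum>i\<in>{i\<in>I. v i / v j \<in> G'}. f i) = 0"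
  proof (rule class_sums_vanish_saturated[OF assms(1,2,5,6)])
    fix a i assume "a \<in> {i\<in>I. v i / v j \<in> G'}" "i \<in> I" "v i / v a \<in> G"
    then show "i \<in> {i\<in>I. v i / v j \<in> G'}"
      using assms quotient_trans[of G' "v a" "v i" "v j"] by auto
  qed auto
qed

text \<open>Classes for \<open>G\<close> lie inside classes for \<open>G'\<close>, so a relation may
  be split coarsely first and each part then treated as a relation of its own.\<close>

lemma class_sums_vanish_refine:
  assumes "div_closed G" "G \<subseteq> G'" "\<And>i. i \<in> I \<Longrightarrow> v i \<noteq> 0"
    and "\<And>j. j \<in> I \<Longrightarrow> class_sums_vanish G {i\<in>I. v i / v j \<in> G'} v f"
  shows "class_sums_vanish G I v f"
  unfolding class_sums_vanish_def
proof
  fix j assume j: "j \<in> I"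
  then have "j \<in> {i\<in>I. v i / v j \<in> G'}"
    using assms quotient_refl[of G "v j"] by auto
  then have "(\<Sum>i\<in>{i\<in>{i\<in>I. v i / v j \<in> G'}. v i / v j \<in> G}. f i) = 0"
    using assms(4)[OF j] unfolding class_sums_vanish_def by blast
  moreover have "{i\<in>{i\<in>I. v i / v j \<in> G'}. v i / v j \<in> G} = {i\<in>I. v i / v j \<in> G}"
    using assms(2) by blast
  ultimately show "(\<Sum>i\<in>{i\<in>I. v i / v j \<in> G}. f i) = 0" by simp
qed

subsection \<open>Subgroups of the units modulo n\<close>

lemmas cong_mod_def = unique_euclidean_semiring_class.cong_def

definition unit_subgroup :: "nat \<Rightarrow> nat set \<Rightarrow> bool" where
  "unit_subgroup n H \<longleftrightarrow> H \<subseteq> totatives n \<and> 1 \<in> H \<and> (\<forall>s\<in>H. \<forall>t\<in>H. s * t mod n \<in> H)"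

lemma unit_subgroup_totatives:
  assumes "n > 1"
  shows "unit_subgroup n (totatives n)"
  unfolding unit_subgroup_def
proof (intro conjI ballI)
  show "1 \<in> totatives n" using assms by (auto simp: totatives_def)
  fix s t assume "s \<in> totatives n" "t \<in> totatives n"
  then have c: "coprime (s * t mod n) n" by (auto simp: totatives_def)
  then have "s * t mod n \<noteq> 0" using assms by (intro notI) simp
  then show "s * t mod n \<in> totatives n" using c assms
    by (auto simp: totatives_def less_imp_le)
qed simp

lemma unit_subgroup_less:
  "unit_subgroup n H \<Longrightarrow> n > 1 \<Longrightarrow> s \<in> H \<Longrightarrow> s < n"
  unfolding unit_subgroup_def using totatives_less by blast

lemma unit_subgroup_coprime:
  "unit_subgroup n H \<Longrightarrow> s \<in> H \<Longrightarrow> coprime s n"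
  unfolding unit_subgroup_def totatives_def by blast

lemma unit_subgroup_finite: "unit_subgroup n H \<Longrightarrow> finite H"
  unfolding unit_subgroup_def using finite_subset finite_totatives by blast

text \<open>Euler's theorem makes \<open>s ^ (totient n - 1)\<close> the inverse, and powers of
  \<open>s\<close> stay in \<open>H\<close>.\<close>

lemma unit_subgroup_inverse:
  assumes H: "unit_subgroup n H" and n: "n > 1" and s: "s \<in> H"
  obtains t where "t \<in> H" "s * t mod n = 1"
proof -
  have pow: "s ^ k mod n \<in> H" for k
  proof (induction k)
    case 0
    then show ?case using H n by (auto simp: unit_subgroup_def)
  next
    case (Suc k)
    then have "(s * (s ^ k mod n)) mod n \<in> H" using H s unfolding unit_subgroup_def by blast
    then show ?case by (simp add: mod_mult_right_eq)
  qed
  have "[s ^ totient n = 1] (mod n)"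
    using euler_theorem[OF unit_subgroup_coprime[OF H s]] .
  moreover have "totient n > 0" using n by simp
  ultimately have "[s * s ^ (totient n - 1) = 1] (mod n)"
    by (metis Suc_diff_1 power_Suc)
  then have "s * (s ^ (totient n - 1) mod n) mod n = 1"
    using n by (simp add: mod_mult_right_eq cong_mod_def)
  then show ?thesis using that pow by blast
qed

text \<open>The hypothesis lets \<open>H\<close> act on the values of \<open>\<chi>\<close>, so the
  fibres are cosets of the stabilizer of \<open>\<chi> 1\<close>: multiplication by
  \<open>s0\<close> and by its inverse gives injections in both directions. It is applied to the
  powers \<open>\<omega> ^ s\<close> and to the Galois conjugates of a number.\<close>

lemma card_orbit_stabilizer:
  assumes H: "unit_subgroup n H" and n: "n > 1"
    and \<chi>: "\<And>s s' t. s \<in> H \<Longrightarrow> s' \<in> H \<Longrightarrow> t \<in> H \<Longrightarrow> \<chi> s = \<chi> s' \<Longrightarrow> \<chi> (s * t mod n) = \<chi> (s' * t mod n)"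
  shows "unit_subgroup n {s\<in>H. \<chi> s = \<chi> 1}"
    and "s0 \<in> H \<Longrightarrow> card {s\<in>H. \<chi> s = \<chi> s0} = card {s\<in>H. \<chi> s = \<chi> 1}"
    and "card H = card (\<chi> ` H) * card {s\<in>H. \<chi> s = \<chi> 1}"
proof -
  let ?K = "{s\<in>H. \<chi> s = \<chi> 1}"
  have fin: "finite H" using H unit_subgroup_finite by blast
  have one: "1 \<in> H" using H by (simp add: unit_subgroup_def)
  have lt: "s < n" if "s \<in> H" for s using unit_subgroup_less[OF H n that] .
  have cl: "s * t mod n \<in> H" if "s \<in> H" "t \<in> H" for s t using H that by (simp add: unit_subgroup_def)
  have shift: "\<chi> (s * t mod n) = \<chi> t" if "s \<in> ?K" "t \<in> H" for s t
    using \<chi>[of s 1 t] that one lt[OF that(2)] by simp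
  show "unit_subgroup n ?K"
    unfolding unit_subgroup_def
  proof (intro conjI ballI)
    show "?K \<subseteq> totatives n" using H by (auto simp: unit_subgroup_def)
  qed (use one shift cl in auto)
  show fib: "card {s\<in>H. \<chi> s = \<chi> s0} = card ?K" if s0: "s0 \<in> H" for s0
  proof (rule antisym)
    obtain t0 where t0: "t0 \<in> H" "s0 * t0 mod n = 1" using unit_subgroup_inverse[OF H n s0] .
    have inj: "inj_on (\<lambda>s. s * t mod n) H" if t: "t \<in> H" for t
    proof (rule inj_onI)
      fix x y assume xy: "x \<in> H" "y \<in> H" "x * t mod n = y * t mod n"
      then have "[x * t = y * t] (mod n)" by (simp add: cong_mod_def)
      then have "[x = y] (mod n)"
        using cong_mult_rcancel_nat[OF unit_subgroup_coprime[OF H t]] by simp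
      then show "x = y" using lt[OF xy(1)] lt[OF xy(2)] by (simp add: cong_mod_def)
    qed
    show "card {s\<in>H. \<chi> s = \<chi> s0} \<le> card ?K"
    proof (rule card_inj_on_le)
      show "inj_on (\<lambda>s. s * t0 mod n) {s\<in>H. \<chi> s = \<chi> s0}"
        using inj[OF t0(1)] by (rule inj_on_subset) auto
      show "(\<lambda>s. s * t0 mod n) ` {s\<in>H. \<chi> s = \<chi> s0} \<subseteq> ?K"
      proof clarify
        fix s assume "s \<in> H" "\<chi> s = \<chi> s0"
        then show "s * t0 mod n \<in> H \<and> \<chi> (s * t0 mod n) = \<chi> 1"
          using \<chi>[of s s0 t0] cl t0 s0 by auto
      qed
      show "finite ?K" using fin by simp
    qed
    show "card ?K \<le> card {s\<in>H. \<chi> s = \<chi> s0}"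
    proof (rule card_inj_on_le)
      show "inj_on (\<lambda>s. s * s0 mod n) ?K"
        using inj[OF s0] by (rule inj_on_subset) auto
      show "(\<lambda>s. s * s0 mod n) ` ?K \<subseteq> {s\<in>H. \<chi> s = \<chi> s0}"
        using shift s0 cl by auto
      show "finite {s\<in>H. \<chi> s = \<chi> s0}" using fin by simp
    qed
  qed
  have "card H = (\<Sum>s\<in>H. 1)" by simp
  also have "\<dots> = (\<Sum>y\<in>\<chi> ` H. \<Sum>s\<in>{s\<in>H. \<chi> s = y}. 1)" by (rule sum.image_gen[OF fin])
  also have "\<dots> = (\<Sum>y\<in>\<chi> ` H. card ?K)"
    by (rule sum.cong) (use fib in auto)
  finally show "card H = card (\<chi> ` H) * card ?K" by simp
qed

section \<open>Lifting residues and bounding the totient from below\<close>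

text \<open>An elementary substitute for primes in arithmetic progressions:
  \<open>m = s + d * P\<close>, where \<open>P\<close> collects the primes of \<open>B\<close> that
  do not divide \<open>s\<close>. A prime of \<open>B\<close> divides exactly one of
  \<open>s\<close> and \<open>d * P\<close>.\<close>

lemma coprime_lift:
  fixes s d B :: nat
  assumes "coprime s d" "B > 0"
  obtains m where "[m = s] (mod d)" "coprime m B"
proof -
  define P where "P = \<Prod>{q \<in> prime_factors B. \<not> q dvd s}"
  have "coprime (s + d * P) B"
  proof (rule coprimeI)
    fix c assume c: "c dvd s + d * P" "c dvd B"
    show "is_unit c"
    proof (rule ccontr)
      assume "\<not> is_unit c"
      then have "c \<noteq> 1" by simp
      then obtain q where q: "prime q" "q dvd c" using prime_factor_nat by blast
      have qB: "q \<in> prime_factors B" using q c assms(2) by (auto simp: in_prime_factors_iff)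
      have qm: "q dvd s + d * P" using q c by auto
      show False
      proof (cases "q dvd s")
        case True
        then have "q dvd d * P" using qm by (metis dvd_add_right_iff)
        moreover have "\<not> q dvd d" using True assms(1) q(1)
          by (meson coprime_common_divisor not_prime_unit)
        ultimately have "q dvd P" using q(1) by (simp add: prime_dvd_mult_iff)
        then obtain q' where "q' \<in> {q \<in> prime_factors B. \<not> q dvd s}" "q dvd q'"
          unfolding P_def using prime_dvd_prod_iff[OF _ q(1), of "{q \<in> prime_factors B. \<not> q dvd s}" "\<lambda>x. x"]
          by auto
        then show False using True q(1) by (metis (mono_tags, lifting) in_prime_factors_imp_prime mem_Collect_eq primes_dvd_imp_eq)
      next
        case False
        then have "q \<in> {q \<in> prime_factors B. \<not> q dvd s}" using qB by simp
        then have "q dvd P" unfolding P_def by (intro dvd_prodI[where f = "\<lambda>x. x", simplified]) auto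
        then have "q dvd s" using qm by (metis dvd_add_left_iff dvd_mult)
        then show False using False by simp
      qed
    qed
  qed
  moreover have "[s + d * P = s] (mod d)" by (simp add: cong_mod_def)
  ultimately show ?thesis using that by blast
qed

text \<open>The largest of \<open>k + 1\<close> such elements is at least \<open>k + 2\<close>, so
  its factor is at least \<open>(k + 1) / (k + 2)\<close> and the product telescopes.\<close>

lemma prod_one_minus_inverse_ge:
  fixes P :: "nat set"
  assumes "finite P" "\<And>p. p \<in> P \<Longrightarrow> p \<ge> 2"
  shows "(\<Prod>p\<in>P. 1 - 1 / real p) \<ge> 1 / real (card P + 1)"
  using assms
proof (induction "card P" arbitrary: P)
  case 0
  then show ?case by simp
next
  case (Suc k)
  then have ne: "P \<noteq> {}" by auto
  define m where "m = Max P"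
  have m: "m \<in> P" using ne Suc.prems by (simp add: m_def)
  have "P \<subseteq> {2..m}" using Suc.prems by (auto simp: m_def)
  then have "card P \<le> card {2..m}" by (intro card_mono) auto
  then have mk: "m \<ge> k + 2" using Suc.hyps(2) by simp
  have ck: "card (P - {m}) = k" using Suc.hyps(2) m Suc.prems by simp
  have IH: "(\<Prod>p\<in>P - {m}. 1 - 1 / real p) \<ge> 1 / real (k + 1)"
    using Suc.hyps(1)[of "P - {m}"] ck Suc.prems by simp
  have "1 - 1 / real m \<ge> 1 - 1 / real (k + 2)"
    using mk by (intro diff_left_mono divide_left_mono) auto
  moreover have "1 - 1 / real (k + 2) = real (k + 1) / real (k + 2)" by (simp add: field_simps)
  ultimately have "(1 - 1 / real m) * (\<Prod>p\<in>P - {m}. 1 - 1 / real p) \<ge> (real (k + 1) / real (k + 2)) * (1 / real (k + 1))"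
    using IH mk by (intro mult_mono) auto
  moreover have "(real (k + 1) / real (k + 2)) * (1 / real (k + 1)) = 1 / real (card P + 1)"
    unfolding Suc.hyps(2)[symmetric] by (simp add: field_simps)
  moreover have "(\<Prod>p\<in>P. 1 - 1 / real p) = (1 - 1 / real m) * (\<Prod>p\<in>P - {m}. 1 - 1 / real p)"
    using m Suc.prems by (intro prod.remove) auto
  ultimately show ?case by linarith
qed

text \<open>The primes of \<open>d\<close> are at least 2 and their product is at most
  \<open>d\<close>, so there are at most \<open>log 2 d\<close> of them.\<close>

lemma totient_ge:
  assumes "d > 0"
  shows "real (totient d) \<ge> real d / (log 2 (real d) + 1)"
proof -
  let ?P = "prime_factors d"
  have p2: "p \<ge> 2" if "p \<in> ?P" for p using that by (simp add: in_prime_factors_imp_prime prime_ge_2_nat)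
  have "2 ^ card ?P = (\<Prod>p\<in>?P. (2::nat))" by simp
  also have "\<dots> \<le> \<Prod>?P" by (intro prod_mono) (use p2 in auto)
  also have "\<dots> \<le> d"
  proof -
    have "\<Prod>?P \<le> (\<Prod>p\<in>?P. p ^ multiplicity p d)"
    proof (intro prod_mono conjI)
      fix p assume "p \<in> ?P"
      then have "multiplicity p d \<ge> 1" "p \<ge> 1"
        using prime_factors_multiplicity[of d] p2[of p] by auto
      then show "p \<le> p ^ multiplicity p d" by (metis self_le_power Suc_le_eq One_nat_def)
    qed auto
    also have "\<dots> = d" using assms prod_prime_factors[of d] by simp
    finally show ?thesis .
  qed
  finally have "2 ^ card ?P \<le> d" .
  then have "2 ^ card ?P \<le> real d" by (metis of_nat_le_iff of_nat_numeral of_nat_power)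
  then have "real (card ?P) \<le> log 2 (real d)" using assms by (simp add: le_log_iff powr_realpow)
  then have "real d / (log 2 (real d) + 1) \<le> real d / (real (card ?P) + 1)"
    by (intro divide_left_mono) (auto intro!: mult_pos_pos add_nonneg_pos)
  also have "\<dots> = real d * (1 / real (card ?P + 1))" by simp
  also have "\<dots> \<le> real d * (\<Prod>p\<in>?P. 1 - 1 / real p)"
    by (intro mult_left_mono prod_one_minus_inverse_ge) (use p2 in auto)
  also have "\<dots> = real (totient d)" by (rule totient_formula2[symmetric])
  finally show ?thesis .
qed

text \<open>Means of roots of unity of order \<open>d\<close> will be bounded by a multiple of
  \<open>sqrt d / totient d\<close>; this makes them small for large \<open>d\<close>.\<close>

lemma totient_dominates_sqrt:
  fixes C :: real
  obtains D :: nat where "D > 0" "\<And>d. d > D \<Longrightarrow> C * sqrt (real d) < real (totient d)"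
proof -
  have "eventually (\<lambda>d::nat. C * sqrt (real d) < real d / (log 2 (real d) + 1)) at_top"
    by real_asymp
  then obtain D where D: "\<And>d. d \<ge> D \<Longrightarrow> C * sqrt (real d) < real d / (log 2 (real d) + 1)"
    unfolding eventually_at_top_linorder by blast
  show ?thesis
  proof (rule that[of "D + 1"])
    fix d assume "d > D + 1"
    then show "C * sqrt (real d) < real (totient d)" using D[of d] totient_ge[of d] by linarith
  qed simp
qed

section \<open>Exponential sums over subgroups of the units\<close>

lemma root_of_unity_order:
  fixes \<omega> :: complex
  assumes "\<omega> ^ n = 1" "n > 0"
  obtains d where "d > 0" "\<And>k. \<omega> ^ k = 1 \<longleftrightarrow> d dvd k"
proof -
  define d where "d = (LEAST d. d > 0 \<and> \<omega> ^ d = 1)"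
  have d: "d > 0" "\<omega> ^ d = 1"
    using LeastI[of "\<lambda>d. d > 0 \<and> \<omega> ^ d = 1" n] assms by (auto simp: d_def)
  have "\<omega> ^ k = 1 \<longleftrightarrow> d dvd k" for k
  proof
    assume k: "\<omega> ^ k = 1"
    have "\<omega> ^ (k mod d) = 1"
      using k d by (metis div_mult_mod_eq lambda_one mult.commute power_add power_mult power_one)
    then have "k mod d = 0"
      using not_less_Least[of "k mod d" "\<lambda>d. d > 0 \<and> \<omega> ^ d = 1"] d by (auto simp: d_def[symmetric])
    then show "d dvd k" by auto
  next
    assume "d dvd k"
    then show "\<omega> ^ k = 1" using d by (auto simp: power_mult)
  qed
  then show ?thesis using that d by blast
qed

lemma power_mod_eq:
  fixes \<omega> :: "'a :: monoid_mult"
  assumes "\<omega> ^ d = 1"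
  shows "\<omega> ^ (k mod d) = \<omega> ^ k"
proof -
  have "\<omega> ^ k = \<omega> ^ (d * (k div d) + k mod d)" by simp
  also have "\<dots> = \<omega> ^ (k mod d)" using assms by (simp only: power_add power_mult power_one mult_1_left)
  finally show ?thesis by simp
qed

lemma power_eq_iff_cong:
  fixes \<omega> :: complex
  assumes "d > 0" "\<And>k. \<omega> ^ k = 1 \<longleftrightarrow> d dvd k"
  shows "\<omega> ^ a = \<omega> ^ b \<longleftrightarrow> a mod d = b mod d"
proof
  have \<omega>: "\<omega> ^ d = 1" using assms by simp
  then have nz: "\<omega> \<noteq> 0" using assms(1) by (auto simp: power_0_left)
  show "a mod d = b mod d" if "\<omega> ^ a = \<omega> ^ b" for a b
    using that
  proof (induction a b rule: linorder_wlog)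
    case (le a b)
    have "\<omega> ^ b = \<omega> ^ a * \<omega> ^ (b - a)" using le(1) by (simp flip: power_add)
    then have "\<omega> ^ a * \<omega> ^ (b - a) = \<omega> ^ a * 1" using le(2) by simp
    then have "\<omega> ^ (b - a) = 1" using nz by simp
    then have "d dvd b - a" using assms by simp
    then show ?case using le by (metis mod_eq_dvd_iff_nat)
  next
    case (sym a b)
    then show ?case by auto
  qed
  show "\<omega> ^ a = \<omega> ^ b" if "a mod d = b mod d"
    using that power_mod_eq[OF \<omega>] by metis
qed

lemma root_of_unity_power:
  fixes \<omega> :: "'a :: monoid_mult"
  assumes "\<omega> ^ n = 1"
  shows "(\<omega> ^ s) ^ n = 1"
  using assms by (metis mult.commute power_mult power_one)

lemma norm_root_of_unity:
  fixes x :: complex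
  assumes "x ^ n = 1" "n > 0"
  shows "norm x = 1"
proof -
  have "norm x ^ n = 1 ^ n" using assms by (simp flip: norm_power)
  then show ?thesis using assms power_eq_imp_eq_base[of "norm x" n 1] by simp
qed

lemma sum_powers_root_of_unity:
  fixes z :: complex
  assumes "z ^ d = 1"
  shows "(\<Sum>b<d. z ^ b) = (if z = 1 then of_nat d else 0)"
  using assms geometric_sum[of z d] by auto

text \<open>Orthogonality of the characters of the group of \<open>d\<close>-th roots of unity, for
  the indicator function of \<open>X\<close>.\<close>

lemma parseval_powers:
  fixes X :: "complex set"
  assumes X: "finite X" "\<And>x. x \<in> X \<Longrightarrow> x ^ d = 1" and d: "d > 0"
  shows "(\<Sum>b<d. (norm (\<Sum>x\<in>X. x ^ b))\<^sup>2) = real d * real (card X)"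
proof -
  have cn: "cnj x = 1 / x" if "x \<in> X" for x
    using norm_root_of_unity[OF X(2)[OF that] d] complex_div_cnj[of 1 x] by simp
  have "complex_of_real (\<Sum>b<d. (norm (\<Sum>x\<in>X. x ^ b))\<^sup>2)
      = (\<Sum>b<d. (\<Sum>x\<in>X. x ^ b) * cnj (\<Sum>x\<in>X. x ^ b))"
    by (simp only: of_real_sum complex_norm_square)
  also have "\<dots> = (\<Sum>b<d. \<Sum>x\<in>X. \<Sum>y\<in>X. (x / y) ^ b)"
  proof (rule sum.cong[OF refl])
    fix b
    have "cnj (\<Sum>x\<in>X. x ^ b) = (\<Sum>x\<in>X. (1 / x) ^ b)" using cn by (simp add: power_one_over)
    then show "(\<Sum>x\<in>X. x ^ b) * cnj (\<Sum>x\<in>X. x ^ b) = (\<Sum>x\<in>X. \<Sum>y\<in>X. (x / y) ^ b)"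
      by (simp add: sum_product power_divide)
  qed
  also have "\<dots> = (\<Sum>x\<in>X. \<Sum>y\<in>X. \<Sum>b<d. (x / y) ^ b)"
    by (subst sum.swap, rule sum.cong[OF refl], subst sum.swap) simp
  also have "\<dots> = (\<Sum>x\<in>X. \<Sum>y\<in>X. if y = x then of_nat d else 0)"
  proof (intro sum.cong refl)
    fix x y assume xy: "x \<in> X" "y \<in> X"
    then have "y \<noteq> 0" using X(2)[of y] d by (auto simp: power_0_left)
    moreover have "(x / y) ^ d = 1" using X xy by (simp add: power_divide)
    ultimately show "(\<Sum>b<d. (x / y) ^ b) = (if y = x then of_nat d else 0)"
      by (subst sum_powers_root_of_unity) auto
  qed
  also have "\<dots> = of_real (real d * real (card X))" using X by simp
  finally show ?thesis by (simp only: of_real_eq_iff)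
qed

text \<open>Raising to a power \<open>a\<close> in \<open>H\<close> permutes the orbit, so the power
  sum \<open>g a\<close> equals \<open>g 1\<close>. These exponents give as many residues modulo
  \<open>d\<close> as the orbit has elements, and Parseval bounds their joint contribution by
  \<open>d\<close> times that number.\<close>

lemma orbit_sum_norm_le:
  fixes \<omega> :: complex
  assumes H: "unit_subgroup n H" and n: "n > 1" and \<omega>n: "\<omega> ^ n = 1"
    and d: "d > 0" "\<And>k. \<omega> ^ k = 1 \<longleftrightarrow> d dvd k"
  shows "norm (\<Sum>x\<in>(\<lambda>s. \<omega> ^ s) ` H. x) \<le> sqrt (real d)"
proof -
  let ?O = "(\<lambda>s. \<omega> ^ s) ` H"
  define g where "g b = (\<Sum>x\<in>?O. x ^ b)" for b :: nat
  have fin: "finite H" using H unit_subgroup_finite by blast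
  have On: "x ^ n = 1" if "x \<in> ?O" for x
    using that root_of_unity_power[OF \<omega>n] by blast
  have \<omega>d: "\<omega> ^ d = 1" using d by simp
  have Od: "x ^ d = 1" if "x \<in> ?O" for x
    using that root_of_unity_power[OF \<omega>d] by blast
  have one: "1 \<in> H" using H by (simp add: unit_subgroup_def)
  have gH: "g a = g 1" if a: "a \<in> H" for a
  proof -
    obtain a' where a': "a' \<in> H" "a * a' mod n = 1" using unit_subgroup_inverse[OF H n a] .
    have inv: "(x ^ a) ^ a' = x" if "x \<in> ?O" for x
      using power_mod_eq[OF On[OF that], of "a * a'"] a' by (simp add: power_mult)
    have inj: "inj_on (\<lambda>x. x ^ a) ?O" using inv by (metis inj_onI)
    have "(\<lambda>x. x ^ a) ` ?O \<subseteq> ?O"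
    proof clarify
      fix s assume s: "s \<in> H"
      have "(\<omega> ^ s) ^ a = \<omega> ^ (s * a mod n)" using power_mod_eq[OF \<omega>n] by (simp add: power_mult)
      then show "(\<omega> ^ s) ^ a \<in> ?O" using s a H by (auto simp: unit_subgroup_def)
    qed
    then have "(\<lambda>x. x ^ a) ` ?O = ?O" using inj fin by (intro endo_inj_surj) auto
    then show ?thesis unfolding g_def using sum.reindex[OF inj, of "\<lambda>x. x"] by simp
  qed
  define B where "B = (\<lambda>a. a mod d) ` H"
  have Bd: "B \<subseteq> {..<d}" using d by (auto simp: B_def)
  have gB: "g b = g 1" if "b \<in> B" for b
  proof -
    obtain a where a: "a \<in> H" "b = a mod d" using \<open>b \<in> B\<close> unfolding B_def by blast
    have "g b = g a" unfolding g_def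
      by (rule sum.cong[OF refl]) (use a power_mod_eq[OF Od] in auto)
    then show ?thesis using gH a by simp
  qed
  have "bij_betw (\<lambda>b. \<omega> ^ b) B ?O"
    unfolding bij_betw_def
  proof
    show "inj_on (\<lambda>b. \<omega> ^ b) B"
    proof (rule inj_onI)
      fix x y assume "x \<in> B" "y \<in> B" "\<omega> ^ x = \<omega> ^ y"
      moreover from this have "x mod d = y mod d" using power_eq_iff_cong[OF d] by blast
      ultimately show "x = y" using Bd by (metis lessThan_iff mod_less subsetD)
    qed
    show "(\<lambda>b. \<omega> ^ b) ` B = ?O"
      unfolding B_def image_image using power_mod_eq[OF \<omega>d] by simp
  qed
  then have cB: "card B = card ?O" by (rule bij_betw_same_card)
  have "real (card ?O) * (norm (g 1))\<^sup>2 = (\<Sum>b\<in>B. (norm (g b))\<^sup>2)"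
    using gB cB by simp
  also have "\<dots> \<le> (\<Sum>b<d. (norm (g b))\<^sup>2)" using Bd by (intro sum_mono2) auto
  also have "\<dots> = real d * real (card ?O)"
    unfolding g_def using fin Od d by (intro parseval_powers) auto
  finally have "real (card ?O) * (norm (g 1))\<^sup>2 \<le> real (card ?O) * real d" by (simp add: mult.commute)
  moreover have "card ?O > 0" using fin one by (auto simp: card_gt_0_iff)
  ultimately have "(norm (g 1))\<^sup>2 \<le> real d" by simp
  then have "norm (g 1) \<le> sqrt (real d)" by (rule real_le_rsqrt)
  then show ?thesis by (simp add: g_def)
qed

text \<open>The sum is the orbit sum times the order of the stabilizer, and the orbit is not small:
  under all units it contains the powers with exponent coprime to \<open>d\<close>, and passing to
  \<open>H\<close> shrinks it at most by the factor \<open>c\<close>. The inequality bounds the mean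
  over \<open>H\<close> by \<open>c * sqrt d / totient d\<close>, cleared of denominators.\<close>

lemma character_sum_norm_le:
  fixes \<omega> :: complex
  assumes H: "unit_subgroup n H" and n: "n > 1" and \<omega>n: "\<omega> ^ n = 1"
    and d: "d > 0" "\<And>k. \<omega> ^ k = 1 \<longleftrightarrow> d dvd k"
    and c: "totient n \<le> c * card H"
  shows "norm (\<Sum>s\<in>H. \<omega> ^ s) * real (totient d) \<le> real c * sqrt (real d) * real (card H)"
proof -
  let ?\<chi> = "\<lambda>s. \<omega> ^ s"
  let ?G = "totatives n"
  let ?K = "{s\<in>H. ?\<chi> s = ?\<chi> 1}" and ?L = "{s\<in>?G. ?\<chi> s = ?\<chi> 1}"
  have \<chi>: "?\<chi> (s * t mod n) = ?\<chi> (s' * t mod n)" if "?\<chi> s = ?\<chi> s'" for s s' t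
    using that by (simp add: power_mod_eq[OF \<omega>n] power_mult)
  have fin: "finite H" using H unit_subgroup_finite by blast
  note orbH = card_orbit_stabilizer[OF H n, of ?\<chi>, OF \<chi>]
  note orbG = card_orbit_stabilizer[OF unit_subgroup_totatives[OF n] n, of ?\<chi>, OF \<chi>]
  have cH: "card H = card (?\<chi> ` H) * card ?K" using orbH(3) by blast
  have cG: "totient n = card (?\<chi> ` ?G) * card ?L" using orbG(3) by (simp add: totient_def)
  have "(\<Sum>s\<in>H. \<omega> ^ s) = (\<Sum>y\<in>?\<chi> ` H. \<Sum>s\<in>{s\<in>H. ?\<chi> s = y}. \<omega> ^ s)"
    by (rule sum.image_gen[OF fin])
  also have "\<dots> = (\<Sum>y\<in>?\<chi> ` H. of_nat (card ?K) * y)"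
  proof (rule sum.cong[OF refl])
    fix y assume "y \<in> ?\<chi> ` H"
    then obtain s0 where s0: "s0 \<in> H" "y = ?\<chi> s0" by blast
    have "card {s\<in>H. ?\<chi> s = y} = card ?K" using orbH(2)[OF _ s0(1)] s0 by blast
    then show "(\<Sum>s\<in>{s\<in>H. ?\<chi> s = y}. \<omega> ^ s) = of_nat (card ?K) * y" by simp
  qed
  finally have sumeq: "norm (\<Sum>s\<in>H. \<omega> ^ s) = real (card ?K) * norm (\<Sum>x\<in>?\<chi> ` H. x)"
    by (simp add: sum_distrib_left[symmetric] norm_mult)
  have le1: "norm (\<Sum>s\<in>H. \<omega> ^ s) \<le> real (card ?K) * sqrt (real d)"
    unfolding sumeq by (intro mult_left_mono orbit_sum_norm_le[OF H n \<omega>n d]) auto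
  have KL: "card ?K \<le> card ?L" using H by (intro card_mono) (auto simp: unit_subgroup_def)
  have "1 \<in> ?L" using unit_subgroup_totatives[OF n] by (simp add: unit_subgroup_def)
  then have L0: "card ?L > 0" using finite_totatives[of n] card_gt_0_iff by fastforce
  \<comment> \<open>Compare the two orbit-stabilizer equations; the stabilizer in \<open>H\<close>
    is contained in the stabilizer in the full unit group.\<close>
  have GO: "card (?\<chi> ` ?G) \<le> c * card (?\<chi> ` H)"
  proof -
    have "g \<le> c * h" if "g * L \<le> c * (h * K)" "K \<le> L" "L > 0" for g h K L :: nat
    proof -
      have "c * (h * K) \<le> c * h * L" using that(2) by simp
      then have "g * L \<le> (c * h) * L" using that(1) by linarith
      then show ?thesis using that(3) by simp
    qed
    then show ?thesis using c[unfolded cH cG] KL L0 by blast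
  qed
  have \<omega>d: "\<omega> ^ d = 1" using d by simp
  have "totient d \<le> card (?\<chi> ` ?G)"
    unfolding totient_def
  proof (rule card_inj_on_le)
    show "inj_on ?\<chi> (totatives d)"
    proof (rule inj_onI)
      fix x y assume xy: "x \<in> totatives d" "y \<in> totatives d" "\<omega> ^ x = \<omega> ^ y"
      then have m: "x mod d = y mod d" using power_eq_iff_cong[OF d] by blast
      show "x = y"
      proof (cases "d = 1")
        case True
        then show ?thesis using xy by (simp add: totatives_def)
      next
        case False
        then have "x < d" "y < d" using totatives_less xy d by auto
        then show ?thesis using m by simp
      qed
    qed
    show "?\<chi> ` totatives d \<subseteq> ?\<chi> ` ?G"
    proof clarify
      fix t assume "t \<in> totatives d"
      then have "coprime t d" by (simp add: totatives_def)
      then obtain m where m: "[m = t] (mod d)" "coprime m n" using coprime_lift n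
        by (metis less_trans zero_less_one)
      have cm: "coprime (m mod n) n" using m(2) n by simp
      then have "m mod n \<noteq> 0" using n by (intro notI) simp
      moreover have "m mod n \<le> n" using n by (simp add: less_imp_le)
      ultimately have "m mod n \<in> ?G" using cm unfolding totatives_def by simp
      moreover have "\<omega> ^ (m mod n) = \<omega> ^ t"
        using m(1) unfolding cong_mod_def
        by (metis power_mod_eq[OF \<omega>n] power_mod_eq[OF \<omega>d])
      ultimately show "\<omega> ^ t \<in> ?\<chi> ` ?G" by (metis image_eqI)
    qed
  qed simp
  then have "totient d \<le> c * card (?\<chi> ` H)" using GO by linarith
  then have t: "real (totient d) \<le> real c * real (card (?\<chi> ` H))"
    by (metis of_nat_le_iff of_nat_mult)
  have *: "norm (\<Sum>s\<in>H. \<omega> ^ s) * real (totient d) \<le> (real (card ?K) * sqrt (real d)) * (real c * real (card (?\<chi> ` H)))"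
    by (intro mult_mono le1 t) auto
  have **: "x \<le> c * q * h" if "x \<le> (k * q) * (c * w)" "h = w * k" for x c q h k w :: real
    using that by (simp add: mult_ac)
  have "real (card H) = real (card (?\<chi> ` H)) * real (card ?K)"
    using arg_cong[OF cH, of real] by (simp only: of_nat_mult)
  then show ?thesis by (rule **[OF *])
qed

text \<open>In the equation for an index where \<open>norm (e j)\<close> is largest, the other terms
  are too small to cancel the diagonal one.\<close>

lemma diagonally_dominant_trivial_kernel:
  fixes e :: "'i \<Rightarrow> complex"
  assumes I: "finite I" and eq: "\<And>j. j \<in> I \<Longrightarrow> (\<Sum>i\<in>I. e i * a i j) = 0"
    and diag: "\<And>j. j \<in> I \<Longrightarrow> a j j = 1"
    and off: "\<And>i j. i \<in> I \<Longrightarrow> j \<in> I \<Longrightarrow> i \<noteq> j \<Longrightarrow> norm (a i j) * real (card I) < 1"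
    and "i \<in> I"
  shows "e i = 0"
proof -
  have ne: "I \<noteq> {}" using assms by auto
  have "finite ((\<lambda>i. norm (e i)) ` I)" using I by simp
  then obtain j where j: "j \<in> I" "norm (e j) = Max ((\<lambda>i. norm (e i)) ` I)"
    using Max_in[of "(\<lambda>i. norm (e i)) ` I"] ne by (metis (no_types, lifting) image_iff image_is_empty)
  have mx: "norm (e k) \<le> norm (e j)" if "k \<in> I" for k using j I that by simp
  have "e j = 0"
  proof (rule ccontr)
    assume "e j \<noteq> 0"
    then have pos: "norm (e j) > 0" by simp
    have c: "card I > 0" using I ne by (simp add: card_gt_0_iff)
    have "0 = e j * a j j + (\<Sum>i\<in>I - {j}. e i * a i j)" using eq[OF j(1)] I j by (simp add: sum.remove)
    then have "e j = - (\<Sum>i\<in>I - {j}. e i * a i j)" using diag[OF j(1)] by (simp add: eq_neg_iff_add_eq_0)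
    then have "norm (e j) \<le> (\<Sum>i\<in>I - {j}. norm (e i * a i j))" by (metis norm_minus_cancel norm_sum)
    also have "\<dots> \<le> (\<Sum>i\<in>I - {j}. norm (e j) * (1 / real (card I)))"
    proof (rule sum_mono)
      fix i assume i: "i \<in> I - {j}"
      then have "norm (a i j) < 1 / real (card I)" using off[of i j] j c by (simp add: field_simps)
      then show "norm (e i * a i j) \<le> norm (e j) * (1 / real (card I))"
        unfolding norm_mult using mx[of i] i by (intro mult_mono) auto
    qed
    also have "\<dots> = real (card (I - {j})) * (norm (e j) / real (card I))" by simp
    also have "\<dots> < real (card I) * (norm (e j) / real (card I))"
      using I j c pos by (intro mult_strict_right_mono) (auto simp: card_gt_0_iff)
    also have "\<dots> = norm (e j)" using c by simp
    finally show False by simp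
  qed
  then show ?thesis using mx[OF \<open>i \<in> I\<close>] by simp
qed

subsection \<open>Short relations among roots of unity\<close>

lemma sum_merge:
  fixes f :: "'i \<Rightarrow> 'a :: comm_monoid_add"
  assumes "finite A" "i0 \<in> A" "j0 \<in> A" "i0 \<noteq> j0"
  shows "(\<Sum>i\<in>A - {i0}. (f(j0 := f j0 + f i0)) i) = (\<Sum>i\<in>A. f i)"
proof -
  have "(\<Sum>i\<in>A - {i0}. (f(j0 := f j0 + f i0)) i) = (f j0 + f i0) + (\<Sum>i\<in>A - {i0} - {j0}. (f(j0 := f j0 + f i0)) i)"
    using assms by (subst sum.remove[of _ j0]) auto
  also have "(\<Sum>i\<in>A - {i0} - {j0}. (f(j0 := f j0 + f i0)) i) = (\<Sum>i\<in>A - {i0} - {j0}. f i)"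
    by (rule sum.cong) auto
  also have "(f j0 + f i0) + \<dots> = f i0 + (\<Sum>i\<in>A - {i0}. f i)"
    using assms by (subst (2) sum.remove[of _ j0]) (auto simp: ac_simps)
  also have "\<dots> = (\<Sum>i\<in>A. f i)"
    using assms by (intro sum.remove[symmetric]) auto
  finally show ?thesis .
qed

text \<open>Terms of one class can be collected at a single index without changing any class sum;
  this is how the later inductions reduce the number of terms.\<close>

lemma class_sums_vanish_merge:
  assumes I: "finite I" and G: "div_closed G" and nz: "\<And>i. i \<in> I \<Longrightarrow> v i \<noteq> 0"
    and ij: "i0 \<in> I" "j0 \<in> I" "i0 \<noteq> j0" "v i0 / v j0 \<in> G"
    and cs: "class_sums_vanish G (I - {i0}) v (f(j0 := f j0 + f i0))"
  shows "class_sums_vanish G I v f"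
  unfolding class_sums_vanish_def
proof
  fix k assume k: "k \<in> I"
  let ?A = "{i\<in>I. v i / v k \<in> G}" and ?g = "f(j0 := f j0 + f i0)"
  have ijA: "i0 \<in> ?A \<longleftrightarrow> j0 \<in> ?A"
    using ij quotient_trans[OF G nz[OF ij(2)] ij(4)]
      quotient_trans[OF G nz[OF ij(1)] quotient_sym[OF G ij(4)]] by blast
  have "sum ?g (?A - {i0}) = 0"
  proof (rule class_sums_vanish_saturated[OF _ G _ cs])
    fix a i assume a: "a \<in> ?A - {i0}" "i \<in> I - {i0}" "v i / v a \<in> G"
    then show "i \<in> ?A - {i0}"
      using quotient_trans[OF G, of "v a" "v i" "v k"] nz[of a] by auto
  qed (use I nz in auto)
  moreover have "sum ?g (?A - {i0}) = sum f ?A"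
  proof (cases "i0 \<in> ?A")
    case True
    then show ?thesis using sum_merge[of ?A i0 j0 f] ijA I ij(3) by simp
  next
    case False
    then show ?thesis using ijA by (intro sum.cong) auto
  qed
  ultimately show "sum f ?A = 0" by simp
qed

definition roots_of_unity :: "nat \<Rightarrow> complex set" where
  "roots_of_unity M = {x. x ^ M = 1}"

lemma div_closed_roots_of_unity: "div_closed (roots_of_unity M)"
  by (auto simp: div_closed_def roots_of_unity_def power_divide)

lemma roots_of_unity_mono: "M dvd N \<Longrightarrow> roots_of_unity M \<subseteq> roots_of_unity N"
  by (auto simp: roots_of_unity_def power_mult elim!: dvdE)

text \<open>
  Either all quotients \<open>\<zeta> i / \<zeta> j\<close> have large order, and averaging over \<open>H\<close> gives a diagonally
  dominant system; or some quotient has small order, and its two terms can be merged over the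
  stabilizer of that quotient in \<open>H\<close>.
\<close>

lemma bounded_class_sums_vanish:
  "\<exists>M>0. \<forall>n>1. \<forall>H (I :: 'i set) (e :: 'i \<Rightarrow> complex) \<zeta>.
     unit_subgroup n H \<longrightarrow> totient n \<le> c * card H \<longrightarrow> finite I \<longrightarrow> card I \<le> l \<longrightarrow>
     (\<forall>i\<in>I. \<zeta> i ^ n = 1) \<longrightarrow> (\<forall>s\<in>H. (\<Sum>i\<in>I. e i * \<zeta> i ^ s) = 0) \<longrightarrow>
     class_sums_vanish (roots_of_unity M) I \<zeta> (\<lambda>i. e i * \<zeta> i)"
\<comment> \<open>Passing to a stabilizer enlarges the index bound, so \<open>c\<close> varies in
  the induction.\<close>
proof (induction l arbitrary: c)
  case 0
  then show ?case by (intro exI[of _ 1]) (auto simp: class_sums_vanish_def)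
next
  case (Suc l)
  obtain D :: nat where D: "D > 0"
    "\<And>d. d > D \<Longrightarrow> (real c * real (Suc l)) * sqrt (real d) < real (totient d)"
    using totient_dominates_sqrt[of "real c * real (Suc l)"] by blast
  \<comment> \<open>Orders up to \<open>D\<close> divide \<open>fact D\<close>, so an order that
    does not divide \<open>F\<close> exceeds \<open>D\<close>.\<close>
  define F where "F = (fact D :: nat)"
  have F: "F > 0" by (simp add: F_def)
  obtain M' where M': "M' > 0" "\<forall>n>1. \<forall>H (I :: 'i set) (e :: 'i \<Rightarrow> complex) \<zeta>.
     unit_subgroup n H \<longrightarrow> totient n \<le> (c * F) * card H \<longrightarrow> finite I \<longrightarrow> card I \<le> l \<longrightarrow>
     (\<forall>i\<in>I. \<zeta> i ^ n = 1) \<longrightarrow> (\<forall>s\<in>H. (\<Sum>i\<in>I. e i * \<zeta> i ^ s) = 0) \<longrightarrow>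
     class_sums_vanish (roots_of_unity M') I \<zeta> (\<lambda>i. e i * \<zeta> i)"
    using Suc.IH[of "c * F"] by (elim exE conjE) (rule that)
  \<comment> \<open>\<open>F\<close> accounts for the merged quotient, \<open>M'\<close> for the
    relation with one term fewer.\<close>
  define M where "M = M' * F"
  have M: "M > 0" using M' F by (simp add: M_def)
  have "class_sums_vanish (roots_of_unity M) I \<zeta> (\<lambda>i. e i * \<zeta> i)"
    if n: "n > 1" and H: "unit_subgroup n H" and c: "totient n \<le> c * card H" and I: "finite I" "card I \<le> Suc l"
      and \<zeta>: "\<forall>i\<in>I. \<zeta> i ^ n = 1" and rel: "\<forall>s\<in>H. (\<Sum>i\<in>I. e i * \<zeta> i ^ s) = 0"
    for n H and I :: "'i set" and e :: "'i \<Rightarrow> complex" and \<zeta>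
  proof -
    have nz: "\<zeta> i \<noteq> 0" if "i \<in> I" for i
    proof
      assume "\<zeta> i = 0"
      then show False using bspec[OF \<zeta> that] n by (simp add: power_0_left)
    qed
    have one: "1 \<in> H" using H by (simp add: unit_subgroup_def)
    show ?thesis
    proof (cases "\<exists>i\<in>I. \<exists>j\<in>I. i \<noteq> j \<and> (\<zeta> i / \<zeta> j) ^ F = 1")
      case True
      then obtain i0 j0 where ij: "i0 \<in> I" "j0 \<in> I" "i0 \<noteq> j0" "(\<zeta> i0 / \<zeta> j0) ^ F = 1" by blast
      define \<omega> where "\<omega> = \<zeta> i0 / \<zeta> j0"
      have \<omega>n: "\<omega> ^ n = 1" using \<zeta> ij by (simp add: \<omega>_def power_divide)
      \<comment> \<open>On the stabilizer,
        \<open>\<zeta> i0 ^ s = \<omega> * \<zeta> j0 ^ s\<close>, so the two terms merge with a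
        coefficient independent of \<open>s\<close>. Its index in \<open>H\<close> is at most
        \<open>F\<close>, since every value \<open>\<omega> ^ s\<close> is an \<open>F\<close>-th
        root of unity.\<close>
      define K where "K = {s\<in>H. \<omega> ^ s = \<omega> ^ 1}"
      have \<chi>: "\<omega> ^ (s * t mod n) = \<omega> ^ (s' * t mod n)" if "\<omega> ^ s = \<omega> ^ s'" for s s' t
        using that by (simp add: power_mod_eq[OF \<omega>n] power_mult)
      note orb = card_orbit_stabilizer[OF H n, of "\<lambda>s. \<omega> ^ s", OF \<chi>, folded K_def]
      have K: "unit_subgroup n K" using orb(1) by blast
      have cH: "card H = card ((\<lambda>s. \<omega> ^ s) ` H) * card K" using orb(3) by blast
      have "(\<lambda>s. \<omega> ^ s) ` H \<subseteq> {z. z ^ F = 1}"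
        using root_of_unity_power[of \<omega> F] ij by (auto simp: \<omega>_def)
      then have "card ((\<lambda>s. \<omega> ^ s) ` H) \<le> card {z::complex. z ^ F = 1}"
        using F by (intro card_mono finite_roots_unity) auto
      also have "\<dots> \<le> F" using F by (intro card_roots_unity) auto
      finally have "card H \<le> F * card K" unfolding cH by simp
      then have cK: "totient n \<le> (c * F) * card K"
        using c by (metis (no_types, lifting) le_trans mult.assoc mult_le_mono2)
      define I' where "I' = I - {i0}"
      define e' where "e' = e(j0 := e j0 + e i0 * \<omega>)"
      have I': "finite I'" "card I' \<le> l" using I ij by (auto simp: I'_def)
      have jI': "j0 \<in> I'" using ij by (simp add: I'_def)
      have \<zeta>i: "\<zeta> i0 = \<omega> * \<zeta> j0" using nz ij by (simp add: \<omega>_def)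
      have e': "(\<lambda>i. e' i * \<zeta> i ^ s) = (\<lambda>i. e i * \<zeta> i ^ s)(j0 := e j0 * \<zeta> j0 ^ s + e i0 * \<zeta> i0 ^ s)"
        if "\<omega> ^ s = \<omega>" for s
        using that by (auto simp: e'_def \<zeta>i power_mult_distrib algebra_simps)
      have cs: "class_sums_vanish (roots_of_unity M') I' \<zeta> (\<lambda>i. e' i * \<zeta> i)"
      proof (rule M'(2)[rule_format, OF n K cK I'])
        show "\<zeta> i ^ n = 1" if "i \<in> I'" for i using \<zeta> that by (simp add: I'_def)
        show "(\<Sum>i\<in>I'. e' i * \<zeta> i ^ s) = 0" if "s \<in> K" for s
        proof -
          have "\<omega> ^ s = \<omega>" "s \<in> H" using that by (auto simp: K_def)
          then show ?thesis unfolding I'_def e'[OF \<open>\<omega> ^ s = \<omega>\<close>] using sum_merge[OF I(1) ij(1-3), of "\<lambda>i. e i * \<zeta> i ^ s"] rel \<open>s \<in> H\<close> by simp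
        qed
      qed
      have M'M: "roots_of_unity M' \<subseteq> roots_of_unity M" and FM: "roots_of_unity F \<subseteq> roots_of_unity M"
        by (auto intro!: roots_of_unity_mono simp: M_def)
      have dc: "div_closed (roots_of_unity M)" by (rule div_closed_roots_of_unity)
      have cs': "class_sums_vanish (roots_of_unity M) I' \<zeta> (\<lambda>i. e' i * \<zeta> i)"
        by (rule class_sums_vanish_coarsen[OF I'(1) div_closed_roots_of_unity dc M'M _ cs])
          (use nz in \<open>auto simp: I'_def\<close>)
      have \<omega>M: "\<zeta> i0 / \<zeta> j0 \<in> roots_of_unity M" using FM ij by (auto simp: roots_of_unity_def)
      have "class_sums_vanish (roots_of_unity M) (I - {i0}) \<zeta> ((\<lambda>i. e i * \<zeta> i)(j0 := e j0 * \<zeta> j0 + e i0 * \<zeta> i0))"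
        using cs' e'[of 1] by (simp add: I'_def)
      then show ?thesis
        using class_sums_vanish_merge[of I "roots_of_unity M" \<zeta> i0 j0 "\<lambda>i. e i * \<zeta> i"] I(1) dc nz ij(1-3) \<omega>M
        by simp
    next
      case False
      have "e i = 0" if "i \<in> I" for i
      proof -
        \<comment> \<open>Dividing the relation at \<open>s\<close> by \<open>\<zeta> j ^ s\<close>
          and averaging over \<open>H\<close> gives the equation of index \<open>j\<close>.\<close>
        define a where "a i j = (\<Sum>s\<in>H. (\<zeta> i / \<zeta> j) ^ s) / of_nat (card H)" for i j
        have cH: "card H > 0" using one unit_subgroup_finite[OF H] by (auto simp: card_gt_0_iff)
        show ?thesis
        proof (rule diagonally_dominant_trivial_kernel[OF I(1), where a = a])
          show "i \<in> I" by fact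
          show "(\<Sum>i\<in>I. e i * a i j) = 0" if j: "j \<in> I" for j
          proof -
            have "(\<Sum>i\<in>I. e i * a i j) = (\<Sum>i\<in>I. \<Sum>s\<in>H. e i * \<zeta> i ^ s / (\<zeta> j ^ s * of_nat (card H)))"
              by (simp add: a_def sum_divide_distrib sum_distrib_left power_divide)
            also have "\<dots> = (\<Sum>s\<in>H. (\<Sum>i\<in>I. e i * \<zeta> i ^ s) / (\<zeta> j ^ s * of_nat (card H)))"
              by (subst sum.swap) (simp add: sum_divide_distrib)
            also have "\<dots> = 0" using rel by (intro sum.neutral) auto
            finally show ?thesis .
          qed
          show "a j j = 1" if "j \<in> I" for j using nz[OF that] cH by (simp add: a_def)
          show "norm (a i j) * real (card I) < 1" if ij: "i \<in> I" "j \<in> I" "i \<noteq> j" for i j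
          proof -
            define \<omega> where "\<omega> = \<zeta> i / \<zeta> j"
            have \<omega>n: "\<omega> ^ n = 1" using \<zeta> ij by (simp add: \<omega>_def power_divide)
            obtain d where d: "d > 0" "\<And>k. \<omega> ^ k = 1 \<longleftrightarrow> d dvd k"
              using root_of_unity_order[OF \<omega>n] n by auto
            have "\<not> d dvd F" using False ij d(2)[of F] by (auto simp: \<omega>_def)
            then have dD: "d > D" using d(1) by (metis F_def dvd_fact Suc_leI One_nat_def not_le)
            let ?S = "norm (\<Sum>s\<in>H. \<omega> ^ s)"
            have S: "?S * real (totient d) \<le> real c * sqrt (real d) * real (card H)"
              by (rule character_sum_norm_le[OF H n \<omega>n d c])
            have t: "real (totient d) > 0" using d(1) by simp
            have "(?S * real (Suc l)) * real (totient d) \<le> (real c * real (Suc l)) * sqrt (real d) * real (card H)"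
              using mult_right_mono[OF S, of "real (Suc l)"] by (simp only: mult_ac of_nat_0_le_iff)
            also have "\<dots> < real (totient d) * real (card H)"
              using D(2)[OF dD] cH by (intro mult_strict_right_mono) auto
            finally have "?S * real (Suc l) < real (card H)"
              using t by (simp only: mult.commute[of "real (totient d)"] mult_less_cancel_right_pos)
            moreover have "?S * real (card I) \<le> ?S * real (Suc l)"
              using I by (intro mult_left_mono) auto
            ultimately have "?S * real (card I) < real (card H)" by linarith
            then show ?thesis using cH by (simp add: a_def \<omega>_def norm_divide field_simps)
          qed
        qed
      qed
      then show ?thesis by (simp add: class_sums_vanish_def)
    qed
  qed
  then show ?case using M by blast
qed

subsection \<open>Subrings of the complex numbers and polynomials over them\<close>

definition csubring :: "complex set \<Rightarrow> bool" where
  "csubring S \<longleftrightarrow> 1 \<in> S \<and> (\<forall>x\<in>S. \<forall>y\<in>S. x - y \<in> S \<and> x * y \<in> S)"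

context
  fixes S :: "complex set"
  assumes S: "csubring S"
begin

lemma subring_1: "1 \<in> S" and subring_diff: "x \<in> S \<Longrightarrow> y \<in> S \<Longrightarrow> x - y \<in> S"
  and subring_mult: "x \<in> S \<Longrightarrow> y \<in> S \<Longrightarrow> x * y \<in> S"
  using S by (auto simp: csubring_def)

lemma subring_0: "0 \<in> S"
  using subring_diff[OF subring_1 subring_1] by simp

lemma subring_uminus: "x \<in> S \<Longrightarrow> - x \<in> S"
  using subring_diff[OF subring_0] by fastforce

lemma subring_add: "x \<in> S \<Longrightarrow> y \<in> S \<Longrightarrow> x + y \<in> S"
  using subring_diff[OF _ subring_uminus] by fastforce

lemma subring_power: "x \<in> S \<Longrightarrow> x ^ k \<in> S"
  by (induction k) (auto intro: subring_1 subring_mult)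

lemma subring_sum: "(\<And>i. i \<in> A \<Longrightarrow> f i \<in> S) \<Longrightarrow> (\<Sum>i\<in>A. f i) \<in> S"
  by (induction A rule: infinite_finite_induct) (auto intro: subring_0 subring_add)

lemma subring_prod: "(\<And>i. i \<in> A \<Longrightarrow> f i \<in> S) \<Longrightarrow> (\<Prod>i\<in>A. f i) \<in> S"
  by (induction A rule: infinite_finite_induct) (auto intro: subring_1 subring_mult)

lemma subring_of_nat: "of_nat k \<in> S"
  by (induction k) (auto intro: subring_0 subring_1 subring_add)

lemma subring_of_int: "of_int k \<in> S"
  by (cases k rule: int_cases2) (auto intro: subring_of_nat subring_uminus)

end

lemma csubring_Ints: "csubring \<int>"
  and csubring_Rats: "csubring \<rat>"
  by (auto simp: csubring_def)

text \<open>
  Cramer's rule would give \<open>d\<close> as a determinant; a maximal independent subfamily does as well.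
\<close>

lemma subring_independent_subfamily:
  fixes c :: "'i \<Rightarrow> complex"
  assumes S: "csubring S" and I: "finite I"
  obtains J d f where "J \<subseteq> I" "d \<in> S" "d \<noteq> 0" "\<And>i j. i \<in> I \<Longrightarrow> j \<in> J \<Longrightarrow> f i j \<in> S"
    "\<And>i. i \<in> I \<Longrightarrow> d * c i = (\<Sum>j\<in>J. f i j * c j)"
    "\<And>g j. (\<And>j. j \<in> J \<Longrightarrow> g j \<in> S) \<Longrightarrow> (\<Sum>j\<in>J. g j * c j) = 0 \<Longrightarrow> j \<in> J \<Longrightarrow> g j = 0"
proof -
  define indep where
    "indep J \<longleftrightarrow> (\<forall>g. (\<forall>j\<in>J. g j \<in> S) \<longrightarrow> (\<Sum>j\<in>J. g j * c j) = 0 \<longrightarrow> (\<forall>j\<in>J. g j = 0))" for J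
  have "\<exists>J d f. J \<subseteq> I \<and> indep J \<and> d \<in> S \<and> d \<noteq> 0 \<and> (\<forall>i\<in>I. \<forall>j\<in>J. f i j \<in> S) \<and>
    (\<forall>i\<in>I. d * c i = (\<Sum>j\<in>J. f i j * c j))"
    using I
  proof (induction I)
    case empty
    then show ?case by (intro exI[of _ "{}"] exI[of _ 1]) (auto simp: indep_def subring_1[OF S])
  next
    case (insert x I)
    then obtain J d f where J: "J \<subseteq> I" "indep J" "d \<in> S" "d \<noteq> 0" "\<forall>i\<in>I. \<forall>j\<in>J. f i j \<in> S"
      "\<forall>i\<in>I. d * c i = (\<Sum>j\<in>J. f i j * c j)" by blast
    have fJ: "finite J" using J insert finite_subset by blast
    have xJ: "x \<notin> J" using J insert by blast
    show ?case
    proof (cases "indep (insert x J)")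
      case True
      define f' where "f' i j = (if i = x then if j = x then d else 0 else if j = x then 0 else f i j)" for i j
      show ?thesis
      proof (intro exI[of _ "insert x J"] exI[of _ d] exI[of _ f'] conjI ballI)
        fix i j assume "i \<in> insert x I" "j \<in> insert x J"
        then show "f' i j \<in> S" using J by (auto simp: f'_def subring_0[OF S])
      next
        fix i assume i: "i \<in> insert x I"
        show "d * c i = (\<Sum>j\<in>insert x J. f' i j * c j)"
        proof (cases "i = x")
          case True
          then have "(\<Sum>j\<in>J. f' i j * c j) = 0" using xJ by (intro sum.neutral) (auto simp: f'_def)
          then show ?thesis using True fJ xJ by (simp add: f'_def)
        next
          case False
          then have "(\<Sum>j\<in>J. f' i j * c j) = (\<Sum>j\<in>J. f i j * c j)" using xJ by (intro sum.cong) (auto simp: f'_def)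
          then show ?thesis using False fJ xJ i J by (simp add: f'_def)
        qed
      qed (use J True in auto)
    next
      case False
      then obtain g where g: "\<forall>j\<in>insert x J. g j \<in> S" "(\<Sum>j\<in>insert x J. g j * c j) = 0" "\<not> (\<forall>j\<in>insert x J. g j = 0)"
        unfolding indep_def by blast
      have gs: "g x * c x + (\<Sum>j\<in>J. g j * c j) = 0" using g fJ xJ by simp
      have gx: "g x \<noteq> 0"
      proof
        assume "g x = 0"
        then have "(\<Sum>j\<in>J. g j * c j) = 0" using gs by simp
        then have "\<forall>j\<in>J. g j = 0" using J(2) g(1) unfolding indep_def by auto
        then show False using g \<open>g x = 0\<close> by auto
      qed
      \<comment> \<open>Division by \<open>g x\<close> may leave the ring \<open>S\<close>, so
        \<open>g x\<close> is absorbed into the common multiplier \<open>d\<close> instead.\<close>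
      define f' where "f' i j = (if i = x then - (d * g j) else g x * f i j)" for i j
      show ?thesis
      proof (intro exI[of _ J] exI[of _ "d * g x"] exI[of _ f'] conjI ballI)
        fix i j assume "i \<in> insert x I" "j \<in> J"
        then show "f' i j \<in> S" using J g by (auto simp: f'_def intro!: subring_uminus[OF S] subring_mult[OF S])
      next
        fix i assume i: "i \<in> insert x I"
        show "d * g x * c i = (\<Sum>j\<in>J. f' i j * c j)"
        proof (cases "i = x")
          case True
          then have "(\<Sum>j\<in>J. f' i j * c j) = - d * (\<Sum>j\<in>J. g j * c j)"
            by (simp add: f'_def sum_distrib_left algebra_simps)
          also have "(\<Sum>j\<in>J. g j * c j) = - (g x * c x)" using gs by (simp add: add_eq_0_iff)
          also have "- d * - (g x * c x) = d * g x * c x" by simp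
          finally show ?thesis using True by simp
        next
          case False
          then have "(\<Sum>j\<in>J. f' i j * c j) = g x * (\<Sum>j\<in>J. f i j * c j)"
            by (simp add: f'_def sum_distrib_left algebra_simps)
          then show ?thesis using False J i by (simp add: algebra_simps)
        qed
      qed (use J g gx in \<open>auto intro!: subring_mult[OF S]\<close>)
    qed
  qed
  then obtain J d f where J: "J \<subseteq> I" "indep J" "d \<in> S" "d \<noteq> 0" "\<forall>i\<in>I. \<forall>j\<in>J. f i j \<in> S"
    "\<forall>i\<in>I. d * c i = (\<Sum>j\<in>J. f i j * c j)" by blast
  show ?thesis
  proof (rule that[of J d f])
    fix g j assume "\<And>j. j \<in> J \<Longrightarrow> g j \<in> S" "(\<Sum>j\<in>J. g j * c j) = 0" "j \<in> J"
    then show "g j = 0" using J(2) unfolding indep_def by blast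
  qed (use J in auto)
qed

definition coeffs_in :: "complex set \<Rightarrow> complex poly \<Rightarrow> bool" where
  "coeffs_in S p \<longleftrightarrow> (\<forall>i. coeff p i \<in> S)"

context
  fixes S :: "complex set"
  assumes S: "csubring S"
begin

lemma coeffs_in_0: "coeffs_in S 0"
  by (simp add: coeffs_in_def subring_0[OF S])

lemma coeffs_in_pCons: "coeffs_in S (pCons a p) \<longleftrightarrow> a \<in> S \<and> coeffs_in S p"
  unfolding coeffs_in_def by (auto simp: coeff_pCons split: nat.splits)

lemma coeffs_in_diff: "coeffs_in S p \<Longrightarrow> coeffs_in S q \<Longrightarrow> coeffs_in S (p - q)"
  by (simp add: coeffs_in_def subring_diff[OF S])

lemma coeffs_in_add: "coeffs_in S p \<Longrightarrow> coeffs_in S q \<Longrightarrow> coeffs_in S (p + q)"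
  by (simp add: coeffs_in_def subring_add[OF S])

lemma coeffs_in_mult: "coeffs_in S p \<Longrightarrow> coeffs_in S q \<Longrightarrow> coeffs_in S (p * q)"
  by (auto simp: coeffs_in_def coeff_mult intro!: subring_sum[OF S] subring_mult[OF S])

lemma coeffs_in_monom: "a \<in> S \<Longrightarrow> coeffs_in S (monom a k)"
  by (simp add: coeffs_in_def subring_0[OF S])

lemma coeffs_in_const: "a \<in> S \<Longrightarrow> coeffs_in S [:a:]"
  by (simp add: coeffs_in_pCons coeffs_in_0)

lemma coeffs_in_smult: "a \<in> S \<Longrightarrow> coeffs_in S p \<Longrightarrow> coeffs_in S (smult a p)"
  by (simp add: coeffs_in_def subring_mult[OF S])

lemma coeffs_in_power: "coeffs_in S p \<Longrightarrow> coeffs_in S (p ^ k)"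
  by (induction k) (auto intro: coeffs_in_mult coeffs_in_const simp: subring_1[OF S] one_pCons)

lemma coeffs_in_sum: "(\<And>i. i \<in> A \<Longrightarrow> coeffs_in S (f i)) \<Longrightarrow> coeffs_in S (\<Sum>i\<in>A. f i)"
  by (induction A rule: infinite_finite_induct) (auto intro: coeffs_in_0 coeffs_in_add)

lemma coeffs_in_prod: "(\<And>i. i \<in> A \<Longrightarrow> coeffs_in S (f i)) \<Longrightarrow> coeffs_in S (\<Prod>i\<in>A. f i)"
  by (induction A rule: infinite_finite_induct)
    (auto intro: coeffs_in_mult coeffs_in_const simp: subring_1[OF S] one_pCons)

lemma coeffs_in_pcompose: "coeffs_in S p \<Longrightarrow> coeffs_in S q \<Longrightarrow> coeffs_in S (pcompose p q)"
  by (induction p) (auto simp: pcompose_pCons coeffs_in_pCons intro!: coeffs_in_0 coeffs_in_add coeffs_in_mult)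

end

definition adjoin :: "complex set \<Rightarrow> complex \<Rightarrow> complex set" where
  "adjoin S z = {poly p z | p. coeffs_in S p}"

lemma csubring_adjoin:
  assumes "csubring S"
  shows "csubring (adjoin S z)"
  unfolding csubring_def adjoin_def
proof safe
  show "\<exists>p. 1 = poly p z \<and> coeffs_in S p"
    using assms by (intro exI[of _ "[:1:]"]) (simp add: coeffs_in_const subring_1)
next
  fix p q assume "coeffs_in S p" "coeffs_in S q"
  then show "\<exists>r. poly p z - poly q z = poly r z \<and> coeffs_in S r"
    "\<exists>r. poly p z * poly q z = poly r z \<and> coeffs_in S r"
    by (metis poly_diff coeffs_in_diff[OF assms], metis poly_mult coeffs_in_mult[OF assms])
qed

lemma adjoin_generator: "csubring S \<Longrightarrow> z \<in> adjoin S z"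
  unfolding adjoin_def
  by (rule CollectI, rule exI[of _ "[:0, 1:]"])
    (simp add: coeffs_in_pCons coeffs_in_0 subring_0 subring_1)

lemma adjoin_base: "csubring S \<Longrightarrow> a \<in> S \<Longrightarrow> a \<in> adjoin S z"
  unfolding adjoin_def by (rule CollectI, rule exI[of _ "[:a:]"]) (simp add: coeffs_in_const)

subsection \<open>Conjugation of roots of unity\<close>

lemma prime_dvd_power_add_diff:
  assumes S: "csubring S" and p: "prime p" and xy: "x \<in> S" "y \<in> S"
  shows "\<exists>w\<in>S. (x + y) ^ p - (x ^ p + y ^ p) = of_nat p * w"
proof -
  have p0: "p > 0" using p prime_gt_0_nat by blast
  define t where "t k = of_nat (p choose k) * x ^ k * y ^ (p - k)" for k
  have "(x + y) ^ p = (\<Sum>k\<in>{..p}. t k)" by (simp add: binomial_ring t_def)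
  also have "{..p} = insert 0 (insert p {0<..<p})" using p0 by auto
  also have "(\<Sum>k\<in>\<dots>. t k) = y ^ p + (x ^ p + (\<Sum>k\<in>{0<..<p}. t k))"
    using p0 by (simp add: t_def)
  finally have "(x + y) ^ p - (x ^ p + y ^ p) = (\<Sum>k\<in>{0<..<p}. t k)" by simp
  also have "\<dots> = (\<Sum>k\<in>{0<..<p}. of_nat p * (of_nat ((p choose k) div p) * x ^ k * y ^ (p - k)))"
  proof (rule sum.cong[OF refl])
    fix k assume "k \<in> {0<..<p}"
    then have "p dvd (p choose k)" using dvd_choose_prime[of k p] p by auto
    then have "p choose k = p * ((p choose k) div p)" by simp
    then have "(of_nat (p choose k) :: complex) = of_nat p * of_nat ((p choose k) div p)"
      by (metis of_nat_mult)
    then show "t k = of_nat p * (of_nat ((p choose k) div p) * x ^ k * y ^ (p - k))"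
      by (simp add: t_def mult.assoc)
  qed
  also have "\<dots> = of_nat p * (\<Sum>k\<in>{0<..<p}. of_nat ((p choose k) div p) * x ^ k * y ^ (p - k))"
    by (simp add: sum_distrib_left)
  finally show ?thesis
    using xy by (intro bexI[of _ "\<Sum>k\<in>{0<..<p}. of_nat ((p choose k) div p) * x ^ k * y ^ (p - k)"])
      (auto intro!: subring_sum[OF S] subring_mult[OF S] subring_power[OF S] subring_of_nat[OF S])
qed

lemma prime_dvd_int_power_diff:
  fixes a :: int
  assumes "prime (p::nat)"
  shows "int p dvd a ^ p - a"
proof -
  have "[a ^ p = a] (mod int p)"
  proof (cases "int p dvd a")
    case True
    then have "int p dvd a ^ p" using assms prime_gt_0_nat by (metis dvd_power dvd_trans dvd_power_same)
    then show ?thesis using True by (simp add: cong_iff_dvd_diff)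
  next
    case False
    define b where "b = nat (a mod int p)"
    have b: "[int b = a] (mod int p)" using assms prime_gt_0_nat[of p] by (simp add: b_def cong_mod_def)
    have "\<not> p dvd b"
    proof
      assume "p dvd b"
      then have "int p dvd int b" by simp
      then show False using b False by (metis cong_dvd_iff)
    qed
    then have "[b ^ (p - 1) = 1] (mod p)" by (rule fermat_theorem[OF assms])
    then have "[int b ^ (p - 1) = 1] (mod int p)" by (metis cong_int_iff of_nat_1 of_nat_power)
    then have "[a ^ (p - 1) = 1] (mod int p)" using b by (metis cong_pow cong_sym cong_trans)
    then have "[a * a ^ (p - 1) = a * 1] (mod int p)" by (rule cong_scalar_left)
    then show ?thesis using assms prime_gt_0_nat[of p] by (simp flip: power_Suc)
  qed
  then show ?thesis by (simp add: cong_iff_dvd_diff)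
qed

text \<open>Modulo \<open>p\<close> the Frobenius map is additive on \<open>adjoin \<int> z\<close>,
  and it fixes the integer coefficients by Fermat's theorem.\<close>

lemma poly_power_prime_cong:
  assumes p: "prime p" and g: "coeffs_in \<int> g"
  shows "\<exists>w\<in>adjoin \<int> z. poly g (z ^ p) - poly g z ^ p = of_nat p * w"
  using g
proof (induction g)
  case 0
  then show ?case using p prime_gt_0_nat subring_0[OF csubring_adjoin[OF csubring_Ints]]
    by (intro bexI[of _ 0]) (auto simp: power_0_left)
next
  case (pCons a g)
  let ?R = "adjoin \<int> z"
  have R: "csubring ?R" by (rule csubring_adjoin[OF csubring_Ints])
  have z: "z \<in> ?R" by (rule adjoin_generator[OF csubring_Ints])
  have a: "a \<in> \<int>" "coeffs_in \<int> g" using pCons.prems by (simp_all add: coeffs_in_pCons[OF csubring_Ints])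
  have aR: "a \<in> ?R" using a adjoin_base[OF csubring_Ints] by blast
  have gz: "poly g z \<in> ?R" using a by (auto simp: adjoin_def)
  obtain w where w: "w \<in> ?R" "poly g (z ^ p) - poly g z ^ p = of_nat p * w" using pCons.IH a by blast
  obtain w' where w': "w' \<in> ?R" "(a + z * poly g z) ^ p - (a ^ p + (z * poly g z) ^ p) = of_nat p * w'"
    using prime_dvd_power_add_diff[OF R p aR subring_mult[OF R z gz]] by blast
  obtain m where m: "a = of_int m" using a by (auto elim: Ints_cases)
  obtain q where q: "m ^ p - m = int p * q" using prime_dvd_int_power_diff[OF p] by (metis dvdE)
  have aq: "a ^ p - a = of_nat p * of_int q"
    unfolding m using arg_cong[OF q, of of_int] by simp
  have "poly (pCons a g) (z ^ p) - poly (pCons a g) z ^ p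
      = z ^ p * (poly g (z ^ p) - poly g z ^ p) - (a ^ p - a) - ((a + z * poly g z) ^ p - (a ^ p + (z * poly g z) ^ p))"
    by (simp add: power_mult_distrib algebra_simps)
  also have "\<dots> = of_nat p * (z ^ p * w - of_int q - w')"
    unfolding w(2) w'(2) aq by (simp add: algebra_simps)
  finally show ?case
    using w w' z by (intro bexI[of _ "z ^ p * w - of_int q - w'"])
      (auto intro!: subring_diff[OF R] subring_mult[OF R] subring_power[OF R] subring_of_int[OF R])
qed

text \<open>Multiplication by \<open>d\<close> sends the ring into the free module over the integers
  on an independent family of powers of \<open>z\<close>. Every such \<open>p\<close> divides a
  fixed nonzero integer coordinate of \<open>d * x\<close>.\<close>

lemma adjoin_Ints_bounded_divisors:
  assumes z: "z ^ n = 1" "n > 0" and x: "x \<in> adjoin \<int> z" "x \<noteq> 0"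
  shows "\<exists>A::nat. \<forall>p w. w \<in> adjoin \<int> z \<longrightarrow> x = of_nat p * w \<longrightarrow> p \<le> A"
proof -
  obtain J d f where J: "J \<subseteq> {..<n}" "d \<in> \<int>" "d \<noteq> 0" "\<And>i j. i \<in> {..<n} \<Longrightarrow> j \<in> J \<Longrightarrow> f i j \<in> \<int>"
    "\<And>i. i \<in> {..<n} \<Longrightarrow> d * z ^ i = (\<Sum>j\<in>J. f i j * z ^ j)"
    "\<And>g j. (\<And>j. j \<in> J \<Longrightarrow> g j \<in> \<int>) \<Longrightarrow> (\<Sum>j\<in>J. g j * z ^ j) = 0 \<Longrightarrow> j \<in> J \<Longrightarrow> g j = 0"
    using subring_independent_subfamily[OF csubring_Ints, of "{..<n}" "\<lambda>i. z ^ i"] by blast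
  have repr: "\<exists>Y. (\<forall>j\<in>J. Y j \<in> \<int>) \<and> d * y = (\<Sum>j\<in>J. Y j * z ^ j)" if "y \<in> adjoin \<int> z" for y
  proof -
    obtain q where q: "coeffs_in \<int> q" "y = poly q z" using \<open>y \<in> adjoin \<int> z\<close> by (auto simp: adjoin_def)
    define Y where "Y j = (\<Sum>i\<le>degree q. coeff q i * f (i mod n) j)" for j
    have "d * y = (\<Sum>i\<le>degree q. coeff q i * (d * z ^ (i mod n)))"
      unfolding q poly_altdef power_mod_eq[OF z(1)] by (simp add: sum_distrib_left algebra_simps)
    also have "\<dots> = (\<Sum>i\<le>degree q. coeff q i * (\<Sum>j\<in>J. f (i mod n) j * z ^ j))"
      using J(5) z(2) by simp
    also have "\<dots> = (\<Sum>j\<in>J. Y j * z ^ j)"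
      unfolding Y_def sum_distrib_left sum_distrib_right by (subst sum.swap) (simp add: mult.assoc)
    finally have "d * y = (\<Sum>j\<in>J. Y j * z ^ j)" .
    moreover have "Y j \<in> \<int>" if "j \<in> J" for j
      unfolding Y_def using q(1) J(4) z(2) that by (intro Ints_sum Ints_mult) (auto simp: coeffs_in_def)
    ultimately show ?thesis by blast
  qed
  obtain X where X: "\<forall>j\<in>J. X j \<in> \<int>" "d * x = (\<Sum>j\<in>J. X j * z ^ j)" using repr[OF x(1)] by blast
  have "\<exists>j\<in>J. X j \<noteq> 0"
  proof (rule ccontr)
    assume "\<not> ?thesis"
    then have "d * x = 0" unfolding X(2) by (intro sum.neutral) auto
    then show False using x J by simp
  qed
  then obtain j where j: "j \<in> J" "X j \<noteq> 0" by blast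
  obtain k where k: "X j = of_int k" using X j by (metis Ints_cases)
  have "p \<le> nat \<bar>k\<bar>" if w: "w \<in> adjoin \<int> z" "x = of_nat p * w" for p w
  proof -
    obtain W where W: "\<forall>j\<in>J. W j \<in> \<int>" "d * w = (\<Sum>j\<in>J. W j * z ^ j)" using repr[OF w(1)] by blast
    have "(\<Sum>j\<in>J. (X j - of_nat p * W j) * z ^ j) = d * x - of_nat p * (d * w)"
      unfolding X W by (simp add: sum_subtractf sum_distrib_left algebra_simps)
    also have "\<dots> = 0" using w by simp
    finally have "X j - of_nat p * W j = 0"
      using J(6)[of "\<lambda>j. X j - of_nat p * W j" j] X W j by auto
    moreover obtain l where l: "W j = of_int l" using W j by (metis Ints_cases)
    ultimately have "(of_int k :: complex) = of_int (int p * l)" using k by simp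
    then have "k = int p * l" by (simp only: of_int_eq_iff)
    moreover have "k \<noteq> 0" using j k by auto
    ultimately show ?thesis by (metis abs_mult abs_of_nat dvd_imp_le_int dvd_triv_left int_nat_eq nat_le_iff le_nat_iff abs_ge_zero)
  qed
  then show ?thesis by blast
qed

text \<open>
  Landau's argument: for a prime \<open>p\<close>, \<open>poly g (z ^ p)\<close> is divisible by \<open>p\<close> and takes one of finitely
  many values, so it vanishes for large \<open>p\<close>; every residue class coprime to \<open>n\<close> contains numbers
  without small prime factors.
\<close>

lemma int_poly_root_of_unity_conjugate:
  assumes z: "z ^ n = 1" "n > 0" and g: "coeffs_in \<int> g" and root: "poly g z = 0" and s: "coprime s n"
  shows "poly g (z ^ s) = 0"
proof -
  have "\<exists>A::nat. \<forall>p. prime p \<longrightarrow> p > A \<longrightarrow> (\<forall>y. y ^ n = 1 \<longrightarrow> poly g y = 0 \<longrightarrow> poly g (y ^ p) = 0)"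
  proof -
    \<comment> \<open>The value at \<open>y ^ p\<close> depends only on \<open>y\<close> and
      \<open>p mod n\<close>. The bound must serve all \<open>n\<close>-th roots of unity
      \<open>y\<close>, because the primes of a composite exponent are applied one after
      another.\<close>
    let ?T = "{y::complex. y ^ n = 1} \<times> {..<n}"
    have fin: "finite ?T" using z by (simp add: finite_roots_unity Suc_le_eq)
    have "\<forall>t\<in>?T. \<exists>A::nat. poly g (fst t ^ snd t) \<noteq> 0 \<longrightarrow>
      (\<forall>p w. w \<in> adjoin \<int> (fst t) \<longrightarrow> poly g (fst t ^ snd t) = of_nat p * w \<longrightarrow> p \<le> A)"
    proof
      fix t assume t: "t \<in> ?T"
      have "coeffs_in \<int> (pcompose g (monom 1 (snd t)))"
        by (intro coeffs_in_pcompose[OF csubring_Ints] g coeffs_in_monom[OF csubring_Ints]) simp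
      then have "poly g (fst t ^ snd t) \<in> adjoin \<int> (fst t)"
        unfolding adjoin_def by (intro CollectI exI[of _ "pcompose g (monom 1 (snd t))"])
          (simp add: poly_pcompose poly_monom)
      then show "\<exists>A::nat. poly g (fst t ^ snd t) \<noteq> 0 \<longrightarrow>
        (\<forall>p w. w \<in> adjoin \<int> (fst t) \<longrightarrow> poly g (fst t ^ snd t) = of_nat p * w \<longrightarrow> p \<le> A)"
        using adjoin_Ints_bounded_divisors[of "fst t" n] t z(2) by auto
    qed
    then obtain A :: "complex \<times> nat \<Rightarrow> nat" where A: "\<forall>t\<in>?T. poly g (fst t ^ snd t) \<noteq> 0 \<longrightarrow>
      (\<forall>p w. w \<in> adjoin \<int> (fst t) \<longrightarrow> poly g (fst t ^ snd t) = of_nat p * w \<longrightarrow> p \<le> A t)"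
      by (rule bchoice[THEN exE])
    show ?thesis
    proof (intro exI[of _ "Max (A ` ?T)"] allI impI)
      fix p y assume p: "prime p" "p > Max (A ` ?T)" and y: "y ^ n = 1" "poly g y = 0"
      have t: "(y, p mod n) \<in> ?T" using y z by simp
      then have "A (y, p mod n) \<le> Max (A ` ?T)" using fin by simp
      then have lt: "A (y, p mod n) < p" using p by simp
      obtain w where w: "w \<in> adjoin \<int> y" "poly g (y ^ p) - poly g y ^ p = of_nat p * w"
        using poly_power_prime_cong[OF p(1) g] by blast
      then have "poly g (y ^ (p mod n)) = of_nat p * w"
        using y p prime_gt_0_nat[of p] by (simp add: power_mod_eq power_0_left)
      moreover have "poly g (y ^ (p mod n)) \<noteq> 0 \<longrightarrow>
          (\<forall>p' w. w \<in> adjoin \<int> y \<longrightarrow> poly g (y ^ (p mod n)) = of_nat p' * w \<longrightarrow> p' \<le> A (y, p mod n))"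
        using bspec[OF A t] by simp
      ultimately have "poly g (y ^ (p mod n)) = 0" using w(1) lt by (metis not_le)
      then show "poly g (y ^ p) = 0" using y by (simp add: power_mod_eq)
    qed
  qed
  then obtain A where A: "\<And>p y. prime p \<Longrightarrow> p > A \<Longrightarrow> y ^ n = 1 \<Longrightarrow> poly g y = 0 \<Longrightarrow> poly g (y ^ p) = 0" by blast
  have big: "poly g (y ^ m) = 0" if "m > 0" "\<And>p. prime p \<Longrightarrow> p dvd m \<Longrightarrow> p > A" "y ^ n = 1" "poly g y = 0" for m y
    using that
  proof (induction m arbitrary: y rule: less_induct)
    case (less m)
    show ?case
    proof (cases "m = 1")
      case False
      then obtain p where p: "prime p" "p dvd m" using prime_factor_nat by blast
      then obtain m' where m': "m = p * m'" by blast
      have "poly g ((y ^ p) ^ m') = 0"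
      proof (rule less.IH)
        show "m' < m" using m' p less.prems prime_gt_1_nat[of p] by simp
        show "poly g (y ^ p) = 0" using A p less.prems by blast
      qed (use less.prems m' root_of_unity_power[of y n] in auto)
      then show ?thesis by (simp add: m' power_mult)
    qed (use less.prems in simp)
  qed
  \<comment> \<open>The summand 2 makes the factorial even, which excludes \<open>m = 0\<close>
    below.\<close>
  have "(fact (A + 2) :: nat) > 0" by simp
  then obtain m where m: "[m = s] (mod n)" "coprime m (fact (A + 2) :: nat)" using coprime_lift[OF s] by blast
  have m0: "m > 0"
  proof (rule ccontr)
    assume "\<not> m > 0"
    then have "(fact (A + 2) :: nat) dvd 1" using m(2) by simp
    moreover have "(2 :: nat) dvd fact (A + 2)" by (rule dvd_fact) auto
    ultimately have "(2 :: nat) dvd 1" using dvd_trans by blast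
    then show False by simp
  qed
  have "poly g (z ^ m) = 0"
  proof (rule big[OF m0 _ z(1) root])
    fix p assume p: "prime p" "p dvd m"
    show "p > A"
    proof (rule ccontr)
      assume "\<not> p > A"
      then have "p dvd fact (A + 2)" using p prime_gt_0_nat[of p] by (intro dvd_fact) auto
      then show False using m p by (meson coprime_common_divisor not_prime_unit)
    qed
  qed
  moreover have "z ^ m = z ^ s"
    using m(1) unfolding cong_mod_def by (metis power_mod_eq[OF z(1)])
  ultimately show ?thesis by simp
qed

lemma coeffs_in_Rats_clear_denominators:
  assumes "coeffs_in \<rat> g"
  obtains D :: nat where "D > 0" "coeffs_in \<int> (smult (of_nat D) g)"
  using assms
proof (induction g arbitrary: thesis)
  case 0
  then show ?case by (auto simp: coeffs_in_0[OF csubring_Ints])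
next
  case (pCons a g)
  then have a: "a \<in> \<rat>" "coeffs_in \<rat> g" by (simp_all add: coeffs_in_pCons[OF csubring_Rats])
  then obtain D where D: "D > 0" "coeffs_in \<int> (smult (of_nat D) g)" using pCons.IH by blast
  obtain m n :: int where mn: "n > 0" "a = of_int m / of_int n" using a(1) by (metis Rats_cases')
  have na: "of_nat (nat n) * a = of_int m" using mn by simp
  show ?case
  proof (rule pCons.prems(1)[of "D * nat n"])
    show "D * nat n > 0" using D mn by simp
    have "of_nat (D * nat n) * a = of_nat D * of_int m" using na by (simp add: mult.assoc)
    then have "of_nat (D * nat n) * a \<in> \<int>" by (metis Ints_mult Ints_of_nat Ints_of_int)
    moreover have "coeffs_in \<int> (smult (of_nat (nat n)) (smult (of_nat D) g))"
      by (rule coeffs_in_smult[OF csubring_Ints _ D(2)]) simp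
    then have "coeffs_in \<int> (smult (of_nat (D * nat n)) g)" by (simp add: mult.commute)
    ultimately show "coeffs_in \<int> (smult (of_nat (D * nat n)) (pCons a g))"
      by (simp del: of_nat_mult add: coeffs_in_pCons[OF csubring_Ints])
  qed
qed

lemma rat_poly_root_of_unity_conjugate:
  assumes z: "z ^ n = 1" "n > 0" and g: "coeffs_in \<rat> g" and root: "poly g z = 0" and s: "coprime s n"
  shows "poly g (z ^ s) = 0"
proof -
  obtain D :: nat where D: "D > 0" "coeffs_in \<int> (smult (of_nat D) g)"
    using coeffs_in_Rats_clear_denominators[OF g] .
  have "poly (smult (of_nat D) g) (z ^ s) = 0"
    by (rule int_poly_root_of_unity_conjugate[OF z D(2) _ s]) (simp add: root)
  then show ?thesis using D(1) by simp
qed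

subsection \<open>Cyclotomic fields\<close>

definition zeta :: "nat \<Rightarrow> complex" where
  "zeta n = cis (2 * pi / real n)"

definition cyc :: "nat \<Rightarrow> complex set" where
  "cyc n = adjoin \<rat> (zeta n)"

text \<open>The automorphism \<open>zeta n \<mapsto> zeta n ^ s\<close>; meaningful only for \<open>s\<close> coprime to \<open>n\<close> and \<open>x \<in> cyc n\<close>.\<close>

definition sigma :: "nat \<Rightarrow> nat \<Rightarrow> complex \<Rightarrow> complex" where
  "sigma n s x = poly (SOME p. coeffs_in \<rat> p \<and> poly p (zeta n) = x) (zeta n ^ s)"

lemma zeta_power_self: "n > 0 \<Longrightarrow> zeta n ^ n = 1"
  by (simp add: zeta_def DeMoivre)

lemma root_of_unity_eq_zeta_power:
  assumes "w ^ n = 1" "n > 0"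
  obtains j where "w = zeta n ^ j"
proof -
  have "w \<in> (\<lambda>k. cis (2 * pi * real k / real n)) ` {..<n}"
    using bij_betw_roots_unity[OF assms(2)] assms(1) by (auto simp: bij_betw_def)
  then obtain k where "w = cis (2 * pi * real k / real n)" by blast
  then have "w = zeta n ^ k" by (simp add: zeta_def DeMoivre mult.commute)
  then show ?thesis using that by blast
qed

lemma csubring_cyc: "csubring (cyc n)"
  unfolding cyc_def by (rule csubring_adjoin[OF csubring_Rats])

lemma Rats_subset_cyc: "q \<in> \<rat> \<Longrightarrow> q \<in> cyc n"
  unfolding cyc_def by (rule adjoin_base[OF csubring_Rats])

lemma root_of_unity_in_cyc:
  assumes "w ^ n = 1" "n > 0"
  shows "w \<in> cyc n"
proof -
  obtain j where "w = zeta n ^ j" using root_of_unity_eq_zeta_power[OF assms] .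
  then show ?thesis unfolding cyc_def
    using subring_power[OF csubring_adjoin[OF csubring_Rats] adjoin_generator[OF csubring_Rats]]
    by simp
qed

lemma cyc_mono:
  assumes "n dvd m" "m > 0"
  shows "cyc n \<subseteq> cyc m"
proof
  fix x assume "x \<in> cyc n"
  then obtain p where p: "coeffs_in \<rat> p" "x = poly p (zeta n)" by (auto simp: cyc_def adjoin_def)
  have n0: "n > 0" using assms by (metis dvd_0_left_iff neq0_conv)
  have "zeta n ^ m = 1"
    using zeta_power_self[OF n0] assms by (auto simp: power_mult elim!: dvdE)
  then obtain k where k: "zeta n = zeta m ^ k" using root_of_unity_eq_zeta_power assms by blast
  have "x = poly (pcompose p (monom 1 k)) (zeta m)" by (simp add: p k poly_pcompose poly_monom)
  moreover have "coeffs_in \<rat> (pcompose p (monom 1 k))"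
    by (intro coeffs_in_pcompose[OF csubring_Rats] p coeffs_in_monom[OF csubring_Rats]) simp
  ultimately show "x \<in> cyc m" unfolding cyc_def adjoin_def by blast
qed

lemma cnj_Rats:
  assumes "q \<in> \<rat>"
  shows "cnj q = q"
proof -
  obtain a b :: int where "q = of_int a / of_int b" using assms by (metis Rats_cases')
  then show ?thesis by simp
qed

context
  fixes n :: nat
  assumes n: "n > 1"
begin

text \<open>Two rational polynomials that agree at \<open>zeta n\<close> agree at its conjugates, so
  the value does not depend on the choice made in \<open>sigma\<close>.\<close>

lemma sigma_poly:
  assumes "coprime s n" "coeffs_in \<rat> p"
  shows "sigma n s (poly p (zeta n)) = poly p (zeta n ^ s)"
proof -
  let ?q = "SOME q. coeffs_in \<rat> q \<and> poly q (zeta n) = poly p (zeta n)"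
  have "\<exists>q. coeffs_in \<rat> q \<and> poly q (zeta n) = poly p (zeta n)" using assms by blast
  then have q: "coeffs_in \<rat> ?q" "poly ?q (zeta n) = poly p (zeta n)"
    using someI_ex[of "\<lambda>q. coeffs_in \<rat> q \<and> poly q (zeta n) = poly p (zeta n)"] by blast+
  have "poly (?q - p) (zeta n ^ s) = 0"
  proof (rule rat_poly_root_of_unity_conjugate[OF _ _ _ _ assms(1)])
    show "coeffs_in \<rat> (?q - p)" by (rule coeffs_in_diff[OF csubring_Rats q(1) assms(2)])
    show "poly (?q - p) (zeta n) = 0" using q(2) by simp
  qed (use n zeta_power_self[of n] in auto)
  then show ?thesis by (simp add: sigma_def)
qed

lemma cycE:
  assumes "x \<in> cyc n"
  obtains p where "coeffs_in \<rat> p" "x = poly p (zeta n)"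
  using assms by (auto simp: cyc_def adjoin_def)

lemma sigma_add:
  assumes "coprime s n" "x \<in> cyc n" "y \<in> cyc n"
  shows "sigma n s (x + y) = sigma n s x + sigma n s y"
proof -
  obtain p where p: "coeffs_in \<rat> p" "x = poly p (zeta n)" using cycE[OF assms(2)] .
  obtain q where q: "coeffs_in \<rat> q" "y = poly q (zeta n)" using cycE[OF assms(3)] .
  have "sigma n s (poly (p + q) (zeta n)) = poly (p + q) (zeta n ^ s)"
    by (rule sigma_poly[OF assms(1) coeffs_in_add[OF csubring_Rats p(1) q(1)]])
  then show ?thesis using p q by (simp add: sigma_poly[OF assms(1)])
qed

lemma sigma_mult:
  assumes "coprime s n" "x \<in> cyc n" "y \<in> cyc n"
  shows "sigma n s (x * y) = sigma n s x * sigma n s y"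
proof -
  obtain p where p: "coeffs_in \<rat> p" "x = poly p (zeta n)" using cycE[OF assms(2)] .
  obtain q where q: "coeffs_in \<rat> q" "y = poly q (zeta n)" using cycE[OF assms(3)] .
  have "sigma n s (poly (p * q) (zeta n)) = poly (p * q) (zeta n ^ s)"
    by (rule sigma_poly[OF assms(1) coeffs_in_mult[OF csubring_Rats p(1) q(1)]])
  then show ?thesis using p q by (simp add: sigma_poly[OF assms(1)])
qed

lemma sigma_Rats:
  assumes "coprime s n" "q \<in> \<rat>"
  shows "sigma n s q = q"
  using sigma_poly[OF assms(1) coeffs_in_const[OF csubring_Rats assms(2)]] by simp

lemma sigma_sum:
  assumes "coprime s n" "\<And>i. i \<in> A \<Longrightarrow> f i \<in> cyc n"
  shows "sigma n s (\<Sum>i\<in>A. f i) = (\<Sum>i\<in>A. sigma n s (f i))"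
  using assms(2)
  by (induction A rule: infinite_finite_induct)
    (auto simp: sigma_Rats[OF assms(1)] sigma_add[OF assms(1)] subring_sum[OF csubring_cyc])

lemma sigma_prod:
  assumes "coprime s n" "\<And>i. i \<in> A \<Longrightarrow> f i \<in> cyc n"
  shows "sigma n s (\<Prod>i\<in>A. f i) = (\<Prod>i\<in>A. sigma n s (f i))"
  using assms(2)
  by (induction A rule: infinite_finite_induct)
    (auto simp: sigma_Rats[OF assms(1)] sigma_mult[OF assms(1)] subring_prod[OF csubring_cyc])

lemma sigma_power:
  assumes "coprime s n" "x \<in> cyc n"
  shows "sigma n s (x ^ k) = sigma n s x ^ k"
  by (induction k)
    (auto simp: sigma_Rats[OF assms(1)] sigma_mult[OF assms(1)] assms subring_power[OF csubring_cyc])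

lemma sigma_root_of_unity:
  assumes "coprime s n" "w ^ n = 1"
  shows "sigma n s w = w ^ s"
proof -
  obtain j where j: "w = zeta n ^ j" using root_of_unity_eq_zeta_power[OF assms(2)] n by auto
  have "sigma n s (poly (monom 1 j) (zeta n)) = poly (monom 1 j) (zeta n ^ s)"
    by (rule sigma_poly[OF assms(1) coeffs_in_monom[OF csubring_Rats]]) simp
  then show ?thesis by (simp add: j poly_monom flip: power_mult) (simp add: mult.commute)
qed

lemma sigma_in_cyc:
  assumes "coprime s n" "x \<in> cyc n"
  shows "sigma n s x \<in> cyc n"
proof -
  obtain p where p: "coeffs_in \<rat> p" "x = poly p (zeta n)" using cycE[OF assms(2)] .
  have "sigma n s x = poly (pcompose p (monom 1 s)) (zeta n)"
    using p by (simp add: sigma_poly[OF assms(1)] poly_pcompose poly_monom)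
  moreover have "coeffs_in \<rat> (pcompose p (monom 1 s))"
    by (intro coeffs_in_pcompose[OF csubring_Rats] p coeffs_in_monom[OF csubring_Rats]) simp
  ultimately show ?thesis unfolding cyc_def adjoin_def by blast
qed

lemma sigma_sigma:
  assumes "coprime s n" "coprime t n" "x \<in> cyc n"
  shows "sigma n t (sigma n s x) = sigma n (s * t) x"
proof -
  obtain p where p: "coeffs_in \<rat> p" "x = poly p (zeta n)" using cycE[OF assms(3)] .
  let ?q = "pcompose p (monom 1 s)"
  have q: "coeffs_in \<rat> ?q"
    by (intro coeffs_in_pcompose[OF csubring_Rats] p coeffs_in_monom[OF csubring_Rats]) simp
  have "sigma n s x = poly ?q (zeta n)"
    using p by (simp add: sigma_poly[OF assms(1)] poly_pcompose poly_monom)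
  then have "sigma n t (sigma n s x) = poly ?q (zeta n ^ t)" using sigma_poly[OF assms(2) q] by simp
  also have "\<dots> = poly p (zeta n ^ (s * t))"
    by (simp add: poly_pcompose poly_monom flip: power_mult) (simp add: mult.commute)
  also have "\<dots> = sigma n (s * t) x" using p assms by (simp add: sigma_poly)
  finally show ?thesis .
qed

lemma sigma_mod: "sigma n (s mod n) x = sigma n s x"
  using power_mod_eq[OF zeta_power_self] n by (simp add: sigma_def)

lemma sigma_1: "x \<in> cyc n \<Longrightarrow> sigma n 1 x = x"
  by (erule cycE) (simp add: sigma_poly)

text \<open>An inverse exponent modulo \<open>n\<close> undoes \<open>sigma n s\<close>.\<close>

lemma sigma_eq_0:
  assumes "coprime s n" "x \<in> cyc n" "sigma n s x = 0"
  shows "x = 0"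
proof -
  obtain t where t: "[s * t = 1] (mod n)" using assms(1) by (metis cong_solve_coprime_nat One_nat_def)
  then have "coprime (s * t) n" using n by (metis coprime_1_left cong_gcd_eq coprime_iff_gcd_eq_1)
  then have ct: "coprime t n" by simp
  have "sigma n (s * t) x = x"
    using t n sigma_mod[of "s * t"] sigma_1[OF assms(2)]
    by (simp add: cong_mod_def)
  then show ?thesis using sigma_sigma[OF assms(1) ct assms(2)] assms(3) sigma_Rats[OF ct, of 0] by simp
qed

lemma coprime_pred: "coprime (n - 1) n"
  using n coprime_Suc_right_nat[of "n - 1"] by simp

text \<open>The exponent \<open>n - 1\<close> acts as -1, so complex conjugation is one of the
  automorphisms.\<close>

lemma sigma_pred_cnj:
  assumes "x \<in> cyc n"
  shows "sigma n (n - 1) x = cnj x"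
proof -
  obtain p where p: "coeffs_in \<rat> p" "x = poly p (zeta n)" using cycE[OF assms] .
  have "zeta n * zeta n ^ (n - 1) = 1"
    using zeta_power_self[of n] n by (simp flip: power_Suc)
  moreover have "zeta n * cnj (zeta n) = 1" by (simp add: zeta_def cis_cnj cis_mult)
  moreover have "zeta n \<noteq> 0" by (simp add: zeta_def)
  ultimately have "zeta n ^ (n - 1) = cnj (zeta n)" by (metis mult_left_cancel)
  moreover have "cnj (coeff p i) = coeff p i" for i
    using p(1) by (simp add: coeffs_in_def cnj_Rats)
  then have "cnj (poly p (zeta n)) = poly p (cnj (zeta n))" by (simp add: poly_altdef)
  ultimately show ?thesis using p sigma_poly[OF coprime_pred p(1)] by simp
qed

text \<open>The automorphisms commute because their exponents do; in particular real elements have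
  real conjugates.\<close>

lemma cnj_sigma:
  assumes "coprime s n" "x \<in> cyc n"
  shows "cnj (sigma n s x) = sigma n s (cnj x)"
  using sigma_sigma[OF assms(1) coprime_pred assms(2)] sigma_sigma[OF coprime_pred assms(1) assms(2)]
    sigma_pred_cnj[OF assms(2)] sigma_pred_cnj[OF sigma_in_cyc[OF assms]]
  by (simp add: mult.commute)

end

text \<open>These are Ramanujan sums. Summing over all multiples of a divisor \<open>g\<close> gives
  a geometric sum, equal to 0 or \<open>n / g\<close>; grouping by \<open>gcd s n\<close> and
  descending from large \<open>g\<close> isolates the part with gcd exactly
  \<open>g\<close>.\<close>

lemma sum_totatives_root_of_unity_rational:
  fixes w :: complex
  assumes w: "w ^ n = 1" and n: "n > 0"
  shows "(\<Sum>s\<in>totatives n. w ^ s) \<in> \<rat>"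
proof -
  define T where "T g = (\<Sum>s\<in>{s\<in>{1..n}. gcd s n = g}. w ^ s)" for g
  have "T g \<in> \<rat>" if "g dvd n" for g
    using that
  proof (induction "n - g" arbitrary: g rule: less_induct)
    case less
    have g: "g > 0" "g \<le> n" using less.prems n by (auto intro: dvd_imp_le Nat.gr0I)
    obtain m where m: "n = g * m" using less.prems by blast
    let ?D = "{g'. g' dvd n \<and> g dvd g'}"
    have finD: "finite ?D" using n by (auto intro: finite_subset[OF _ finite_divisors_nat[OF n]])
    have "bij_betw (\<lambda>j. g * j) {1..m} {s\<in>{1..n}. g dvd s}"
      unfolding bij_betw_def
    proof
      show "inj_on (\<lambda>j. g * j) {1..m}" using g by (auto intro: inj_onI)
      show "(\<lambda>j. g * j) ` {1..m} = {s\<in>{1..n}. g dvd s}"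
        using g m by (auto simp: image_iff Suc_le_eq)
    qed
    then have "(\<Sum>s\<in>{s\<in>{1..n}. g dvd s}. w ^ s) = (\<Sum>j\<in>{1..m}. w ^ (g * j))"
      by (rule sum.reindex_bij_betw[symmetric])
    also have "\<dots> = (\<Sum>j\<in>{1..m}. (w ^ g) ^ j)" by (simp add: power_mult)
    also have "\<dots> = w ^ g * (\<Sum>j<m. (w ^ g) ^ j)"
      unfolding sum_distrib_left by (rule sum.reindex_bij_witness[of _ Suc "\<lambda>j. j - 1"]) (auto simp flip: power_Suc)
    also have "\<dots> \<in> \<rat>"
      using sum_powers_root_of_unity[of "w ^ g" m] w m by (simp add: power_mult)
    finally have R: "(\<Sum>s\<in>{s\<in>{1..n}. g dvd s}. w ^ s) \<in> \<rat>" .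
    have "(\<Sum>s\<in>{s\<in>{1..n}. g dvd s}. w ^ s) = (\<Sum>g'\<in>?D. \<Sum>s\<in>{s\<in>{s\<in>{1..n}. g dvd s}. gcd s n = g'}. w ^ s)"
      using finD less.prems by (intro sum.group[symmetric]) auto
    also have "\<dots> = (\<Sum>g'\<in>?D. T g')"
      unfolding T_def by (intro sum.cong refl) auto
    also have "\<dots> = T g + (\<Sum>g'\<in>?D - {g}. T g')" using finD less.prems by (intro sum.remove) auto
    finally have "T g = (\<Sum>s\<in>{s\<in>{1..n}. g dvd s}. w ^ s) - (\<Sum>g'\<in>?D - {g}. T g')" by simp
    moreover have "(\<Sum>g'\<in>?D - {g}. T g') \<in> \<rat>"
    proof (rule subring_sum[OF csubring_Rats])
      fix g' assume g': "g' \<in> ?D - {g}"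
      then have "g' \<le> n" "g' > 0" using n by (auto intro: dvd_imp_le Nat.gr0I)
      moreover have "g \<le> g'" using g' \<open>g' > 0\<close> by (auto intro: dvd_imp_le)
      ultimately show "T g' \<in> \<rat>" using g' by (intro less.hyps) auto
    qed
    ultimately show ?case using R by simp
  qed
  then have "T 1 \<in> \<rat>" by simp
  moreover have "{s\<in>{1..n}. gcd s n = 1} = totatives n"
    unfolding totatives_def coprime_iff_gcd_eq_1[symmetric] by auto
  ultimately show ?thesis by (simp add: T_def)
qed

text \<open>A fixed element is the mean of its conjugates, and the mean of the conjugates of each
  power of \<open>zeta n\<close> is rational by the preceding sum.\<close>

lemma sigma_fixed_imp_Rats:
  assumes n: "n > 1" and x: "x \<in> cyc n" and fixed: "\<And>s. s \<in> totatives n \<Longrightarrow> sigma n s x = x"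
  shows "x \<in> \<rat>"
proof -
  obtain p where p: "coeffs_in \<rat> p" "x = poly p (zeta n)" using x by (auto simp: cyc_def adjoin_def)
  have "of_nat (totient n) * x = (\<Sum>s\<in>totatives n. sigma n s x)" using fixed by (simp add: totient_def)
  also have "\<dots> = (\<Sum>s\<in>totatives n. \<Sum>i\<le>degree p. coeff p i * (zeta n ^ i) ^ s)"
  proof (rule sum.cong[OF refl])
    fix s assume "s \<in> totatives n"
    then have "coprime s n" by (simp add: totatives_def)
    then show "sigma n s x = (\<Sum>i\<le>degree p. coeff p i * (zeta n ^ i) ^ s)"
      using sigma_poly[OF n _ p(1)] p(2) by (simp add: poly_altdef mult.commute flip: power_mult)
  qed
  also have "\<dots> = (\<Sum>i\<le>degree p. coeff p i * (\<Sum>s\<in>totatives n. (zeta n ^ i) ^ s))"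
    by (subst sum.swap) (simp add: sum_distrib_left)
  also have "\<dots> \<in> \<rat>"
    using p(1) n zeta_power_self[of n]
    by (intro subring_sum[OF csubring_Rats] Rats_mult sum_totatives_root_of_unity_rational root_of_unity_power)
      (auto simp: coeffs_in_def)
  finally have "of_nat (totient n) * x / of_nat (totient n) \<in> \<rat>" by (intro Rats_divide) auto
  then show ?thesis using n by simp
qed

definition csubfield :: "complex set \<Rightarrow> bool" where
  "csubfield F \<longleftrightarrow> csubring F \<and> (\<forall>x\<in>F. inverse x \<in> F)"

text \<open>The norm, that is the product of the conjugates, is fixed by every automorphism and so
  rational. The product of the other conjugates divided by the norm is the inverse.\<close>

lemma csubfield_cyc:
  assumes n: "n > 1"
  shows "csubfield (cyc n)"
  unfolding csubfield_def
proof (intro conjI ballI)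
  show ring: "csubring (cyc n)" by (rule csubring_cyc)
  fix x assume x: "x \<in> cyc n"
  show "inverse x \<in> cyc n"
  proof (cases "x = 0")
    case False
    have cop: "coprime s n" if "s \<in> totatives n" for s using that by (simp add: totatives_def)
    have one: "1 \<in> totatives n" using n by (auto simp: totatives_def)
    define N where "N = (\<Prod>s\<in>totatives n. sigma n s x)"
    have cyc: "sigma n s x \<in> cyc n" if "s \<in> totatives n" for s using sigma_in_cyc[OF n cop[OF that] x] .
    have "N \<in> \<rat>"
    proof (rule sigma_fixed_imp_Rats[OF n])
      show "N \<in> cyc n" unfolding N_def using cyc by (intro subring_prod[OF ring])
      fix t assume t: "t \<in> totatives n"
      let ?h = "\<lambda>s. s * t mod n"
      have "inj_on ?h (totatives n)"
      proof (rule inj_onI)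
        fix a b assume ab: "a \<in> totatives n" "b \<in> totatives n" "a * t mod n = b * t mod n"
        then have "[a = b] (mod n)"
          using cong_mult_rcancel_nat[OF cop[OF t]] by (simp add: cong_mod_def)
        then show "a = b" using ab n totatives_less by (simp add: cong_mod_def)
      qed
      moreover have "?h ` totatives n \<subseteq> totatives n"
        using unit_subgroup_totatives[OF n] t by (auto simp: unit_subgroup_def)
      ultimately have bij: "bij_betw ?h (totatives n) (totatives n)"
        unfolding bij_betw_def using endo_inj_surj[OF finite_totatives] by blast
      have "sigma n t N = (\<Prod>s\<in>totatives n. sigma n t (sigma n s x))"
        unfolding N_def using cyc by (rule sigma_prod[OF n cop[OF t]])
      also have "\<dots> = (\<Prod>s\<in>totatives n. sigma n (?h s) x)"
        by (intro prod.cong refl) (simp add: sigma_mod[OF n] sigma_sigma[OF n cop cop[OF t] x])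
      also have "\<dots> = N" unfolding N_def by (rule prod.reindex_bij_betw[OF bij])
      finally show "sigma n t N = N" .
    qed
    have N0: "N \<noteq> 0"
      unfolding N_def using sigma_eq_0[OF n cop x] False by auto
    have "N = x * (\<Prod>s\<in>totatives n - {1}. sigma n s x)"
      unfolding N_def using prod.remove[OF finite_totatives one, of "\<lambda>s. sigma n s x"] sigma_1[OF n x] by simp
    then have "inverse x = inverse N * (\<Prod>s\<in>totatives n - {1}. sigma n s x)"
      using N0 by (simp add: field_simps)
    moreover have "inverse N \<in> cyc n" using \<open>N \<in> \<rat>\<close> by (intro Rats_subset_cyc) simp
    moreover have "(\<Prod>s\<in>totatives n - {1}. sigma n s x) \<in> cyc n" using cyc by (intro subring_prod[OF ring]) auto
    ultimately show ?thesis using subring_mult[OF ring] by simp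
  qed (simp add: subring_0[OF ring])
qed

text \<open>The conjugate is real, as the automorphism commutes with \<open>cnj\<close>, and has the
  same \<open>N\<close>-th power as \<open>r\<close>, hence the same absolute value.\<close>

lemma sigma_real_radical:
  assumes n: "n > 1" and s: "coprime s n" and r: "complex_of_real r \<in> cyc n" "r > 0"
    and N: "complex_of_real r ^ N \<in> \<rat>" "N > 0"
  shows "sigma n s (of_real r) = of_real r \<or> sigma n s (of_real r) = - of_real r"
proof -
  let ?y = "sigma n s (of_real r)"
  have "cnj ?y = ?y" using cnj_sigma[OF n s r(1)] by simp
  then obtain y where y: "?y = of_real y" by (metis Reals_cases Reals_cnj_iff)
  have "?y ^ N = of_real r ^ N" using sigma_power[OF n s r(1), of N] sigma_Rats[OF n s N(1)] by simp
  then have "complex_of_real (y ^ N) = of_real (r ^ N)" using y by simp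
  then have "y ^ N = r ^ N" by (simp only: of_real_eq_iff)
  then have "\<bar>y\<bar> ^ N = r ^ N" using r(2) by (metis abs_of_pos power_abs zero_less_power)
  then have "\<bar>y\<bar> = r" using r(2) N(2) power_eq_imp_eq_base[of "\<bar>y\<bar>" N r] by simp
  then show ?thesis using y by (auto simp: abs_if split: if_splits)
qed

text \<open>Every conjugate is \<open>r\<close> or \<open>- r\<close>, so the square is fixed by all
  automorphisms.\<close>

lemma cyclotomic_real_radical_square:
  assumes n: "n > 1" and r: "complex_of_real r \<in> cyc n" "r > 0"
    and N: "complex_of_real r ^ N \<in> \<rat>" "N > 0"
  shows "complex_of_real r ^ 2 \<in> \<rat>"
proof (rule sigma_fixed_imp_Rats[OF n])
  show "complex_of_real r ^ 2 \<in> cyc n" by (rule subring_power[OF csubring_cyc r(1)])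
  fix s assume "s \<in> totatives n"
  then have s: "coprime s n" by (simp add: totatives_def)
  show "sigma n s (of_real r ^ 2) = of_real r ^ 2"
    using sigma_power[OF n s r(1), of 2] sigma_real_radical[OF n s r N] by auto
qed

subsection \<open>Kummer theory\<close>

context
  fixes F :: "complex set"
  assumes F: "csubfield F"
begin

lemma subfield_subring: "csubring F"
  using F by (simp add: csubfield_def)

lemma subfield_divide: "x \<in> F \<Longrightarrow> y \<in> F \<Longrightarrow> x / y \<in> F"
  using F subring_mult[OF subfield_subring, of x "inverse y"]
  by (auto simp: csubfield_def divide_inverse)

lemma div_closed_subfield: "div_closed F"
  using subring_1[OF subfield_subring] subfield_divide by (simp add: div_closed_def)

text \<open>Division with remainder, one leading term at a time, so that the coefficients stay in
  \<open>F\<close>.\<close>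

lemma subfield_minimal_poly_dvd:
  assumes P: "coeffs_in F P" "P \<noteq> 0" "poly P w = 0"
    and min: "\<And>R. coeffs_in F R \<Longrightarrow> R \<noteq> 0 \<Longrightarrow> poly R w = 0 \<Longrightarrow> degree P \<le> degree R"
    and Q: "coeffs_in F Q" "poly Q w = 0"
  shows "P dvd Q"
  using Q
proof (induction "degree Q" arbitrary: Q rule: less_induct)
  case less
  show ?case
  proof (cases "Q = 0")
    case False
    have le: "degree P \<le> degree Q" using min less.prems False by blast
    define T where "T = monom (lead_coeff Q / lead_coeff P) (degree Q - degree P) * P"
    have c0: "lead_coeff Q / lead_coeff P \<noteq> 0" using False P by simp
    have dT: "degree T = degree Q"
      unfolding T_def using c0 P le by (subst degree_mult_eq) (auto simp: degree_monom_eq)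
    have lT: "coeff T (degree Q) = lead_coeff Q"
      unfolding T_def using le P by (simp add: coeff_monom_mult)
    have "coeffs_in F T"
      unfolding T_def using P less.prems
      by (intro coeffs_in_mult[OF subfield_subring] coeffs_in_monom[OF subfield_subring] subfield_divide)
        (auto simp: coeffs_in_def)
    then have Q': "coeffs_in F (Q - T)" by (intro coeffs_in_diff[OF subfield_subring] less.prems)
    have Tw: "poly (Q - T) w = 0" using P less.prems by (simp add: T_def)
    have "P dvd Q - T"
    proof (cases "Q - T = 0")
      case False
      have "degree (Q - T) \<le> degree Q" using dT by (intro degree_diff_le) auto
      moreover have "degree (Q - T) \<noteq> degree Q"
        using lT False by (metis coeff_diff diff_self leading_coeff_0_iff)
      ultimately show ?thesis using less.hyps[OF _ Q' Tw] by simp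
    qed simp
    moreover have "P dvd T" by (simp add: T_def)
    ultimately have "P dvd (Q - T) + T" by (rule dvd_add)
    then show ?thesis by simp
  qed simp
qed

text \<open>
  The constant coefficient of the minimal polynomial \<open>P\<close> of \<open>w\<close> is a root of unity times
  \<open>w ^ degree P\<close>, so \<open>P\<close> has degree \<open>N\<close>.
\<close>

lemma kummer_conjugate:
  assumes mu: "\<And>x m. m > 0 \<Longrightarrow> x ^ m = 1 \<Longrightarrow> x \<in> F"
    and w: "w \<noteq> 0" "N > 0" "w ^ N \<in> F" "\<And>k. 0 < k \<Longrightarrow> k < N \<Longrightarrow> w ^ k \<notin> F"
    and Q: "coeffs_in F Q" "poly Q w = 0" and \<zeta>: "\<zeta> ^ N = 1"
  shows "poly Q (\<zeta> * w) = 0"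
proof -
  define X where "X = monom 1 N - [:w ^ N:]"
  have one: "1 \<in> F" by (rule subring_1[OF subfield_subring])
  have X: "coeffs_in F X" "poly X w = 0"
    unfolding X_def using w one
    by (auto intro!: coeffs_in_diff[OF subfield_subring] coeffs_in_monom[OF subfield_subring] coeffs_in_const[OF subfield_subring]
        simp: poly_monom)
  have dX: "degree X = N" "lead_coeff X = 1"
  proof -
    have "coeff X N = 1" using w by (simp add: X_def coeff_pCons split: nat.splits)
    moreover have "degree X \<le> N"
      unfolding X_def by (intro degree_diff_le) (auto simp: degree_monom_le)
    ultimately show "degree X = N" using le_degree[of X N] by simp
    then show "lead_coeff X = 1" using \<open>coeff X N = 1\<close> by simp
  qed
  then have X0: "X \<noteq> 0" by auto
  define good where "good R \<longleftrightarrow> coeffs_in F R \<and> R \<noteq> 0 \<and> poly R w = 0" for R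
  have "good X" using X X0 by (simp add: good_def)
  then obtain P where P: "good P" "\<And>R. good R \<Longrightarrow> degree P \<le> degree R"
    using exists_least_iff[of "\<lambda>d. \<exists>R. good R \<and> degree R = d"] by (metis not_le)
  have dvd: "P dvd R" if "coeffs_in F R" "poly R w = 0" for R
    by (rule subfield_minimal_poly_dvd[of P w]) (use P that in \<open>auto simp: good_def\<close>)
  have P0: "P \<noteq> 0" using P by (simp add: good_def)
  have dP: "degree P \<le> N" using P(2)[OF \<open>good X\<close>] dX by simp
  obtain A where A: "size A = degree P" "P = smult (lead_coeff P) (\<Prod>x\<in>#A. [:- x, 1:])"
    using alg_closed_imp_factorization[OF P0] by blast
  have rootA: "\<exists>\<xi>. \<xi> ^ N = 1 \<and> x = \<xi> * w" if "x \<in># A" for x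
  proof -
    have "[:- x, 1:] dvd (\<Prod>x\<in>#A. [:- x, 1:])" using that by (intro dvd_prod_mset) auto
    then have "[:- x, 1:] dvd P" using A(2) by (metis dvd_smult)
    then have "[:- x, 1:] dvd X" using dvd[OF X] dvd_trans by blast
    then have "poly X x = 0" by (simp add: poly_eq_0_iff_dvd)
    then have "x ^ N = w ^ N" by (simp add: X_def poly_monom)
    then have "(x / w) ^ N = 1" "x = (x / w) * w" using w by (simp_all add: power_divide)
    then show ?thesis by blast
  qed
  have prodA: "\<exists>\<xi>. \<xi> ^ N = 1 \<and> (\<Prod>x\<in>#B. - x) = (-1) ^ size B * \<xi> * w ^ size B" if "\<And>x. x \<in># B \<Longrightarrow> x \<in># A" for B
    using that
  proof (induction B)
    case empty
    then show ?case by (intro exI[of _ 1]) simp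
  next
    case (add x B)
    then obtain \<xi> where 1: "\<xi> ^ N = 1" "(\<Prod>x\<in>#B. - x) = (-1) ^ size B * \<xi> * w ^ size B" by auto
    obtain \<xi>' where 2: "\<xi>' ^ N = 1" "x = \<xi>' * w" using rootA[of x] add.prems by auto
    show ?case using 1 2 by (intro exI[of _ "\<xi>' * \<xi>"]) (simp add: power_mult_distrib)
  qed
  then obtain \<xi> where \<xi>: "\<xi> ^ N = 1" "(\<Prod>x\<in>#A. - x) = (-1) ^ size A * \<xi> * w ^ size A" by blast
  have "poly P 0 = lead_coeff P * poly (\<Prod>x\<in>#A. [:- x, 1:]) 0" by (subst A(2)) simp
  also have "poly (\<Prod>x\<in>#A. [:- x, 1:]) 0 = (\<Prod>x\<in>#A. - x)"
    by (induction A) auto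
  finally have "poly P 0 = lead_coeff P * ((-1) ^ size A * \<xi> * w ^ size A)" using \<xi> by simp
  then have wA: "w ^ size A = poly P 0 / (lead_coeff P * ((-1) ^ size A * \<xi>))"
    using P0 \<xi>(1) w(2) by (auto simp: field_simps power_0_left)
  have "coeffs_in F P" using P by (simp add: good_def)
  then have lcs: "poly P 0 \<in> F" "lead_coeff P \<in> F" by (simp_all add: coeffs_in_def poly_0_coeff_0)
  have m1: "- 1 \<in> F" using subring_uminus[OF subfield_subring one] .
  have "w ^ size A \<in> F"
    unfolding wA
    by (intro subfield_divide subring_mult[OF subfield_subring] subring_power[OF subfield_subring] lcs m1 mu[OF w(2) \<xi>(1)])
  moreover have "size A > 0"
  proof (rule ccontr)
    assume "\<not> size A > 0"
    then have "degree P = 0" using A by simp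
    then obtain c where "P = [:c:]" by (metis degree_eq_zeroE)
    then show False using P by (simp add: good_def)
  qed
  ultimately have "degree P = N" using w(4) A(1) dP by (metis le_neq_implies_less)
  moreover obtain B where B: "X = P * B" using dvd[OF X] by blast
  ultimately have "degree B = 0" using X0 dX degree_mult_eq[of P B] by auto
  then obtain b where "B = [:b:]" by (metis degree_eq_zeroE)
  then have b: "X = smult b P" "b \<noteq> 0" using B X0 by auto
  have "poly X (\<zeta> * w) = 0" by (simp add: X_def poly_monom power_mult_distrib \<zeta>)
  then have "poly P (\<zeta> * w) = 0" using b by simp
  then show ?thesis using dvd[OF Q] by (auto elim: dvdE)
qed

end

text \<open>The field generated by \<open>w\<close> over a field \<open>F\<close>; fractions give
  inverses without recourse to a minimal polynomial.\<close>

definition fraction_adjoin :: "complex set \<Rightarrow> complex \<Rightarrow> complex set" where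
  "fraction_adjoin F w = {a / b | a b. a \<in> adjoin F w \<and> b \<in> adjoin F w \<and> b \<noteq> 0}"

lemma fraction_adjoin_base:
  assumes "csubring F" "a \<in> adjoin F w"
  shows "a \<in> fraction_adjoin F w"
  unfolding fraction_adjoin_def using assms subring_1[OF csubring_adjoin[OF assms(1)]]
  by (intro CollectI exI[of _ a] exI[of _ 1]) auto

lemma csubfield_fraction_adjoin:
  assumes F: "csubring F"
  shows "csubfield (fraction_adjoin F w)"
proof -
  let ?R = "adjoin F w" and ?K = "fraction_adjoin F w"
  have R: "csubring ?R" by (rule csubring_adjoin[OF F])
  show ?thesis
    unfolding csubfield_def csubring_def
  proof (intro conjI ballI)
    show "1 \<in> ?K" by (rule fraction_adjoin_base[OF F subring_1[OF R]])
    fix x y assume "x \<in> ?K" "y \<in> ?K"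
    then obtain a b c d where x: "x = a / b" "a \<in> ?R" "b \<in> ?R" "b \<noteq> 0"
      and y: "y = c / d" "c \<in> ?R" "d \<in> ?R" "d \<noteq> 0" unfolding fraction_adjoin_def by blast
    have "x - y = (a * d - c * b) / (b * d)" "x * y = (a * c) / (b * d)" using x y by (simp_all add: field_simps)
    moreover have "a * d - c * b \<in> ?R" "b * d \<in> ?R" "a * c \<in> ?R" "b * d \<noteq> 0"
      using x y by (auto intro!: subring_diff[OF R] subring_mult[OF R])
    ultimately show "x - y \<in> ?K" "x * y \<in> ?K" unfolding fraction_adjoin_def by blast+
  next
    fix x assume "x \<in> ?K"
    then obtain a b where x: "x = a / b" "a \<in> ?R" "b \<in> ?R" "b \<noteq> 0" unfolding fraction_adjoin_def by blast
    show "inverse x \<in> ?K"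
    proof (cases "a = 0")
      case True
      then show ?thesis using x fraction_adjoin_base[OF F subring_0[OF R]] by simp
    next
      case False
      then have "inverse x = b / a" using x by simp
      then show ?thesis using x False unfolding fraction_adjoin_def by blast
    qed
  qed
qed

text \<open>
  If a quotient \<open>w = v i\<^sub>2 / v i\<^sub>1\<close> is not in \<open>F\<close>, its two terms can be merged over \<open>F(w)\<close>. Should all
  quotients lie in \<open>F(w)\<close>, subtracting the relation from its image under \<open>w \<mapsto> \<zeta> w\<close> kills \<open>i\<^sub>1\<close>.
\<close>

lemma kummer_class_sums_vanish:
  fixes v c :: "'i \<Rightarrow> complex"
  assumes "csubfield F" "\<And>x m. m > 0 \<Longrightarrow> x ^ m = 1 \<Longrightarrow> x \<in> F" "finite I"
    "\<And>i. i \<in> I \<Longrightarrow> v i \<noteq> 0" "\<And>i. i \<in> I \<Longrightarrow> \<exists>m>0. v i ^ m \<in> F"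
    "\<And>i. i \<in> I \<Longrightarrow> c i \<in> F" "(\<Sum>i\<in>I. c i * v i) = 0"
  shows "class_sums_vanish F I v (\<lambda>i. c i * v i)"
  using assms
\<comment> \<open>The field varies too, since merging puts the quotient \<open>w\<close> into a
  coefficient.\<close>
proof (induction "card I" arbitrary: F I c rule: less_induct)
  case less
  note F = less.prems(1) and mu = less.prems(2) and I = less.prems(3) and nz = less.prems(4)
    and rad = less.prems(5) and cF = less.prems(6) and rel = less.prems(7)
  have R: "csubring F" by (rule subfield_subring[OF F])
  have dF: "div_closed F" by (rule div_closed_subfield[OF F])
  show ?case
  proof (cases "\<forall>i\<in>I. \<forall>j\<in>I. v i / v j \<in> F")
    case True
    then have "{i\<in>I. v i / v j \<in> F} = I" if "j \<in> I" for j using that by blast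
    then show ?thesis using rel by (simp add: class_sums_vanish_def)
  next
    case False
    then obtain i1 i2 where i12: "i1 \<in> I" "i2 \<in> I" "v i2 / v i1 \<notin> F" by blast
    define w where "w = v i2 / v i1"
    have wF: "w \<notin> F" using i12 by (simp add: w_def)
    have w0: "w \<noteq> 0" using nz i12 by (simp add: w_def)
    have ne: "i2 \<noteq> i1" using i12 nz subring_1[OF R] by auto
    have radq: "\<exists>m>0. (v i / v i1) ^ m \<in> F" if i: "i \<in> I" for i
    proof -
      obtain m where m: "m > 0" "v i ^ m \<in> F" using rad[OF i] by blast
      obtain m' where m': "m' > 0" "v i1 ^ m' \<in> F" using rad[OF i12(1)] by blast
      have "(v i / v i1) ^ (m * m') = (v i ^ m) ^ m' / (v i1 ^ m') ^ m"
        by (simp add: power_divide power_mult[symmetric] mult.commute[of m'])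
      also have "\<dots> \<in> F" by (rule subfield_divide[OF F subring_power[OF R m(2)] subring_power[OF R m'(2)]])
      finally show ?thesis using m m' by (intro exI[of _ "m * m'"]) auto
    qed
    define F' where "F' = fraction_adjoin F w"
    have F': "csubfield F'" unfolding F'_def by (rule csubfield_fraction_adjoin[OF R])
    have FF': "F \<subseteq> F'" unfolding F'_def using fraction_adjoin_base[OF R adjoin_base[OF R]] by blast
    have wF': "w \<in> F'" unfolding F'_def by (rule fraction_adjoin_base[OF R adjoin_generator[OF R]])
    have dF': "div_closed F'" by (rule div_closed_subfield[OF F'])
    have R': "csubring F'" by (rule subfield_subring[OF F'])
    have csF': "class_sums_vanish F' I v (\<lambda>i. c i * v i)"
    proof (rule class_sums_vanish_merge[OF I dF' nz i12(2,1) ne])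
      show "v i2 / v i1 \<in> F'" using wF' by (simp add: w_def)
      define c' where "c' = c(i1 := c i1 + c i2 * w)"
      have c': "(\<lambda>i. c i * v i)(i1 := c i1 * v i1 + c i2 * v i2) = (\<lambda>i. c' i * v i)"
        using nz i12 by (auto simp: c'_def w_def field_simps)
      have "class_sums_vanish F' (I - {i2}) v (\<lambda>i. c' i * v i)"
      proof (rule less.hyps[OF _ F'])
        show "card (I - {i2}) < card I" using I i12 by (intro psubset_card_mono) auto
        show "c' i \<in> F'" if "i \<in> I - {i2}" for i
          using that cF FF' wF' i12 by (auto simp: c'_def intro!: subring_add[OF R'] subring_mult[OF R'])
        show "(\<Sum>i\<in>I - {i2}. c' i * v i) = 0"
          using sum_merge[OF I i12(2,1) ne, of "\<lambda>i. c i * v i"] rel unfolding c' by simp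
        show "x \<in> F'" if "m > 0" "x ^ m = 1" for x m using mu[OF that] FF' by blast
        show "\<exists>m>0. v i ^ m \<in> F'" if "i \<in> I - {i2}" for i using rad[of i] that FF' by blast
      qed (use I nz in auto)
      then show "class_sums_vanish F' (I - {i2}) v ((\<lambda>i. c i * v i)(i1 := c i1 * v i1 + c i2 * v i2))"
        unfolding c' .
    qed
    show ?thesis
    proof (cases "\<forall>i\<in>I. v i / v i1 \<in> F'")
      case False
      then obtain i3 where i3: "i3 \<in> I" "v i3 / v i1 \<notin> F'" by blast
      show ?thesis
      \<comment> \<open>Some quotient lies outside \<open>F'\<close>, so each
        \<open>F'\<close>-class is a proper part of \<open>I\<close>, and its vanishing sum is a
        shorter relation over the original \<open>F\<close>.\<close>
      proof (rule class_sums_vanish_refine[OF dF FF' nz])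
        fix j assume j: "j \<in> I"
        let ?C = "{i\<in>I. v i / v j \<in> F'}"
        have "?C \<noteq> I"
        proof
          assume "?C = I"
          then have "v i3 / v j \<in> F'" "v i1 / v j \<in> F'" using i3 i12 by blast+
          then show False using quotient_trans[OF dF' nz[OF j] _ quotient_sym[OF dF']] i3 by blast
        qed
        then have "card ?C < card I" using I by (intro psubset_card_mono) auto
        moreover have "(\<Sum>i\<in>?C. c i * v i) = 0" using csF' j by (simp add: class_sums_vanish_def)
        ultimately show "class_sums_vanish F ?C v (\<lambda>i. c i * v i)"
          using F mu I nz rad cF by (intro less.hyps) auto
      qed
    next
      case True
      have "\<exists>N>0. w ^ N \<in> F" using radq[OF i12(2)] by (simp add: w_def)
      define N where "N = (LEAST N. N > 0 \<and> w ^ N \<in> F)"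
      have N: "N > 0" "w ^ N \<in> F"
        using LeastI_ex[of "\<lambda>N. N > 0 \<and> w ^ N \<in> F"] \<open>\<exists>N>0. w ^ N \<in> F\<close> by (auto simp: N_def)
      have Nmin: "w ^ k \<notin> F" if "0 < k" "k < N" for k
        using not_less_Least[of k "\<lambda>N. N > 0 \<and> w ^ N \<in> F"] that by (auto simp: N_def)
      have N1: "N > 1" using N wF by (cases "N = 1") auto
      define \<zeta> where "\<zeta> = zeta N"
      have \<zeta>N: "\<zeta> ^ N = 1" using zeta_power_self N by (simp add: \<zeta>_def)
      have \<zeta>1: "\<zeta> \<noteq> 1"
      proof
        assume "\<zeta> = 1"
        then have "cis (2 * pi / real N) = 1" by (simp add: \<zeta>_def zeta_def)
        then have "inj_on (\<lambda>k. cis (2 * pi * real k / real N)) {..<N} \<and> cis (2 * pi * real 1 / real N) = cis (2 * pi * real 0 / real N)"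
          using bij_betw_roots_unity[OF N(1)] by (simp add: bij_betw_def)
        then show False using N1 by (metis inj_onD lessThan_iff less_trans zero_less_one zero_neq_one)
      qed
      have conj: "poly f (\<zeta> * w) = 0" if "coeffs_in F f" "poly f w = 0" for f
        by (rule kummer_conjugate[OF F mu w0 N Nmin that \<zeta>N])
      have "\<forall>i\<in>I. \<exists>pq. coeffs_in F (fst pq) \<and> coeffs_in F (snd pq) \<and> poly (snd pq) w \<noteq> 0 \<and> v i / v i1 = poly (fst pq) w / poly (snd pq) w"
      proof
        fix i assume "i \<in> I"
        then have "v i / v i1 \<in> F'" using True by blast
        then obtain p q where "coeffs_in F p" "coeffs_in F q" "poly q w \<noteq> 0" "v i / v i1 = poly p w / poly q w"
          unfolding F'_def fraction_adjoin_def adjoin_def by blast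
        then show "\<exists>pq. coeffs_in F (fst pq) \<and> coeffs_in F (snd pq) \<and> poly (snd pq) w \<noteq> 0 \<and> v i / v i1 = poly (fst pq) w / poly (snd pq) w"
          by (intro exI[of _ "(p, q)"]) simp
      qed
      then obtain pq where pq: "\<forall>i\<in>I. coeffs_in F (fst (pq i)) \<and> coeffs_in F (snd (pq i)) \<and> poly (snd (pq i)) w \<noteq> 0 \<and>
          v i / v i1 = poly (fst (pq i)) w / poly (snd (pq i)) w"
        by (rule bchoice[THEN exE])
      \<comment> \<open>Over the common denominator \<open>Q\<close> the quotients become
        \<open>poly (P i) w / poly Q w\<close>. Conjugation is then applied to polynomials only, and
        no field automorphism has to be built.\<close>
      define Q where "Q = (\<Prod>i\<in>I. snd (pq i))"
      define P where "P i = fst (pq i) * (\<Prod>j\<in>I - {i}. snd (pq j))" for i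
      define u where "u i = v i / v i1" for i
      have QF: "coeffs_in F Q" unfolding Q_def using pq by (intro coeffs_in_prod[OF R]) auto
      have PF: "coeffs_in F (P i)" if "i \<in> I" for i
        unfolding P_def using pq that by (intro coeffs_in_mult[OF R] coeffs_in_prod[OF R]) auto
      have Qw: "poly Q w \<noteq> 0" unfolding Q_def using pq I by (auto simp: poly_prod)
      have Pw: "poly (P i) w = u i * poly Q w" if "i \<in> I" for i
      proof -
        have "poly Q w = poly (snd (pq i)) w * (\<Prod>j\<in>I - {i}. poly (snd (pq j)) w)"
          unfolding Q_def poly_prod using I that by (intro prod.remove) auto
        then show ?thesis using pq that by (simp add: P_def u_def poly_prod)
      qed
      \<comment> \<open>Repeated multiplication by \<open>\<zeta>\<close> returns to
        \<open>w\<close> after \<open>N\<close> steps, so a zero at \<open>\<zeta> * w\<close> would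
        spread back to \<open>w\<close>.\<close>
      have Q\<zeta>: "poly Q (\<zeta> * w) \<noteq> 0"
      proof
        assume *: "poly Q (\<zeta> * w) = 0"
        have "\<zeta> \<in> F" by (rule mu[OF N(1) \<zeta>N])
        have "poly Q (\<zeta> ^ Suc k * w) = 0" for k
        proof (induction k)
          case (Suc k)
          have "poly (pcompose Q [:0, \<zeta> ^ Suc k:]) (\<zeta> * w) = 0"
            by (rule conj) (use Suc \<open>\<zeta> \<in> F\<close> in \<open>auto simp: poly_pcompose mult.commute coeffs_in_pCons[OF R] coeffs_in_0[OF R]
              intro!: coeffs_in_pcompose[OF R] QF subring_0[OF R] subring_mult[OF R] subring_power[OF R]\<close>)
          then show ?case by (simp add: poly_pcompose ac_simps)
        qed (use * in simp)
        from this[of "N - 1"] show False using \<zeta>N N Qw by simp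
      qed
      \<comment> \<open>The factor by which conjugation scales \<open>u i\<close>. It is a root of
        unity since a power of \<open>u i\<close> lies in \<open>F\<close>, and it is constant on
        \<open>F\<close>-classes, with value 1 at \<open>i1\<close> and \<open>\<zeta>\<close> at
        \<open>i2\<close>.\<close>
      define \<xi> where "\<xi> i = poly (P i) (\<zeta> * w) / (u i * poly Q (\<zeta> * w))" for i
      have u0: "u i \<noteq> 0" if "i \<in> I" for i using nz that i12 by (simp add: u_def)
      have P\<zeta>: "poly (P i) (\<zeta> * w) = \<xi> i * u i * poly Q (\<zeta> * w)" if "i \<in> I" for i
        using u0[OF that] Q\<zeta> by (simp add: \<xi>_def)
      have \<xi>F: "\<xi> i \<in> F" if i: "i \<in> I" for i
      proof -
        obtain m where m: "m > 0" "u i ^ m \<in> F" using radq[OF i] by (auto simp: u_def)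
        have "poly (P i ^ m - smult (u i ^ m) (Q ^ m)) (\<zeta> * w) = 0"
          by (rule conj) (use m i Pw in \<open>auto simp: power_mult_distrib
            intro!: coeffs_in_diff[OF R] coeffs_in_power[OF R] coeffs_in_smult[OF R] PF QF\<close>)
        then have "\<xi> i ^ m = 1" using u0[OF i] Q\<zeta> by (simp add: \<xi>_def power_divide power_mult_distrib)
        then show ?thesis using mu m by blast
      qed
      have \<xi>1: "\<xi> i1 = 1"
      proof -
        have "poly (P i1 - Q) (\<zeta> * w) = 0"
          by (rule conj) (use i12 Pw nz in \<open>auto simp: u_def intro!: coeffs_in_diff[OF R] PF QF\<close>)
        then show ?thesis using Q\<zeta> nz i12 by (simp add: \<xi>_def u_def)
      qed
      have \<xi>2: "\<xi> i2 = \<zeta>"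
      proof -
        have "poly (P i2 - pCons 0 Q) (\<zeta> * w) = 0"
          by (rule conj) (use i12 Pw in \<open>auto simp: u_def w_def coeffs_in_pCons[OF R]
            intro!: coeffs_in_diff[OF R] PF QF subring_0[OF R]\<close>)
        then show ?thesis using Q\<zeta> w0 by (simp add: \<xi>_def u_def w_def)
      qed
      have \<xi>c: "\<xi> i = \<xi> j" if ij: "i \<in> I" "j \<in> I" "v i / v j \<in> F" for i j
      proof -
        have uij: "u i = (v i / v j) * u j" using nz ij by (simp add: u_def)
        have "poly (P i - smult (v i / v j) (P j)) (\<zeta> * w) = 0"
          by (rule conj) (use ij Pw uij in \<open>auto intro!: coeffs_in_diff[OF R] coeffs_in_smult[OF R] PF\<close>)
        then have "\<xi> i * u i * poly Q (\<zeta> * w) = (v i / v j) * (\<xi> j * u j * poly Q (\<zeta> * w))"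
          using P\<zeta> ij by simp
        also have "\<dots> = \<xi> j * u i * poly Q (\<zeta> * w)" using uij by simp
        finally show ?thesis using u0[OF ij(1)] Q\<zeta> by simp
      qed
      have rel\<xi>: "(\<Sum>i\<in>I. c i * \<xi> i * v i) = 0"
      proof -
        have v1: "v i1 \<noteq> 0" using nz i12 by blast
        have "(\<Sum>i\<in>I. c i * u i) * v i1 = (\<Sum>i\<in>I. c i * v i)"
          using v1 by (simp add: u_def sum_distrib_right)
        then have "(\<Sum>i\<in>I. c i * u i) * v i1 = 0" using rel by simp
        then have "(\<Sum>i\<in>I. c i * u i) = 0" using v1 by simp
        then have "(\<Sum>i\<in>I. c i * poly (P i) w) = 0"
          using Pw by (simp add: mult.assoc[symmetric] flip: sum_distrib_right)
        then have "poly (\<Sum>i\<in>I. smult (c i) (P i)) w = 0" by (simp add: poly_sum)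
        then have "poly (\<Sum>i\<in>I. smult (c i) (P i)) (\<zeta> * w) = 0"
          using cF PF by (intro conj coeffs_in_sum[OF R] coeffs_in_smult[OF R]) auto
        then have "(\<Sum>i\<in>I. c i * poly (P i) (\<zeta> * w)) = 0" by (simp add: poly_sum)
        moreover have "(\<Sum>i\<in>I. c i * \<xi> i * u i) * poly Q (\<zeta> * w) = (\<Sum>i\<in>I. c i * poly (P i) (\<zeta> * w))"
          unfolding sum_distrib_right by (rule sum.cong) (simp_all add: P\<zeta>)
        moreover have "(\<Sum>i\<in>I. c i * \<xi> i * u i) * v i1 = (\<Sum>i\<in>I. c i * \<xi> i * v i)"
          using v1 by (simp add: u_def sum_distrib_right)
        ultimately show ?thesis using Q\<zeta> by auto
      qed
      \<comment> \<open>On the class of \<open>i2\<close> the factor \<open>\<xi>\<close> equals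
        \<open>\<zeta>\<close>, so there the difference of the conjugated and the original relation
        is \<open>\<zeta> - 1\<close> times the original class sum. The difference has lost
        \<open>i1\<close>, so the induction applies to it.\<close>
      define B where "B = {i\<in>I. v i / v i2 \<in> F}"
      have i1B: "i1 \<notin> B" using i12 quotient_sym[OF dF] by (auto simp: B_def)
      have i2B: "i2 \<in> B" using i12 nz quotient_refl[OF dF] by (auto simp: B_def)
      have cs1: "class_sums_vanish F (I - {i1}) v (\<lambda>i. (c i * (\<xi> i - 1)) * v i)"
      proof (rule less.hyps[OF _ F mu])
        show "card (I - {i1}) < card I" using I i12 by (intro psubset_card_mono) auto
        have "(\<Sum>i\<in>I. c i * (\<xi> i - 1) * v i) = 0"
          using rel rel\<xi> by (simp add: algebra_simps sum_subtractf)
        then show "(\<Sum>i\<in>I - {i1}. c i * (\<xi> i - 1) * v i) = 0"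
          using sum.remove[OF I i12(1), of "\<lambda>i. c i * (\<xi> i - 1) * v i"] \<xi>1 by simp
        show "c i * (\<xi> i - 1) \<in> F" if "i \<in> I - {i1}" for i
          using that cF \<xi>F by (intro subring_mult[OF R] subring_diff[OF R] subring_1[OF R]) auto
      qed (use I nz rad in auto)
      have "i2 \<in> I - {i1}" using i12 ne by blast
      from bspec[OF cs1[unfolded class_sums_vanish_def] this]
      have "(\<Sum>i\<in>{i\<in>I - {i1}. v i / v i2 \<in> F}. (c i * (\<xi> i - 1)) * v i) = 0" .
      moreover have "{i\<in>I - {i1}. v i / v i2 \<in> F} = B" using i1B unfolding B_def by blast
      ultimately have "(\<Sum>i\<in>B. (c i * (\<xi> i - 1)) * v i) = 0" by (simp only:)
      moreover have "(\<Sum>i\<in>B. (c i * (\<xi> i - 1)) * v i) = (\<zeta> - 1) * (\<Sum>i\<in>B. c i * v i)"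
        unfolding sum_distrib_left
      proof (rule sum.cong[OF refl])
        fix i assume "i \<in> B"
        then have "\<xi> i = \<zeta>" using \<xi>c[of i i2] i12 \<xi>2 by (auto simp: B_def)
        then show "c i * (\<xi> i - 1) * v i = (\<zeta> - 1) * (c i * v i)" by simp
      qed
      ultimately have Bsum: "(\<Sum>i\<in>B. c i * v i) = 0" using \<zeta>1 by simp
      have BI: "B \<subseteq> I" by (auto simp: B_def)
      \<comment> \<open>As the class \<open>B\<close> sums to zero, the remaining terms again form a
        shorter relation.\<close>
      have rest: "class_sums_vanish F (I - B) v (\<lambda>i. c i * v i)"
      proof (rule less.hyps[OF _ F mu])
        show "card (I - B) < card I" using I i12 i2B by (intro psubset_card_mono) auto
        show "(\<Sum>i\<in>I - B. c i * v i) = 0" using sum.subset_diff[OF BI I, of "\<lambda>i. c i * v i"] rel Bsum by simp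
      qed (use I nz rad cF in auto)
      show ?thesis
        unfolding class_sums_vanish_def
      proof
        fix j assume j: "j \<in> I"
        let ?C = "{i\<in>I. v i / v j \<in> F}"
        have iff: "i \<in> B \<longleftrightarrow> j \<in> B" if "i \<in> ?C" for i
          using that j quotient_trans[OF dF nz[OF j], of "v i" "v i2"]
            quotient_trans[OF dF nz[of i], of "v j" "v i2"] quotient_sym[OF dF, of "v i" "v j"]
          by (auto simp: B_def)
        show "(\<Sum>i\<in>?C. c i * v i) = 0"
        proof (cases "j \<in> B")
          case True
          have "?C = B"
          proof
            show "?C \<subseteq> B" using iff True by blast
            show "B \<subseteq> ?C"
              using True nz[OF i12(2)] quotient_trans[OF dF _ _ quotient_sym[OF dF], of "v i2"]
              by (auto simp: B_def)
          qed
          then show ?thesis using Bsum by simp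
        next
          case False
          then have "?C = {i\<in>I - B. v i / v j \<in> F}" using iff by blast
          then show ?thesis using rest j False unfolding class_sums_vanish_def by simp
        qed
      qed
    qed
  qed
qed

subsection \<open>Relations among radicals of rational numbers\<close>

text \<open>The maximal cyclotomic field; its levels are directed by divisibility.\<close>

definition Cyc :: "complex set" where
  "Cyc = (\<Union>n\<in>{1<..}. cyc n)"

lemma CycE:
  assumes "x \<in> Cyc" "k > 0"
  obtains n where "n > 1" "k dvd n" "x \<in> cyc n"
proof -
  obtain n where n: "n > 1" "x \<in> cyc n" using assms by (auto simp: Cyc_def)
  then have "x \<in> cyc (k * n)" using cyc_mono[of n "k * n"] assms(2) by auto
  moreover have "k * n > 1" using n assms(2) by (metis less_le_trans mult_le_mono1 nat_mult_1 Suc_leI One_nat_def)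
  ultimately show ?thesis using that by auto
qed

lemma cyc_subset_Cyc: "n > 1 \<Longrightarrow> cyc n \<subseteq> Cyc"
  by (auto simp: Cyc_def)

lemma csubfield_Cyc: "csubfield Cyc"
  unfolding csubfield_def csubring_def
proof (intro conjI ballI)
  have "(1::complex) \<in> cyc 2" by (rule Rats_subset_cyc) simp
  then show "1 \<in> Cyc" using cyc_subset_Cyc[of 2] by auto
next
  fix x y assume "x \<in> Cyc" "y \<in> Cyc"
  then obtain m where m: "m > 1" "x \<in> cyc m" by (auto simp: Cyc_def)
  then obtain n where n: "n > 1" "m dvd n" "y \<in> cyc n" using CycE[OF \<open>y \<in> Cyc\<close>, of m] by auto
  then have "x \<in> cyc n" using cyc_mono[of m n] m by auto
  then show "x - y \<in> Cyc" "x * y \<in> Cyc"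
    using subring_diff[OF csubring_cyc] subring_mult[OF csubring_cyc] n cyc_subset_Cyc[OF n(1)] by blast+
next
  fix x assume "x \<in> Cyc"
  then obtain n where "n > 1" "x \<in> cyc n" by (auto simp: Cyc_def)
  then show "inverse x \<in> Cyc"
    using csubfield_cyc[of n] cyc_subset_Cyc[of n] by (auto simp: csubfield_def)
qed

lemma root_of_unity_in_Cyc:
  assumes "m > 0" "x ^ m = 1"
  shows "x \<in> Cyc"
proof -
  have "x \<in> cyc (m * 2)" by (rule root_of_unity_in_cyc) (use assms in \<open>auto simp: power_mult\<close>)
  then show ?thesis using cyc_subset_Cyc[of "m * 2"] assms by auto
qed

definition rat_roots :: "nat \<Rightarrow> complex set" where
  "rat_roots M = {x. x ^ M \<in> \<rat>}"

lemma div_closed_rat_roots: "div_closed (rat_roots M)"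
  by (auto simp: div_closed_def rat_roots_def power_divide)

lemma rat_roots_mult: "x \<in> rat_roots M \<Longrightarrow> x \<in> rat_roots (M * N)"
  by (simp add: rat_roots_def power_mult)

lemma Rats_imp_real:
  assumes "y \<in> \<rat>"
  obtains t where "y = complex_of_real t" "complex_of_real \<bar>t\<bar> \<in> \<rat>"
proof -
  obtain a b :: int where ab: "y = of_int a / of_int b" using assms by (metis Rats_cases')
  show ?thesis
  proof (rule that[of "of_int a / of_int b"])
    show "y = complex_of_real (of_int a / of_int b)" using ab by simp
    have "complex_of_real \<bar>of_int a / of_int b\<bar> = of_int \<bar>a\<bar> / of_int \<bar>b\<bar>"
      by (simp add: abs_divide flip: of_int_abs)
    then show "complex_of_real \<bar>of_int a / of_int b\<bar> \<in> \<rat>" by simp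
  qed
qed

text \<open>As \<open>x ^ m\<close> is a real number of either sign, \<open>sgn x ^ m\<close> is 1
  or -1, whence the doubled exponent.\<close>

lemma radical_polar:
  fixes x :: complex
  assumes "x \<noteq> 0" "x ^ m \<in> \<rat>"
  shows "complex_of_real (norm x) ^ m \<in> \<rat>" "sgn x ^ (2 * m) = 1"
proof -
  obtain t where t: "x ^ m = complex_of_real t" "complex_of_real \<bar>t\<bar> \<in> \<rat>" using Rats_imp_real[OF assms(2)] .
  have n: "norm x ^ m = \<bar>t\<bar>" using t(1) by (metis norm_of_real norm_power)
  then show "complex_of_real (norm x) ^ m \<in> \<rat>" using t(2) by (metis of_real_power)
  have "t \<noteq> 0" using t(1) assms(1) by auto
  have "sgn x ^ m = complex_of_real t / complex_of_real \<bar>t\<bar>"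
    using t(1) n by (simp add: sgn_eq power_divide flip: of_real_power)
  then have "sgn x ^ m = complex_of_real (sgn t)" using \<open>t \<noteq> 0\<close> by (simp add: sgn_if)
  then have "(sgn x ^ m) ^ 2 = complex_of_real (sgn t ^ 2)" by simp
  also have "\<dots> = 1" using \<open>t \<noteq> 0\<close> by (simp add: sgn_if)
  finally show "sgn x ^ (2 * m) = 1" by (simp add: power_mult mult.commute flip: power_mult)
qed

text \<open>Each further \<open>x i\<close> has at most the two conjugates \<open>x i\<close> and
  \<open>- x i\<close>, and so at most doubles the index.\<close>

lemma sigma_stabilizer:
  assumes n: "n > 1" and C: "finite C" and x: "\<And>i. i \<in> C \<Longrightarrow> x i \<in> cyc n"
    and orbit: "\<And>i s. i \<in> C \<Longrightarrow> s \<in> totatives n \<Longrightarrow> sigma n s (x i) = x i \<or> sigma n s (x i) = - x i"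
  shows "unit_subgroup n {s\<in>totatives n. \<forall>i\<in>C. sigma n s (x i) = x i} \<and>
    totient n \<le> 2 ^ card C * card {s\<in>totatives n. \<forall>i\<in>C. sigma n s (x i) = x i}"
  using C x orbit
proof (induction C)
  case empty
  then show ?case using unit_subgroup_totatives[OF n] by (simp add: totient_def)
next
  case (insert a C)
  let ?H = "{s\<in>totatives n. \<forall>i\<in>C. sigma n s (x i) = x i}"
  let ?H' = "{s\<in>totatives n. \<forall>i\<in>insert a C. sigma n s (x i) = x i}"
  let ?\<chi> = "\<lambda>s. sigma n s (x a)"
  have IH: "unit_subgroup n ?H" "totient n \<le> 2 ^ card C * card ?H" using insert by auto
  have xa: "x a \<in> cyc n" using insert.prems by simp
  have \<chi>: "?\<chi> (s * t mod n) = ?\<chi> (s' * t mod n)"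
    if "s \<in> ?H" "s' \<in> ?H" "t \<in> ?H" "?\<chi> s = ?\<chi> s'" for s s' t
  proof -
    have "coprime s n" "coprime s' n" "coprime t n" using that by (auto simp: totatives_def)
    then show ?thesis
      using sigma_sigma[OF n _ _ xa, of s t] sigma_sigma[OF n _ _ xa, of s' t] that(4) by (simp add: sigma_mod[OF n])
  qed
  note orb = card_orbit_stabilizer[OF IH(1) n, of ?\<chi>, OF \<chi>]
  have H': "?H' = {s\<in>?H. ?\<chi> s = ?\<chi> 1}" using sigma_1[OF n xa] by auto
  have "?\<chi> ` ?H \<subseteq> {x a, - x a}" using insert.prems by auto
  then have "card (?\<chi> ` ?H) \<le> card {x a, - x a}" by (intro card_mono) auto
  also have "\<dots> \<le> 2" by (simp add: card_insert_if)
  finally have c2: "card (?\<chi> ` ?H) \<le> 2" .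
  have "card ?H = card (?\<chi> ` ?H) * card ?H'" unfolding H' using orb(3) by blast
  also have "\<dots> \<le> 2 * card ?H'" using c2 by (rule mult_le_mono1)
  finally have "2 ^ card C * card ?H \<le> 2 ^ card C * (2 * card ?H')" by (rule mult_le_mono2)
  with IH(2) have "totient n \<le> 2 ^ card C * (2 * card ?H')" by (rule le_trans)
  then have "totient n \<le> 2 ^ card (insert a C) * card ?H'"
    using insert.hyps by (simp add: mult_ac)
  moreover have "unit_subgroup n ?H'" unfolding H' using orb(1) by blast
  ultimately show ?case by blast
qed

lemma root_of_unity_dvd:
  fixes \<omega> :: "'a :: monoid_mult"
  assumes "\<omega> ^ n = 1" "n dvd m"
  shows "\<omega> ^ m = 1"
  using assms by (auto simp: power_mult elim!: dvdE)

lemma common_cyclotomic_level: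
  assumes "finite C" "\<And>i. i \<in> C \<Longrightarrow> x i \<in> Cyc" "\<And>i. i \<in> C \<Longrightarrow> \<exists>k>0. \<zeta> i ^ k = (1::complex)"
  shows "\<exists>n>1. \<forall>i\<in>C. x i \<in> cyc n \<and> \<zeta> i ^ n = 1"
  using assms
proof (induction C)
  case empty
  then show ?case by (intro exI[of _ 2]) auto
next
  case (insert a C)
  then obtain n where n: "n > 1" "\<forall>i\<in>C. x i \<in> cyc n \<and> \<zeta> i ^ n = 1" by auto
  obtain k where k: "k > 0" "\<zeta> a ^ k = 1" using insert.prems by auto
  obtain m where m: "m > 1" "n * k dvd m" "x a \<in> cyc m" using CycE[of "x a" "n * k"] insert.prems n k by auto
  have nm: "n dvd m" "k dvd m" using m(2) by (auto intro: dvd_mult_left dvd_mult_right)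
  have "cyc n \<subseteq> cyc m" using nm m by (intro cyc_mono) auto
  moreover have "\<zeta> i ^ m = 1" if "i \<in> C" for i using root_of_unity_dvd n(2) nm(1) that by blast
  moreover have "\<zeta> a ^ m = 1" using root_of_unity_dvd k(2) nm(2) by blast
  ultimately show ?case using m n by (intro exI[of _ m]) auto
qed

text \<open>Write \<open>x i\<close> as its modulus \<open>r i\<close> times a root of unity
  \<open>\<zeta> i\<close>. Automorphisms fixing all \<open>r i\<close> turn the relation into
  relations for the powers \<open>\<zeta> i ^ s\<close> with coefficients \<open>q i * r i\<close>.
  Their index is at most \<open>2 ^ l\<close>, so the exponent depends on \<open>l\<close>
  only.\<close>

lemma cyclotomic_class_sums_vanish:
  "\<exists>M>0. \<forall>C (q :: 'i \<Rightarrow> complex) x. finite C \<longrightarrow> card C \<le> l \<longrightarrow>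
     (\<forall>i\<in>C. q i \<in> \<rat> \<and> x i \<noteq> 0 \<and> x i \<in> Cyc \<and> (\<exists>m>0. x i ^ m \<in> \<rat>)) \<longrightarrow> (\<Sum>i\<in>C. q i * x i) = 0 \<longrightarrow>
     class_sums_vanish (rat_roots M) C x (\<lambda>i. q i * x i)"
proof -
  obtain M where M: "M > 0" "\<forall>n>1. \<forall>H (I :: 'i set) (e :: 'i \<Rightarrow> complex) \<zeta>.
     unit_subgroup n H \<longrightarrow> totient n \<le> 2 ^ l * card H \<longrightarrow> finite I \<longrightarrow> card I \<le> l \<longrightarrow>
     (\<forall>i\<in>I. \<zeta> i ^ n = 1) \<longrightarrow> (\<forall>s\<in>H. (\<Sum>i\<in>I. e i * \<zeta> i ^ s) = 0) \<longrightarrow>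
     class_sums_vanish (roots_of_unity M) I \<zeta> (\<lambda>i. e i * \<zeta> i)"
    using bounded_class_sums_vanish[of "2 ^ l" l] by (elim exE conjE) (rule that)
  \<comment> \<open>The factor 2 clears the moduli, whose squares are rational.\<close>
  have "class_sums_vanish (rat_roots (M * 2)) C x (\<lambda>i. q i * x i)"
    if C: "finite C" "card C \<le> l" and qx: "\<forall>i\<in>C. q i \<in> \<rat> \<and> x i \<noteq> 0 \<and> x i \<in> Cyc \<and> (\<exists>m>0. x i ^ m \<in> \<rat>)"
      and rel: "(\<Sum>i\<in>C. q i * x i) = 0" for C and q x :: "'i \<Rightarrow> complex"
  proof -
    define r where "r i = complex_of_real (norm (x i))" for i
    define \<zeta> where "\<zeta> i = sgn (x i)" for i
    have nz: "x i \<noteq> 0" if "i \<in> C" for i using qx that by blast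
    have x: "x i = r i * \<zeta> i" for i by (simp add: r_def \<zeta>_def sgn_eq)
    have \<zeta>0: "\<zeta> i \<noteq> 0" if "i \<in> C" for i using nz[OF that] by (simp add: \<zeta>_def sgn_zero_iff)
    have rm: "\<exists>m>0. r i ^ m \<in> \<rat>" and \<zeta>m: "\<exists>k>0. \<zeta> i ^ k = 1" if i: "i \<in> C" for i
    proof -
      obtain m where m: "m > 0" "x i ^ m \<in> \<rat>" using qx i by blast
      note p = radical_polar[OF nz[OF i] m(2)]
      show "\<exists>m>0. r i ^ m \<in> \<rat>" using p(1) m by (auto simp: r_def)
      show "\<exists>k>0. \<zeta> i ^ k = 1" using p(2) m by (intro exI[of _ "2 * m"]) (simp add: \<zeta>_def)
    qed
    have "\<exists>n>1. \<forall>i\<in>C. x i \<in> cyc n \<and> \<zeta> i ^ n = 1"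
      by (rule common_cyclotomic_level[OF C(1) _ \<zeta>m]) (use qx in auto)
    then obtain n where n: "n > 1" "\<And>i. i \<in> C \<Longrightarrow> x i \<in> cyc n" "\<And>i. i \<in> C \<Longrightarrow> \<zeta> i ^ n = 1" by blast
    have \<zeta>c: "\<zeta> i \<in> cyc n" if "i \<in> C" for i using root_of_unity_in_cyc[OF n(3)[OF that]] n by simp
    have rc: "r i \<in> cyc n" if "i \<in> C" for i
      using subfield_divide[OF csubfield_cyc[OF n(1)] n(2)[OF that] \<zeta>c[OF that]] \<zeta>0[OF that]
      by (simp add: x)
    have orbit: "sigma n s (r i) = r i \<or> sigma n s (r i) = - r i" if i: "i \<in> C" and s: "s \<in> totatives n" for i s
    proof -
      obtain m where "m > 0" "r i ^ m \<in> \<rat>" using rm[OF i] by blast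
      then show ?thesis
        using sigma_real_radical[OF n(1), of s "norm (x i)" m] rc[OF i] nz[OF i] s by (simp add: r_def totatives_def)
    qed
    have r2: "r i ^ 2 \<in> \<rat>" if i: "i \<in> C" for i
    proof -
      obtain m where "m > 0" "r i ^ m \<in> \<rat>" using rm[OF i] by blast
      then show ?thesis
        using cyclotomic_real_radical_square[OF n(1), of "norm (x i)" m] rc[OF i] nz[OF i] by (simp add: r_def)
    qed
    define H where "H = {s\<in>totatives n. \<forall>i\<in>C. sigma n s (r i) = r i}"
    have H: "unit_subgroup n H" "totient n \<le> 2 ^ card C * card H"
      using sigma_stabilizer[OF n(1) C(1) rc orbit] by (auto simp: H_def)
    have "(2::nat) ^ card C * card H \<le> 2 ^ l * card H" using C(2) by (intro mult_le_mono1 power_increasing) auto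
    then have H2: "totient n \<le> 2 ^ l * card H" using H(2) by linarith
    have cs: "class_sums_vanish (roots_of_unity M) C \<zeta> (\<lambda>i. (q i * r i) * \<zeta> i)"
    proof (rule M(2)[rule_format, OF n(1) H(1) H2 C n(3)])
      fix s assume s: "s \<in> H"
      then have cop: "coprime s n" by (simp add: H_def totatives_def)
      have qc: "q i \<in> cyc n" if "i \<in> C" for i using qx that Rats_subset_cyc by blast
      have "(\<Sum>i\<in>C. q i * r i * \<zeta> i ^ s) = (\<Sum>i\<in>C. sigma n s (q i * x i))"
      proof (rule sum.cong[OF refl])
        fix i assume i: "i \<in> C"
        have "sigma n s (q i * x i) = sigma n s (q i) * (sigma n s (r i) * sigma n s (\<zeta> i))"
          unfolding x using i by (simp add: sigma_mult[OF n(1) cop] qc rc \<zeta>c subring_mult[OF csubring_cyc])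
        also have "sigma n s (q i) = q i" using sigma_Rats[OF n(1) cop] qx i by blast
        also have "sigma n s (r i) = r i" using s i by (simp add: H_def)
        also have "sigma n s (\<zeta> i) = \<zeta> i ^ s" by (rule sigma_root_of_unity[OF n(1) cop n(3)[OF i]])
        finally show "q i * r i * \<zeta> i ^ s = sigma n s (q i * x i)" by (simp add: mult.assoc)
      qed
      also have "\<dots> = sigma n s (\<Sum>i\<in>C. q i * x i)"
        by (rule sigma_sum[OF n(1) cop, symmetric]) (use qc n(2) in \<open>auto intro: subring_mult[OF csubring_cyc]\<close>)
      also have "\<dots> = 0" unfolding rel using sigma_Rats[OF n(1) cop, of 0] by simp
      finally show "(\<Sum>i\<in>C. q i * r i * \<zeta> i ^ s) = 0" .
    qed
    show ?thesis
      unfolding class_sums_vanish_def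
    proof
      fix k assume k: "k \<in> C"
      have "(\<Sum>i\<in>{i\<in>C. x i / x k \<in> rat_roots (M * 2)}. (q i * r i) * \<zeta> i) = 0"
      proof (rule class_sums_vanish_saturated[OF C(1) div_closed_roots_of_unity \<zeta>0 cs])
        fix a i assume a: "a \<in> {i\<in>C. x i / x k \<in> rat_roots (M * 2)}" "i \<in> C" "\<zeta> i / \<zeta> a \<in> roots_of_unity M"
        have "(x i / x a) ^ (M * 2) = (r i ^ 2 / r a ^ 2) ^ M * ((\<zeta> i / \<zeta> a) ^ M) ^ 2"
          unfolding x by (simp add: power_divide power_mult_distrib flip: power_mult) (simp add: mult.commute)
        also have "(\<zeta> i / \<zeta> a) ^ M = 1" using a(3) by (simp add: roots_of_unity_def)
        also have "(r i ^ 2 / r a ^ 2) ^ M * 1 ^ 2 \<in> \<rat>" using r2[OF a(2)] r2[of a] a(1) by simp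
        finally have "x i / x a \<in> rat_roots (M * 2)" by (simp add: rat_roots_def)
        then have "x i / x k \<in> rat_roots (M * 2)"
          using quotient_trans[OF div_closed_rat_roots nz[of a]] a(1) by blast
        then show "i \<in> {i\<in>C. x i / x k \<in> rat_roots (M * 2)}" using a(2) by blast
      qed auto
      then show "(\<Sum>i\<in>{i\<in>C. x i / x k \<in> rat_roots (M * 2)}. q i * x i) = 0"
        by (simp add: x mult.assoc)
    qed
  qed
  then show ?thesis using M(1) by (intro exI[of _ "M * 2"]) auto
qed

text \<open>Kummer theory over \<open>Cyc\<close> splits the relation into classes whose quotients
  lie in \<open>Cyc\<close>; divided by one of its terms, each class becomes a relation inside
  \<open>Cyc\<close>.\<close>

lemma rational_radical_class_sums_vanish:
  "\<exists>M>0. \<forall>I (q :: 'i \<Rightarrow> complex) v. finite I \<longrightarrow> card I \<le> l \<longrightarrow>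
     (\<forall>i\<in>I. q i \<in> \<rat> \<and> v i \<noteq> 0 \<and> (\<exists>m>0. v i ^ m \<in> \<rat>)) \<longrightarrow> (\<Sum>i\<in>I. q i * v i) = 0 \<longrightarrow>
     class_sums_vanish (rat_roots M) I v (\<lambda>i. q i * v i)"
proof -
  obtain M where M: "M > 0" "\<forall>C (q :: 'i \<Rightarrow> complex) x. finite C \<longrightarrow> card C \<le> l \<longrightarrow>
     (\<forall>i\<in>C. q i \<in> \<rat> \<and> x i \<noteq> 0 \<and> x i \<in> Cyc \<and> (\<exists>m>0. x i ^ m \<in> \<rat>)) \<longrightarrow> (\<Sum>i\<in>C. q i * x i) = 0 \<longrightarrow>
     class_sums_vanish (rat_roots M) C x (\<lambda>i. q i * x i)"
    using cyclotomic_class_sums_vanish[of l] by (elim exE conjE) (rule that)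
  have "class_sums_vanish (rat_roots M) I v (\<lambda>i. q i * v i)"
    if I: "finite I" "card I \<le> l" and qv: "\<forall>i\<in>I. q i \<in> \<rat> \<and> v i \<noteq> 0 \<and> (\<exists>m>0. v i ^ m \<in> \<rat>)"
      and rel: "(\<Sum>i\<in>I. q i * v i) = 0" for I and q v :: "'i \<Rightarrow> complex"
  proof -
    \<comment> \<open>Classes for \<open>rat_roots M\<close> need not lie in a single
      \<open>Cyc\<close>-class, so the refinement uses the intersection and is coarsened at the
      end.\<close>
    define G where "G = Cyc \<inter> rat_roots M"
    have dG: "div_closed G"
      using div_closed_subfield[OF csubfield_Cyc] div_closed_rat_roots by (simp add: div_closed_def G_def)
    have QC: "\<rat> \<subseteq> Cyc" using Rats_subset_cyc[of _ 2] cyc_subset_Cyc[of 2] by auto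
    have nz: "v i \<noteq> 0" if "i \<in> I" for i using qv that by blast
    have K: "class_sums_vanish Cyc I v (\<lambda>i. q i * v i)"
      by (rule kummer_class_sums_vanish[OF csubfield_Cyc root_of_unity_in_Cyc I(1)]) (use qv QC rel in auto)
    have "class_sums_vanish G I v (\<lambda>i. q i * v i)"
    proof (rule class_sums_vanish_refine[OF dG _ nz])
      show "G \<subseteq> Cyc" by (simp add: G_def)
      fix j assume j: "j \<in> I"
      let ?C = "{i\<in>I. v i / v j \<in> Cyc}"
      define x where "x i = v i / v j" for i
      have C: "finite ?C" "card ?C \<le> l" using I card_mono[of I ?C] by auto
      have "\<forall>i\<in>?C. q i \<in> \<rat> \<and> x i \<noteq> 0 \<and> x i \<in> Cyc \<and> (\<exists>m>0. x i ^ m \<in> \<rat>)"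
      proof
        fix i assume i: "i \<in> ?C"
        then obtain m where m: "m > 0" "v i ^ m \<in> \<rat>" using qv by blast
        obtain m' where m': "m' > 0" "v j ^ m' \<in> \<rat>" using qv j by blast
        have "x i ^ (m * m') = (v i ^ m) ^ m' / (v j ^ m') ^ m"
          by (simp add: x_def power_divide power_mult[symmetric] mult.commute[of m'])
        also have "\<dots> \<in> \<rat>" using m m' by simp
        finally show "q i \<in> \<rat> \<and> x i \<noteq> 0 \<and> x i \<in> Cyc \<and> (\<exists>m>0. x i ^ m \<in> \<rat>)"
          using i m m' qv nz[OF j] nz[of i] by (auto simp: x_def intro!: exI[of _ "m * m'"])
      qed
      moreover have "(\<Sum>i\<in>?C. q i * x i) = 0"
      proof -
        have "(\<Sum>i\<in>?C. q i * x i) = (\<Sum>i\<in>?C. q i * v i) / v j" by (simp add: x_def sum_divide_distrib)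
        also have "(\<Sum>i\<in>?C. q i * v i) = 0" using K j by (simp add: class_sums_vanish_def)
        finally show ?thesis by simp
      qed
      ultimately have csx: "class_sums_vanish (rat_roots M) ?C x (\<lambda>i. q i * x i)"
        using M(2) C by blast
      show "class_sums_vanish G ?C v (\<lambda>i. q i * v i)"
        unfolding class_sums_vanish_def
      proof
        fix k assume k: "k \<in> ?C"
        have xx: "x i / x k = v i / v k" for i using nz[OF j] by (simp add: x_def)
        have cl: "v i / v k \<in> Cyc" if "i \<in> ?C" for i
        proof -
          have "x i \<in> Cyc" "x k \<in> Cyc" using that k by (auto simp: x_def)
          then show ?thesis using subfield_divide[OF csubfield_Cyc] unfolding xx[symmetric] by blast
        qed
        have eq: "{i\<in>?C. v i / v k \<in> G} = {i\<in>?C. x i / x k \<in> rat_roots M}"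
          unfolding xx G_def using cl by blast
        have "(\<Sum>i\<in>{i\<in>?C. v i / v k \<in> G}. q i * v i) = v j * (\<Sum>i\<in>{i\<in>?C. x i / x k \<in> rat_roots M}. q i * x i)"
          unfolding eq sum_distrib_left using nz[OF j] by (intro sum.cong) (auto simp: x_def)
        also have "\<dots> = 0" using csx k unfolding class_sums_vanish_def by simp
        finally show "(\<Sum>i\<in>{i\<in>?C. v i / v k \<in> G}. q i * v i) = 0" .
      qed
    qed
    moreover have "G \<subseteq> rat_roots M" by (simp add: G_def)
    ultimately show ?thesis
      using class_sums_vanish_coarsen[OF I(1) dG div_closed_rat_roots, of M v "\<lambda>i. q i * v i"] nz by blast
  qed
  then show ?thesis using M(1) by blast
qed

section \<open>Arbitrary complex coefficients\<close>

text \<open>The subring generated by all radicals of rationals, since a product of radicals is a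
  radical. The complex coefficients of a relation are compared by linear dependence over this ring,
  which contains every admissible value \<open>v i\<close>.\<close>

definition radical_ring :: "complex set" where
  "radical_ring = {sum_list xs | xs. \<forall>x\<in>set xs. \<exists>m>0. x ^ m \<in> \<rat>}"

lemma radical_mult:
  fixes x y :: complex
  assumes "\<exists>m>0. x ^ m \<in> \<rat>" "\<exists>m>0. y ^ m \<in> \<rat>"
  shows "\<exists>m>0. (x * y) ^ m \<in> \<rat>"
proof -
  obtain m where m: "m > 0" "x ^ m \<in> \<rat>" using assms by blast
  obtain m' where m': "m' > 0" "y ^ m' \<in> \<rat>" using assms by blast
  have "(x * y) ^ (m * m') = (x ^ m) ^ m' * (y ^ m') ^ m"
    by (simp add: power_mult_distrib power_mult[symmetric] mult.commute[of m'])
  also have "\<dots> \<in> \<rat>" using m m' by simp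
  finally show ?thesis using m m' by (intro exI[of _ "m * m'"]) simp
qed

lemma csubring_radical_ring: "csubring radical_ring"
  unfolding csubring_def
proof (intro conjI ballI)
  show "1 \<in> radical_ring" unfolding radical_ring_def by (intro CollectI exI[of _ "[1]"]) (auto intro: exI[of _ 1])
  fix x y assume "x \<in> radical_ring" "y \<in> radical_ring"
  then obtain xs ys where xs: "x = sum_list xs" "\<forall>x\<in>set xs. \<exists>m>0. x ^ m \<in> \<rat>"
    and ys: "y = sum_list ys" "\<forall>x\<in>set ys. \<exists>m>0. x ^ m \<in> \<rat>" unfolding radical_ring_def by blast
  have m1: "\<exists>m>0. (-1::complex) ^ m \<in> \<rat>" by (intro exI[of _ 1]) simp
  have ys': "\<exists>m>0. (- z) ^ m \<in> \<rat>" if "z \<in> set ys" for z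
    using radical_mult[OF m1, of z] ys that by simp
  have "sum_list (map uminus ys) = - sum_list ys" by (induction ys) auto
  then have "x - y = sum_list (xs @ map uminus ys)" by (simp add: xs ys)
  moreover have "\<forall>z\<in>set (xs @ map uminus ys). \<exists>m>0. z ^ m \<in> \<rat>"
  proof
    fix z assume "z \<in> set (xs @ map uminus ys)"
    then consider "z \<in> set xs" | z' where "z' \<in> set ys" "z = - z'" by auto
    then show "\<exists>m>0. z ^ m \<in> \<rat>"
    proof cases
      case 1
      then show ?thesis using xs(2) by blast
    next
      case 2
      then show ?thesis using ys'[OF 2(1)] by (simp only:)
    qed
  qed
  ultimately show "x - y \<in> radical_ring" unfolding radical_ring_def by blast
  have "x * y = sum_list (concat (map (\<lambda>a. map (\<lambda>b. a * b) ys) xs))"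
    unfolding xs(1) ys(1) by (induction xs) (simp_all add: algebra_simps sum_list_const_mult)
  moreover have "\<exists>m>0. z ^ m \<in> \<rat>" if "z \<in> set (concat (map (\<lambda>a. map (\<lambda>b. a * b) ys) xs))" for z
  proof -
    obtain a b where "a \<in> set xs" "b \<in> set ys" "z = a * b" using \<open>z \<in> _\<close> by auto
    then show ?thesis using radical_mult bspec[OF xs(2)] bspec[OF ys(2)] by (simp only:)
  qed
  ultimately show "x * y \<in> radical_ring" unfolding radical_ring_def by blast
qed

lemma radical_in_radical_ring: "\<exists>m>0. x ^ m \<in> \<rat> \<Longrightarrow> x \<in> radical_ring"
  unfolding radical_ring_def by (rule CollectI, rule exI[of _ "[x]"]) simp

text \<open>The length \<open>L\<close> and the exponent \<open>M\<close> serve the whole finite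
  family at once, so later bounds can be fixed before any point is given.\<close>

lemma radical_ring_uniform_representation:
  assumes "finite T" "\<forall>t\<in>T. f t \<in> radical_ring"
  shows "\<exists>(L::nat) M q w. M > 0 \<and> (\<forall>t\<in>T. f t = (\<Sum>k<L. q t k * w t k)) \<and>
    (\<forall>t\<in>T. \<forall>k<L. q t k \<in> \<rat> \<and> w t k \<noteq> 0 \<and> w t k ^ M \<in> \<rat>)"
proof -
  have "\<forall>t\<in>T. \<exists>xs. f t = sum_list xs \<and> (\<forall>x\<in>set xs. \<exists>m>0. x ^ m \<in> \<rat>)"
    using assms(2) unfolding radical_ring_def by blast
  then obtain xs where xs: "\<forall>t\<in>T. f t = sum_list (xs t) \<and> (\<forall>x\<in>set (xs t). \<exists>m>0. x ^ m \<in> \<rat>)"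
    by (rule bchoice[THEN exE])
  define X where "X = (\<Union>t\<in>T. set (xs t))"
  have "finite X" using assms(1) by (simp add: X_def)
  moreover have "\<forall>x\<in>X. \<exists>m>0. x ^ m \<in> \<rat>" using xs by (auto simp: X_def)
  then obtain m where m: "\<forall>x\<in>X. m x > 0 \<and> x ^ m x \<in> \<rat>" by (rule bchoice[THEN exE])
  define M where "M = (\<Prod>x\<in>X. m x)"
  have M0: "M > 0" unfolding M_def using m by (intro prod_pos) auto
  have XM: "x ^ M \<in> \<rat>" if "x \<in> X" for x
  proof -
    have "m x dvd M" unfolding M_def using \<open>finite X\<close> that by (intro dvd_prodI)
    then obtain k where "M = m x * k" by blast
    then show ?thesis using m that by (simp add: power_mult)
  qed
  define L where "L = Max (insert 0 ((\<lambda>t. length (xs t)) ` T))"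
  have L: "length (xs t) \<le> L" if "t \<in> T" for t using assms(1) that by (simp add: L_def)
  \<comment> \<open>Padding and zero entries get coefficient 0 and radical 1, which keeps every
    \<open>w t k\<close> nonzero.\<close>
  define q where "q t k = (if k < length (xs t) \<and> xs t ! k \<noteq> 0 then 1 else 0 :: complex)" for t k
  define w where "w t k = (if k < length (xs t) \<and> xs t ! k \<noteq> 0 then xs t ! k else 1)" for t k
  show ?thesis
  proof (rule exI[of _ L], rule exI[of _ M], rule exI[of _ q], rule exI[of _ w], intro conjI ballI allI impI)
    show "M > 0" by (rule M0)
  next
    fix t assume t: "t \<in> T"
    have "f t = (\<Sum>k<length (xs t). xs t ! k)" using xs t by (simp add: sum_list_sum_nth atLeast0LessThan)
    also have "\<dots> = (\<Sum>k<length (xs t). q t k * w t k)" by (intro sum.cong) (auto simp: q_def w_def)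
    also have "\<dots> = (\<Sum>k<L. q t k * w t k)" using L[OF t] by (intro sum.mono_neutral_left) (auto simp: q_def)
    finally show "f t = (\<Sum>k<L. q t k * w t k)" .
  next
    fix t k assume t: "t \<in> T" "k < L"
    have "xs t ! k \<in> X" if "k < length (xs t)" using t nth_mem[OF that] unfolding X_def by blast
    then show "q t k \<in> \<rat>" "w t k \<noteq> 0" "w t k ^ M \<in> \<rat>" using XM by (auto simp: q_def w_def)
  qed
qed

text \<open>Each \<open>d * c i\<close> is a combination of a subfamily independent over
  \<open>radical_ring\<close>, which also contains the \<open>v i\<close>. Independence gives one
  relation for each \<open>j\<close>, and expanding the \<open>f i j\<close> into \<open>L\<close>
  radicals makes its coefficients rational and its length \<open>card I * L\<close>, whatever
  \<open>v\<close> is.\<close>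

theorem radical_class_sums_vanish:
  fixes c :: "'i \<Rightarrow> complex"
  assumes I: "finite I"
  shows "\<exists>M>0. \<forall>v. (\<forall>i\<in>I. v i \<noteq> 0 \<and> (\<exists>m>0. v i ^ m \<in> \<rat>)) \<longrightarrow> (\<Sum>i\<in>I. c i * v i) = 0 \<longrightarrow>
    class_sums_vanish (rat_roots M) I v (\<lambda>i. c i * v i)"
proof -
  note E = csubring_radical_ring
  obtain J d f where J: "J \<subseteq> I" "d \<in> radical_ring" "d \<noteq> 0" "\<And>i j. i \<in> I \<Longrightarrow> j \<in> J \<Longrightarrow> f i j \<in> radical_ring"
    "\<And>i. i \<in> I \<Longrightarrow> d * c i = (\<Sum>j\<in>J. f i j * c j)"
    "\<And>g j. (\<And>j. j \<in> J \<Longrightarrow> g j \<in> radical_ring) \<Longrightarrow> (\<Sum>j\<in>J. g j * c j) = 0 \<Longrightarrow> j \<in> J \<Longrightarrow> g j = 0"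
    using subring_independent_subfamily[OF E I, of c] by blast
  have fJ: "finite J" using J(1) I finite_subset by blast
  have fIJ: "finite (I \<times> J)" using I fJ by simp
  have "\<forall>t\<in>I \<times> J. case_prod f t \<in> radical_ring" using J(4) by auto
  from radical_ring_uniform_representation[OF fIJ this]
  obtain L MW q w where W: "MW > 0" "\<forall>t\<in>I \<times> J. case_prod f t = (\<Sum>k<L::nat. q t k * w t k)"
    "\<forall>t\<in>I \<times> J. \<forall>k<L. q t k \<in> \<rat> \<and> w t k \<noteq> 0 \<and> w t k ^ MW \<in> \<rat>"
    by (elim exE conjE) (rule that)
  obtain M where M: "M > 0" "\<forall>K (q :: 'i \<times> nat \<Rightarrow> complex) v. finite K \<longrightarrow> card K \<le> card I * L \<longrightarrow>
     (\<forall>i\<in>K. q i \<in> \<rat> \<and> v i \<noteq> 0 \<and> (\<exists>m>0. v i ^ m \<in> \<rat>)) \<longrightarrow> (\<Sum>i\<in>K. q i * v i) = 0 \<longrightarrow>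
     class_sums_vanish (rat_roots M) K v (\<lambda>i. q i * v i)"
    using rational_radical_class_sums_vanish[where 'i = "'i \<times> nat", of "card I * L"] by (elim exE conjE) (rule that)
  \<comment> \<open>\<open>MW\<close> is the exponent of the radicals \<open>w\<close> in the
    expansions; it leads from quotients of products \<open>w * v\<close> to quotients of
    \<open>v\<close>.\<close>
  have "class_sums_vanish (rat_roots (M * MW)) I v (\<lambda>i. c i * v i)"
    if v: "\<forall>i\<in>I. v i \<noteq> 0 \<and> (\<exists>m>0. v i ^ m \<in> \<rat>)" and rel: "(\<Sum>i\<in>I. c i * v i) = 0" for v
    unfolding class_sums_vanish_def
  proof
    fix i0 assume i0: "i0 \<in> I"
    have nz: "v i \<noteq> 0" if "i \<in> I" for i using v that by blast
    define A where "A = {i\<in>I. v i / v i0 \<in> rat_roots (M * MW)}"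
    have AI: "A \<subseteq> I" by (auto simp: A_def)
    have swap: "d * (\<Sum>i\<in>B. c i * v i) = (\<Sum>j\<in>J. (\<Sum>i\<in>B. f i j * v i) * c j)" if B: "B \<subseteq> I" for B
    proof -
      have "d * (\<Sum>i\<in>B. c i * v i) = (\<Sum>i\<in>B. (\<Sum>j\<in>J. f i j * c j) * v i)"
        unfolding sum_distrib_left
      proof (rule sum.cong[OF refl])
        fix i assume "i \<in> B"
        then show "d * (c i * v i) = (\<Sum>j\<in>J. f i j * c j) * v i" using J(5)[of i] B by (auto simp: mult.assoc[symmetric])
      qed
      also have "\<dots> = (\<Sum>j\<in>J. (\<Sum>i\<in>B. f i j * v i) * c j)"
        unfolding sum_distrib_right by (subst sum.swap) (simp add: mult_ac)
      finally show ?thesis .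
    qed
    have fv0: "(\<Sum>i\<in>I. f i j * v i) = 0" if j: "j \<in> J" for j
    proof (rule J(6)[OF _ _ j])
      show "(\<Sum>j\<in>J. (\<Sum>i\<in>I. f i j * v i) * c j) = 0" using swap[of I] rel by simp
      show "(\<Sum>i\<in>I. f i j * v i) \<in> radical_ring" if "j \<in> J" for j
      proof (rule subring_sum[OF E])
        fix i assume i: "i \<in> I"
        then have "v i \<in> radical_ring" using v radical_in_radical_ring by blast
        then show "f i j * v i \<in> radical_ring" by (rule subring_mult[OF E J(4)[OF i \<open>j \<in> J\<close>]])
      qed
    qed
    have fA0: "(\<Sum>i\<in>A. f i j * v i) = 0" if j: "j \<in> J" for j
    proof -
      define Q where "Q = (\<lambda>(i, k). q (i, j) k)"
      define V where "V = (\<lambda>(i, k). w (i, j) k * v i)"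
      have expand: "(\<Sum>i\<in>B. f i j * v i) = (\<Sum>t\<in>B \<times> {..<L}. Q t * V t)" if B: "B \<subseteq> I" for B
      proof -
        have "(\<Sum>i\<in>B. f i j * v i) = (\<Sum>i\<in>B. \<Sum>k<L. Q (i, k) * V (i, k))"
        proof (rule sum.cong[OF refl])
          fix i assume "i \<in> B"
          then have "f i j = (\<Sum>k<L. q (i, j) k * w (i, j) k)" using bspec[OF W(2), of "(i, j)"] B j by auto
          then show "f i j * v i = (\<Sum>k<L. Q (i, k) * V (i, k))"
            by (simp add: Q_def V_def sum_distrib_right mult.assoc)
        qed
        also have "\<dots> = (\<Sum>t\<in>B \<times> {..<L}. Q t * V t)" by (simp add: sum.cartesian_product case_prod_unfold)
        finally show ?thesis .
      qed
      have Wij: "Q (i, k) \<in> \<rat>" "w (i, j) k \<noteq> 0" "w (i, j) k ^ MW \<in> \<rat>" if "i \<in> I" "k < L" for i k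
        using bspec[OF W(3), of "(i, j)"] that j by (auto simp: Q_def)
      have Vnz: "V t \<noteq> 0" if "t \<in> I \<times> {..<L}" for t
        using that Wij nz by (auto simp: V_def)
      have Vrad: "\<exists>m>0. V t ^ m \<in> \<rat>" if t: "t \<in> I \<times> {..<L}" for t
      proof -
        obtain i k where ik: "t = (i, k)" "i \<in> I" "k < L" using t by auto
        have "\<exists>m>0. w (i, j) k ^ m \<in> \<rat>" using Wij(3)[OF ik(2,3)] W(1) by blast
        then have "\<exists>m>0. (w (i, j) k * v i) ^ m \<in> \<rat>" using v ik by (intro radical_mult) auto
        then show ?thesis by (simp add: V_def ik)
      qed
      have fin: "finite (I \<times> {..<L})" using I by simp
      have cs: "class_sums_vanish (rat_roots M) (I \<times> {..<L}) V (\<lambda>t. Q t * V t)"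
      proof (rule M(2)[rule_format, OF fin])
        show "card (I \<times> {..<L}) \<le> card I * L" by (simp add: card_cartesian_product)
        show "Q t \<in> \<rat> \<and> V t \<noteq> 0 \<and> (\<exists>m>0. V t ^ m \<in> \<rat>)" if "t \<in> I \<times> {..<L}" for t
          using that Wij Vnz[OF that] Vrad[OF that] by auto
        show "(\<Sum>t\<in>I \<times> {..<L}. Q t * V t) = 0" using expand[of I] fv0[OF j] by simp
      qed
      \<comment> \<open>A quotient of \<open>V\<close> with rational \<open>M\<close>-th power
        forces a quotient of \<open>v\<close> with rational \<open>(M * MW)\<close>-th power, so
        this product set is a union of classes of \<open>V\<close>.\<close>
      have "(\<Sum>t\<in>A \<times> {..<L}. Q t * V t) = 0"
      proof (rule class_sums_vanish_saturated[OF fin div_closed_rat_roots Vnz cs])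
        fix a t assume a: "a \<in> A \<times> {..<L}" "t \<in> I \<times> {..<L}" "V t / V a \<in> rat_roots M"
        obtain i k where t: "t = (i, k)" "i \<in> I" "k < L" using a by auto
        obtain i' k' where a': "a = (i', k')" "i' \<in> A" "i' \<in> I" "k' < L" using a AI by auto
        have wn: "w (i, j) k \<noteq> 0" "w (i', j) k' \<noteq> 0" using Wij(2) t a' by auto
        have "v i / v i' = (V t / V a) * (w (i', j) k' / w (i, j) k)"
          using wn by (simp add: t a' V_def)
        then have "(v i / v i') ^ (M * MW) = ((V t / V a) ^ M) ^ MW * ((w (i', j) k' ^ MW) / (w (i, j) k ^ MW)) ^ M"
          by (simp add: power_mult_distrib power_divide power_mult[symmetric] mult.commute[of MW])
        also have "\<dots> \<in> \<rat>" using a(3) Wij(3)[OF t(2,3)] Wij(3)[OF a'(3,4)] by (simp add: rat_roots_def)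
        finally have "v i / v i' \<in> rat_roots (M * MW)" by (simp add: rat_roots_def)
        then have "v i / v i0 \<in> rat_roots (M * MW)"
          using quotient_trans[OF div_closed_rat_roots nz[OF a'(3)]] a'(2) unfolding A_def by blast
        then show "t \<in> A \<times> {..<L}" using t by (simp add: A_def)
      qed (use AI in auto)
      then show ?thesis using expand[OF AI] by simp
    qed
    have "d * (\<Sum>i\<in>A. c i * v i) = 0" unfolding swap[OF AI] using fA0 by simp
    then show "(\<Sum>i\<in>{i\<in>I. v i / v i0 \<in> rat_roots (M * MW)}. c i * v i) = 0" using J(3) by (simp add: A_def)
  qed
  then show ?thesis using M(1) W(1) by (intro exI[of _ "M * MW"]) auto
qed

subsection \<open>Integral linear algebra\<close>

lemma sum_fun_apply: "(\<Sum>a\<in>A. F a) i = (\<Sum>a\<in>A. F a i)"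
  by (induction A rule: infinite_finite_induct) auto

lemma common_denominator:
  fixes r :: "'a \<Rightarrow> rat"
  assumes "finite A"
  shows "\<exists>(D::nat) z. D > 0 \<and> (\<forall>a\<in>A. of_nat D * r a = of_int (z a))"
  using assms
proof (induction A)
  case empty
  then show ?case by (intro exI[of _ 1]) auto
next
  case (insert a A)
  then obtain D :: nat and z where D: "D > 0" "\<forall>a\<in>A. of_nat D * r a = of_int (z a)" by blast
  obtain p q where pq: "quotient_of (r a) = (p, q)" by fastforce
  then have q: "q > 0" "r a = of_int p / of_int q" using quotient_of_denom_pos quotient_of_div by blast+
  then have ra: "of_nat (nat q) * r a = of_int p" by simp
  define z' where "z' b = (if b = a then int D * p else int (nat q) * z b)" for b
  have "of_nat (D * nat q) * r b = of_int (z' b)" if b: "b \<in> insert a A" for b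
  proof (cases "b = a")
    case True
    have "of_nat (D * nat q) * r a = of_nat D * (of_nat (nat q) * r a)" by (simp only: of_nat_mult mult.assoc)
    also have "\<dots> = of_int (z' a)" by (simp add: ra z'_def)
    finally show ?thesis using True by (simp only:)
  next
    case False
    then have "of_nat D * r b = of_int (z b)" using D b by blast
    moreover have "of_nat (D * nat q) * r b = of_nat (nat q) * (of_nat D * r b)" by (simp only: of_nat_mult mult_ac)
    moreover have "of_int (z' b) = of_nat (nat q) * (of_int (z b) :: rat)" using False by (simp add: z'_def)
    ultimately show ?thesis by (simp only:)
  qed
  then show ?case using D(1) q by (intro exI[of _ "D * nat q"] exI[of _ z']) auto
qed

text \<open>Over the rationals, if every unit vector lies in the span of \<open>T\<close>, clearing
  denominators gives the second case. Otherwise a linear functional vanishes on \<open>T\<close> but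
  not on some unit vector, and its values on the unit vectors, cleared of denominators, form
  \<open>m\<close>.\<close>

lemma orthogonal_vector_or_spanning:
  fixes T :: "(nat \<Rightarrow> int) set"
  assumes T: "\<And>t i. t \<in> T \<Longrightarrow> i \<ge> k \<Longrightarrow> t i = 0"
  obtains (orthogonal) m :: "nat \<Rightarrow> int" where "\<exists>i<k. m i \<noteq> 0" "\<And>t. t \<in> T \<Longrightarrow> (\<Sum>i<k. m i * t i) = 0"
  | (spanning) "\<forall>i<k. \<exists>D::nat. D > 0 \<and> (\<exists>S z. finite S \<and> S \<subseteq> T \<and>
      (\<forall>j. (\<Sum>t\<in>S. z t * t j) = (if j = i then int D else 0)))"
proof -
  interpret V: vector_space_pair "\<lambda>(c::rat) (f::nat \<Rightarrow> rat) i. c * f i" "(*) :: rat \<Rightarrow> rat \<Rightarrow> rat"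
    by unfold_locales (auto simp: fun_eq_iff algebra_simps)
  define R where "R t = (\<lambda>i. of_int (t i) :: rat)" for t :: "nat \<Rightarrow> int"
  define e where "e i = (\<lambda>j. if j = i then 1 else 0 :: rat)" for i :: nat
  show thesis
  proof (cases "\<forall>i<k. e i \<in> V.vs1.span (R ` T)")
    case True
    have "\<exists>D::nat. D > 0 \<and> (\<exists>S z. finite S \<and> S \<subseteq> T \<and> (\<forall>j. (\<Sum>t\<in>S. z t * t j) = (if j = i then int D else 0)))"
      if i: "i < k" for i
    proof -
      obtain A r where A: "finite A" "A \<subseteq> R ` T" "e i = (\<Sum>a\<in>A. (\<lambda>j. r a * a j))"
        using True i unfolding V.vs1.span_explicit by blast
      obtain S where S: "S \<subseteq> T" "finite S" "A = R ` S" using finite_subset_image[OF A(1,2)] by blast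
      have inj: "inj_on R S" by (auto simp: inj_on_def R_def fun_eq_iff)
      obtain D :: nat and z where D: "D > 0" "\<forall>t\<in>S. of_nat D * r (R t) = of_int (z t)"
        using common_denominator[OF S(2), of "\<lambda>t. r (R t)"] by blast
      have "(\<Sum>t\<in>S. z t * t j) = (if j = i then int D else 0)" for j
      proof -
        have "e i j = (\<Sum>t\<in>S. r (R t) * of_int (t j))"
          unfolding A(3) S(3) sum_fun_apply sum.reindex[OF inj] by (simp add: R_def)
        then have "of_nat D * e i j = (\<Sum>t\<in>S. of_nat D * r (R t) * of_int (t j))"
          by (simp only: sum_distrib_left mult.assoc)
        also have "\<dots> = (\<Sum>t\<in>S. of_int (z t) * of_int (t j))"
        proof (rule sum.cong[OF refl])
          fix t assume "t \<in> S"
          then show "of_nat D * r (R t) * of_int (t j) = of_int (z t) * of_int (t j)"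
            using bspec[OF D(2)] by (simp only:)
        qed
        also have "\<dots> = of_int (\<Sum>t\<in>S. z t * t j)" by simp
        also have "of_nat D * e i j = of_int (if j = i then int D else 0)" by (simp add: e_def)
        finally show ?thesis by (simp only: of_int_eq_iff)
      qed
      then show ?thesis using D(1) S by blast
    qed
    then show thesis using spanning by blast
  next
    case False
    then obtain i where i: "i < k" "e i \<notin> V.vs1.span (R ` T)" by blast
    obtain B where B: "B \<subseteq> R ` T" "V.vs1.independent B" "R ` T \<subseteq> V.vs1.span B"
      using V.vs1.maximal_independent_subset by blast
    have "e i \<notin> V.vs1.span B" using i(2) V.vs1.span_mono[OF B(1)] by blast
    then have ind: "V.vs1.independent (insert (e i) B)" using B(2) by (simp add: V.vs1.independent_insertI)
    obtain g where g: "Vector_Spaces.linear (\<lambda>(c::rat) (f::nat \<Rightarrow> rat) i. c * f i) (*) g"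
      "\<forall>x\<in>insert (e i) B. g x = (if x = e i then 1 else 0 :: rat)"
      using V.linear_independent_extend[OF ind, of "\<lambda>x. if x = e i then 1 else 0"] by blast
    interpret g: Vector_Spaces.linear "\<lambda>(c::rat) (f::nat \<Rightarrow> rat) i. c * f i" "(*) :: rat \<Rightarrow> rat \<Rightarrow> rat" g by (rule g(1))
    have "e i \<notin> B" using \<open>e i \<notin> V.vs1.span B\<close> V.vs1.span_base by blast
    then have gB: "g b = 0" if "b \<in> B" for b using g(2) that by auto
    have gT: "g (R t) = 0" if "t \<in> T" for t
    proof -
      have "R t \<in> V.vs1.span B" using B(3) that by blast
      then show ?thesis
        by (rule V.vs1.span_induct_alt[where h = "\<lambda>x. g x = 0"]) (auto simp: g.add g.scale gB g.zero)
    qed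
    obtain D :: nat and m where D: "D > 0" "\<forall>j\<in>{..<k}. of_nat D * g (e j) = of_int (m j)"
      using common_denominator[of "{..<k}" "\<lambda>j. g (e j)"] by blast
    show thesis
    proof (rule orthogonal[of m])
      have "of_nat D * g (e i) = of_int (m i)" using D(2) i(1) by blast
      moreover have "g (e i) = 1" using g(2) by simp
      ultimately have "m i \<noteq> 0" using D(1) by auto
      then show "\<exists>i<k. m i \<noteq> 0" using i(1) by blast
      fix t assume t: "t \<in> T"
      have "R t = (\<Sum>j<k. (\<lambda>l. of_int (t j) * e j l))"
      proof
        fix l
        have "(\<Sum>j<k. of_int (t j) * e j l) = (\<Sum>j<k. if j = l then of_int (t l) else 0 :: rat)"
          by (intro sum.cong) (auto simp: e_def)
        also have "\<dots> = R t l" using T[OF t, of l] by (simp add: R_def)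
        finally show "R t l = (\<Sum>j<k. (\<lambda>l. of_int (t j) * e j l)) l" by (simp add: sum_fun_apply)
      qed
      then have "g (R t) = (\<Sum>j<k. of_int (t j) * g (e j))" by (simp add: g.sum g.scale)
      then have *: "(\<Sum>j<k. of_int (t j) * g (e j)) = 0" using gT[OF t] by (simp only:)
      have "of_int (\<Sum>j<k. m j * t j) = (\<Sum>j<k. of_nat D * (of_int (t j) * g (e j)))"
        unfolding of_int_sum
      proof (rule sum.cong[OF refl])
        fix j assume "j \<in> {..<k}"
        then have "of_nat D * g (e j) = of_int (m j)" using bspec[OF D(2)] by blast
        then have "of_int (m j * t j) = (of_nat D * g (e j)) * of_int (t j)" by (simp only: of_int_mult)
        then show "of_int (m j * t j) = of_nat D * (of_int (t j) * g (e j))"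
          by (simp only: mult_ac)
      qed
      also have "\<dots> = 0" using * by (simp only: sum_distrib_left[symmetric] mult_zero_right)
      finally have "of_int (\<Sum>j<k. m j * t j) = (0::rat)" .
      then show "(\<Sum>j<k. m j * t j) = 0" by (simp only: of_int_eq_0_iff)
    qed
  qed
qed

lemma bezout_family:
  fixes m :: "nat \<Rightarrow> int"
  shows "\<exists>g b. (\<forall>i<k. g dvd m i) \<and> (\<Sum>i<k. b i * m i) = g"
proof (induction k)
  case 0
  then show ?case by auto
next
  case (Suc k)
  then obtain g b where g: "\<forall>i<k. g dvd m i" "(\<Sum>i<k. b i * m i) = g" by blast
  obtain u v where uv: "u * g + v * m k = gcd g (m k)" using bezout_int by blast
  define b' where "b' i = (if i = k then v else u * b i)" for i
  have "(\<Sum>i<Suc k. b' i * m i) = u * (\<Sum>i<k. b i * m i) + v * m k"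
    by (simp add: b'_def sum_distrib_left mult.assoc)
  also have "\<dots> = gcd g (m k)" using g uv by simp
  finally have "(\<Sum>i<Suc k. b' i * m i) = gcd g (m k)" .
  moreover have "gcd g (m k) dvd m i" if "i < Suc k" for i
    using g(1) that dvd_trans[OF gcd_dvd1] by (cases "i = k") (auto simp: less_Suc_eq)
  ultimately show ?case by blast
qed

text \<open>Dividing by the gcd makes the one-parameter group injective; the Bezout coefficients
  \<open>b\<close> will supply its inverse as a monomial.\<close>

lemma primitive_multiple:
  fixes m :: "nat \<Rightarrow> int"
  assumes "\<exists>i<k. m i \<noteq> 0"
  obtains g m' b where "\<And>i. i < k \<Longrightarrow> m i = g * m' i" "g \<noteq> 0" "(\<Sum>i<k. b i * m' i) = 1"
proof -
  obtain g b where g: "\<forall>i<k. g dvd m i" "(\<Sum>i<k. b i * m i) = g" using bezout_family by blast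
  have g0: "g \<noteq> 0" using assms g(1) by auto
  have m: "m i = g * (m i div g)" if "i < k" for i using g(1) that by simp
  have "g * (\<Sum>i<k. b i * (m i div g)) = (\<Sum>i<k. b i * m i)"
    unfolding sum_distrib_left using m by (intro sum.cong) (auto simp: algebra_simps)
  then have "(\<Sum>i<k. b i * (m i div g)) = 1" using g(2) g0 by simp
  then show ?thesis using that[of g "\<lambda>i. m i div g" b] m g0 by blast
qed

text \<open>With \<open>g = gcd n K\<close>, Bezout gives \<open>y ^ g \<in> \<rat>\<close>. A prime
  \<open>p\<close> dividing \<open>n / g\<close> would make \<open>x\<close> the \<open>p\<close>-th
  power of a power of this rational number.\<close>

lemma radical_exponent_dvd:
  fixes y :: complex and x :: rat
  assumes y: "y \<noteq> 0" "y ^ n = of_rat x" "n > 0" and K: "y ^ K \<in> \<rat>"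
    and x: "\<And>p r. prime p \<Longrightarrow> p dvd n \<Longrightarrow> r \<noteq> 0 \<Longrightarrow> x \<noteq> r ^ p"
  shows "n dvd K"
proof -
  define g where "g = gcd n K"
  have g: "g dvd n" "g dvd K" by (simp_all add: g_def)
  obtain a b where ab: "n * a = K * b + g" using bezout_nat[of n K] y(3) by (auto simp: g_def)
  have "y ^ (n * a) = y ^ (K * b) * y ^ g" unfolding ab by (rule power_add)
  then have "y ^ g = (y ^ n) ^ a / (y ^ K) ^ b" using y(1) by (simp add: power_mult)
  then have yg: "y ^ g \<in> \<rat>" using y(2) K by simp
  obtain h where h: "n = g * h" using g by blast
  have "h = 1"
  proof (rule ccontr)
    assume "h \<noteq> 1"
    then obtain p where p: "prime p" "p dvd h" using prime_factor_nat by blast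
    then obtain h' where h': "h = p * h'" by blast
    have "(y ^ g) ^ h' \<in> \<rat>" using yg by simp
    then obtain r where r: "(y ^ g) ^ h' = of_rat r" by (metis Rats_cases)
    have "of_rat x = ((y ^ g) ^ h') ^ p"
      unfolding y(2)[symmetric] h h' by (simp add: power_mult[symmetric] mult_ac)
    also have "\<dots> = of_rat (r ^ p)" unfolding r by (simp add: of_rat_power)
    finally have "x = r ^ p" by (simp only: of_rat_eq_iff)
    moreover have "r \<noteq> 0" using r y(1) by auto
    moreover have "p dvd n" using p h by simp
    ultimately show False using x p by blast
  qed
  then show ?thesis using h g by simp
qed

subsection \<open>One-dimensional subtori\<close>

abbreviation "keys \<equiv> Poly_Mapping.keys"
abbreviation "lookup \<equiv> Poly_Mapping.lookup"

definition exponent :: "nat \<Rightarrow> (nat \<Rightarrow> int) \<Rightarrow> (nat \<Rightarrow>\<^sub>0 int)" where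
  "exponent k a = Abs_poly_mapping (\<lambda>i. if i < k then a i else 0)"

definition monomial :: "(nat \<Rightarrow>\<^sub>0 int) \<Rightarrow> (nat \<Rightarrow> complex) \<Rightarrow> complex" where
  "monomial a u = (\<Prod>i\<in>keys a. u i powi lookup a i)"

lemma lookup_exponent: "lookup (exponent k a) i = (if i < k then a i else 0)"
  unfolding exponent_def by (subst lookup_Abs_poly_mapping) (auto intro: finite_subset[of _ "{..<k}"])

lemma keys_exponent: "keys (exponent k a) \<subseteq> {..<k}"
  by (auto simp: in_keys_iff lookup_exponent split: if_splits)

lemma monomial_eq:
  assumes "keys a \<subseteq> {..<k}"
  shows "monomial a u = (\<Prod>i<k. u i powi lookup a i)"
  unfolding monomial_def using assms
  by (intro prod.mono_neutral_left) (auto simp: in_keys_iff)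

lemma prod_power_int:
  fixes f :: "'a \<Rightarrow> complex"
  shows "(\<Prod>i\<in>A. f i) powi n = (\<Prod>i\<in>A. f i powi n)"
  by (induction A rule: infinite_finite_induct) (auto simp: power_int_mult_distrib)

lemma power_int_sum:
  fixes z :: complex
  assumes "z \<noteq> 0"
  shows "z powi (\<Sum>i\<in>A. f i) = (\<Prod>i\<in>A. z powi f i)"
  by (induction A rule: infinite_finite_induct) (auto simp: power_int_add assms)

lemma monomial_exponent: "monomial (exponent k a) u = (\<Prod>i<k. u i powi a i)"
  unfolding monomial_eq[OF keys_exponent] by (rule prod.cong) (auto simp: lookup_exponent)

lemma laurent_eval_eq:
  assumes "finite A" "keys p \<subseteq> A"
  shows "laurent_eval p u = (\<Sum>a\<in>A. lookup p a * monomial a u)"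
  unfolding laurent_eval_def monomial_def[symmetric] using assms
  by (intro sum.mono_neutral_left) (auto simp: in_keys_iff)

lemma laurent_eval_single: "laurent_eval (Poly_Mapping.single a 1) u = monomial a u"
  by (subst laurent_eval_eq[of "{a}"]) auto

lemma laurent_eval_single_diff:
  "laurent_eval (Poly_Mapping.single a 1 - Poly_Mapping.single b 1) u = monomial a u - monomial b u"
proof -
  have "laurent_eval (Poly_Mapping.single a 1 - Poly_Mapping.single b 1) u
      = (\<Sum>c\<in>{a, b}. lookup (Poly_Mapping.single a 1 - Poly_Mapping.single b 1) c * monomial c u)"
  proof (rule laurent_eval_eq)
    show "keys (Poly_Mapping.single a (1::complex) - Poly_Mapping.single b 1) \<subseteq> {a, b}"
      by (auto simp: in_keys_iff lookup_minus lookup_single when_def split: if_splits)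
  qed simp
  also have "\<dots> = monomial a u - monomial b u"
    by (cases "a = b") (auto simp: lookup_minus lookup_single when_def)
  finally show ?thesis .
qed

lemma single_in_laurent_polys:
  "keys a \<subseteq> {..<k} \<Longrightarrow> Poly_Mapping.single a 1 \<in> laurent_polys k"
  by (auto simp: laurent_polys_def)

lemma single_diff_in_laurent_polys:
  assumes "keys a \<subseteq> {..<k}" "keys b \<subseteq> {..<k}"
  shows "Poly_Mapping.single a 1 - Poly_Mapping.single b 1 \<in> laurent_polys k"
proof -
  have "keys (Poly_Mapping.single a (1::complex) - Poly_Mapping.single b 1) \<subseteq> {a, b}"
    using keys_diff[of "Poly_Mapping.single a (1::complex)" "Poly_Mapping.single b 1"] by auto
  then show ?thesis using assms unfolding laurent_polys_def by blast
qed

lemma group_Cstar: "group Cstar"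
proof (rule groupI)
  fix x assume "x \<in> carrier Cstar"
  then show "\<exists>y\<in>carrier Cstar. y \<otimes>\<^bsub>Cstar\<^esub> x = \<one>\<^bsub>Cstar\<^esub>"
    by (intro bexI[of _ "inverse x"]) (auto simp: Cstar_def)
qed (auto simp: Cstar_def)

lemma group_Gm: "group (Gm k)"
  by (simp add: Gm_def group_Cstar)

lemma carrier_Gm: "carrier (Gm k) = (\<Pi>\<^sub>E i\<in>{..<k}. UNIV - {0})"
  by (simp add: Gm_def Cstar_def)

lemma mult_Gm: "x \<otimes>\<^bsub>Gm k\<^esub> y = (\<lambda>i\<in>{..<k}. x i * y i)"
  by (simp add: Gm_def Cstar_def)

lemma Gm_nonzero: "x \<in> carrier (Gm k) \<Longrightarrow> i < k \<Longrightarrow> x i \<noteq> 0"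
  by (auto simp: carrier_Gm PiE_def Pi_def)

definition cochar :: "nat \<Rightarrow> (nat \<Rightarrow> int) \<Rightarrow> (nat \<Rightarrow> complex) \<Rightarrow> (nat \<Rightarrow> complex)" where
  "cochar k m x = (\<lambda>i\<in>{..<k}. x 0 powi m i)"

text \<open>By the Bezout relation, the monomial with exponents \<open>b\<close> takes the value
  \<open>x 0\<close> at the image of \<open>x\<close>. It therefore inverts the parametrization and
  also yields equations for the image.\<close>

lemma subtorus_cochar:
  assumes b: "(\<Sum>i<k. b i * m i) = 1"
  shows "subtorus k 1 (cochar k m ` carrier (Gm 1))"
proof -
  let ?\<phi> = "cochar k m" and ?T = "cochar k m ` carrier (Gm 1)"
  define \<beta> where "\<beta> = exponent k b"
  have \<phi>: "?\<phi> x \<in> carrier (Gm k)" if "x \<in> carrier (Gm 1)" for x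
    using Gm_nonzero[OF that, of 0] by (auto simp: cochar_def carrier_Gm)
  have retract: "monomial \<beta> (?\<phi> x) = x 0" if x: "x \<in> carrier (Gm 1)" for x
  proof -
    have x0: "x 0 \<noteq> 0" using Gm_nonzero[OF x, of 0] by simp
    have "monomial \<beta> (?\<phi> x) = (\<Prod>i<k. x 0 powi (b i * m i))"
      unfolding \<beta>_def monomial_exponent
      by (rule prod.cong) (auto simp: cochar_def power_int_mult[symmetric] mult.commute)
    also have "\<dots> = x 0 powi (\<Sum>i<k. b i * m i)" by (rule power_int_sum[OF x0, symmetric])
    finally show ?thesis using b by simp
  qed
  have ext: "x = y" if "x \<in> carrier (Gm 1)" "y \<in> carrier (Gm 1)" "x 0 = y 0" for x y
    using that by (intro PiE_ext[of x "{..<1}" "\<lambda>_. UNIV - {0}" y]) (auto simp: carrier_Gm)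
  have inj: "inj_on ?\<phi> (carrier (Gm 1))" using retract ext by (metis inj_onI)
  have hom: "?\<phi> \<in> hom (Gm 1) (Gm k)"
  proof (rule homI)
    fix x y assume xy: "x \<in> carrier (Gm 1)" "y \<in> carrier (Gm 1)"
    show "?\<phi> (x \<otimes>\<^bsub>Gm 1\<^esub> y) = ?\<phi> x \<otimes>\<^bsub>Gm k\<^esub> ?\<phi> y"
      by (auto simp: cochar_def mult_Gm power_int_mult_distrib fun_eq_iff)
  qed (rule \<phi>)
  then have gh: "group_hom (Gm 1) (Gm k) ?\<phi>"
    using group_Gm by (simp add: group_hom_def group_hom_axioms_def)
  have sg: "subgroup ?T (Gm k)" by (rule group_hom.img_is_subgroup[OF gh])
  \<comment> \<open>The equation \<open>u i = monomial \<beta> u powi m i\<close>: a point of the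
    image is recovered from its parameter \<open>monomial \<beta> u\<close>.\<close>
  define E where "E = (\<lambda>i. Poly_Mapping.single (exponent k (\<lambda>j. if j = i then 1 else 0)) (1::complex)
      - Poly_Mapping.single (exponent k (\<lambda>j. m i * b j)) 1)"
  have Eeval: "laurent_eval (E i) u = u i - monomial \<beta> u powi m i" if i: "i < k" for i u
  proof -
    have "monomial (exponent k (\<lambda>j. if j = i then 1 else 0)) u = (\<Prod>j<k. if j = i then u i else 1)"
      unfolding monomial_exponent by (rule prod.cong) auto
    also have "\<dots> = u i" using i by simp
    finally have 1: "monomial (exponent k (\<lambda>j. if j = i then 1 else 0)) u = u i" .
    have "monomial (exponent k (\<lambda>j. m i * b j)) u = (\<Prod>j<k. (u j powi b j) powi m i)"
      unfolding monomial_exponent by (rule prod.cong) (auto simp: power_int_mult[symmetric] mult.commute)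
    also have "\<dots> = monomial \<beta> u powi m i"
      unfolding \<beta>_def monomial_exponent by (simp add: prod_power_int)
    finally show ?thesis using 1 by (simp add: E_def laurent_eval_single_diff)
  qed
  have sv: "subvariety k ?T"
    unfolding subvariety_def
  proof (intro exI[of _ "E ` {..<k}"] conjI)
    show "E ` {..<k} \<subseteq> laurent_polys k"
      unfolding E_def by (auto intro!: single_diff_in_laurent_polys keys_exponent)
    show "?T = {u \<in> carrier (Gm k). \<forall>p\<in>E ` {..<k}. laurent_eval p u = 0}"
    proof (intro equalityI subsetI)
      fix u assume "u \<in> ?T"
      then obtain x where x: "x \<in> carrier (Gm 1)" "u = ?\<phi> x" by blast
      have "laurent_eval (E i) u = 0" if "i < k" for i
        unfolding Eeval[OF that] using retract[OF x(1)] that by (simp add: x(2) cochar_def)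
      then show "u \<in> {u \<in> carrier (Gm k). \<forall>p\<in>E ` {..<k}. laurent_eval p u = 0}" using \<phi> x by auto
    next
      fix u assume "u \<in> {u \<in> carrier (Gm k). \<forall>p\<in>E ` {..<k}. laurent_eval p u = 0}"
      then have u: "u \<in> carrier (Gm k)" "\<And>i. i < k \<Longrightarrow> u i = monomial \<beta> u powi m i"
        using Eeval by auto
      define x where "x = (\<lambda>i\<in>{..<1::nat}. monomial \<beta> u)"
      have "monomial \<beta> u \<noteq> 0"
        unfolding \<beta>_def monomial_exponent using Gm_nonzero[OF u(1)] by (simp add: power_int_eq_0_iff)
      then have "x \<in> carrier (Gm 1)" by (auto simp: x_def carrier_Gm)
      moreover have "u = ?\<phi> x"
      proof
        fix i show "u i = ?\<phi> x i"
        proof (cases "i < k")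
          case True
          then show ?thesis using u(2)[OF True] by (simp add: cochar_def x_def)
        next
          case False
          then show ?thesis using u(1) by (auto simp: cochar_def carrier_Gm PiE_def extensional_def)
        qed
      qed
      ultimately show "u \<in> ?T" by blast
    qed
  qed simp
  have iso: "?\<phi> \<in> iso (Gm 1) ((Gm k)\<lparr>carrier := ?T\<rparr>)"
    unfolding iso_def
  proof (intro CollectI conjI)
    show "?\<phi> \<in> hom (Gm 1) ((Gm k)\<lparr>carrier := ?T\<rparr>)"
      using hom by (auto simp: hom_def)
    show "bij_betw ?\<phi> (carrier (Gm 1)) (carrier ((Gm k)\<lparr>carrier := ?T\<rparr>))"
      using inj by (simp add: bij_betw_def)
  qed
  have reg: "regular_map 1 k (carrier (Gm 1)) ?\<phi>"
    unfolding regular_map_def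
  proof (intro conjI allI impI)
    show "?\<phi> ` carrier (Gm 1) \<subseteq> carrier (Gm k)" using \<phi> by blast
    fix j assume j: "j < k"
    show "\<exists>p\<in>laurent_polys 1. \<forall>u\<in>carrier (Gm 1). ?\<phi> u j = laurent_eval p u"
      using j by (intro bexI[of _ "Poly_Mapping.single (exponent 1 (\<lambda>_. m j)) 1"])
        (auto simp: laurent_eval_single monomial_exponent cochar_def intro!: single_in_laurent_polys keys_exponent)
  qed
  have reg': "regular_map k 1 ?T (inv_into (carrier (Gm 1)) ?\<phi>)"
    unfolding regular_map_def
  proof (intro conjI allI impI)
    show "inv_into (carrier (Gm 1)) ?\<phi> ` ?T \<subseteq> carrier (Gm 1)"
      using inj by (auto simp: inv_into_f_f)
    fix j :: nat assume "j < 1"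
    then have j: "j = 0" by simp
    show "\<exists>p\<in>laurent_polys k. \<forall>u\<in>?T. inv_into (carrier (Gm 1)) ?\<phi> u j = laurent_eval p u"
    proof (intro bexI ballI)
      show "Poly_Mapping.single \<beta> 1 \<in> laurent_polys k"
        unfolding \<beta>_def by (intro single_in_laurent_polys keys_exponent)
      fix u assume "u \<in> ?T"
      then obtain x where "x \<in> carrier (Gm 1)" "u = ?\<phi> x" by blast
      then show "inv_into (carrier (Gm 1)) ?\<phi> u j = laurent_eval (Poly_Mapping.single \<beta> 1) u"
        using inj retract j by (simp add: laurent_eval_single inv_into_f_f)
    qed
  qed
  show ?thesis unfolding subtorus_def using sv sg iso reg reg' by blast
qed

section \<open>Cosets inside the variety and the uniform bound\<close>

lemma power_int_power_commute:
  fixes x :: complex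
  shows "(x powi a) ^ m = (x ^ m) powi a"
  by (simp add: power_int_mult[symmetric] mult.commute flip: power_int_of_nat)

lemma radical_power_int:
  fixes x :: complex
  assumes "\<exists>m>0. x ^ m \<in> \<rat>"
  shows "\<exists>m>0. (x powi a) ^ m \<in> \<rat>"
proof -
  obtain m where m: "m > 0" "x ^ m \<in> \<rat>" using assms by blast
  have "(x ^ m) powi a \<in> \<rat>" using m(2) by (simp add: power_int_def)
  then have "(x powi a) ^ m \<in> \<rat>" by (simp only: power_int_power_commute)
  then show ?thesis using m(1) by blast
qed

lemma radical_prod:
  fixes f :: "'a \<Rightarrow> complex"
  assumes "\<And>i. i \<in> A \<Longrightarrow> \<exists>m>0. f i ^ m \<in> \<rat>"
  shows "\<exists>m>0. (\<Prod>i\<in>A. f i) ^ m \<in> \<rat>"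
  using assms
proof (induction A rule: infinite_finite_induct)
  case (insert x A)
  then show ?case using radical_mult[of "f x" "\<Prod>i\<in>A. f i"] by auto
qed (auto intro: exI[of _ 1])

text \<open>A weight that is constant on classes merely rescales each class sum. Translation along
  the subtorus produces such weights.\<close>

lemma class_sums_vanish_weighted_sum:
  assumes I: "finite I" and G: "div_closed G" and nz: "\<And>i. i \<in> I \<Longrightarrow> v i \<noteq> 0"
    and cs: "class_sums_vanish G I v f"
    and h: "\<And>i j. i \<in> I \<Longrightarrow> j \<in> I \<Longrightarrow> v i / v j \<in> G \<Longrightarrow> h i = h j"
  shows "(\<Sum>i\<in>I. f i * h i) = 0"
proof (rule class_sums_vanish_saturated[OF I G nz])
  show "class_sums_vanish G I v (\<lambda>i. f i * h i)"
    unfolding class_sums_vanish_def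
  proof
    fix j assume j: "j \<in> I"
    have "(\<Sum>i\<in>{i\<in>I. v i / v j \<in> G}. f i * h i) = (\<Sum>i\<in>{i\<in>I. v i / v j \<in> G}. f i) * h j"
      unfolding sum_distrib_right using h j by (intro sum.cong) auto
    then show "(\<Sum>i\<in>{i\<in>I. v i / v j \<in> G}. f i * h i) = 0"
      using cs j by (simp add: class_sums_vanish_def)
  qed
qed auto

definition exponent_diff :: "(nat \<Rightarrow>\<^sub>0 int) \<times> (nat \<Rightarrow>\<^sub>0 int) \<Rightarrow> nat \<Rightarrow> int" where
  "exponent_diff aa i = lookup (fst aa) i - lookup (snd aa) i"

lemma monomial_quotient:
  assumes "keys a \<subseteq> {..<k}" "keys a' \<subseteq> {..<k}" "\<And>i. i < k \<Longrightarrow> u i \<noteq> 0"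
  shows "monomial a u / monomial a' u = (\<Prod>i<k. u i powi exponent_diff (a, a') i)"
  unfolding monomial_eq[OF assms(1)] monomial_eq[OF assms(2)] prod_dividef[symmetric]
  using assms(3) by (intro prod.cong) (auto simp: exponent_diff_def power_int_diff)

lemma coset_subset_of_orthogonal:
  assumes S: "S \<subseteq> laurent_polys k" "V = {u \<in> carrier (Gm k). \<forall>p\<in>S. laurent_eval p u = 0}"
    and u: "u \<in> V"
    and cs: "\<And>p. p \<in> S \<Longrightarrow> class_sums_vanish (rat_roots M) (keys p) (\<lambda>a. monomial a u)
        (\<lambda>a. lookup p a * monomial a u)"
    and orth: "\<And>p a a'. p \<in> S \<Longrightarrow> a \<in> keys p \<Longrightarrow> a' \<in> keys p \<Longrightarrow>
        monomial a u / monomial a' u \<in> rat_roots M \<Longrightarrow> (\<Sum>i<k. m i * exponent_diff (a, a') i) = 0"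
    and m: "\<exists>i<k. m i \<noteq> 0"
  shows "\<exists>W. weakly_special k 1 W \<and> u \<in> W \<and> W \<subseteq> V"
proof -
  obtain g m' b where g: "\<And>i. i < k \<Longrightarrow> m i = g * m' i" "g \<noteq> 0" "(\<Sum>i<k. b i * m' i) = 1"
    using primitive_multiple[OF m] by blast
  define T where "T = cochar k m' ` carrier (Gm 1)"
  have T: "subtorus k 1 T" unfolding T_def by (rule subtorus_cochar[OF g(3)])
  have uG: "u \<in> carrier (Gm k)" using u S(2) by simp
  have u0: "u i \<noteq> 0" if "i < k" for i using Gm_nonzero[OF uG that] .
  define W where "W = u <#\<^bsub>Gm k\<^esub> T"
  have "weakly_special k 1 W" unfolding weakly_special_def using T uG W_def by blast
  moreover have "u \<in> W"
  proof -
    have "\<one>\<^bsub>Gm k\<^esub> \<in> T" using T subgroup.one_closed by (auto simp: subtorus_def)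
    moreover have "u \<otimes>\<^bsub>Gm k\<^esub> \<one>\<^bsub>Gm k\<^esub> = u"
      using group.is_monoid[OF group_Gm] uG by (rule monoid.r_one)
    ultimately show ?thesis unfolding W_def l_coset_def by force
  qed
  moreover have "W \<subseteq> V"
  proof
    fix w assume "w \<in> W"
    then obtain x where x: "x \<in> carrier (Gm 1)" "w = u \<otimes>\<^bsub>Gm k\<^esub> cochar k m' x"
      unfolding W_def l_coset_def T_def by blast
    define t where "t = x 0"
    have t0: "t \<noteq> 0" using Gm_nonzero[OF x(1), of 0] by (simp add: t_def)
    have w: "w = (\<lambda>i\<in>{..<k}. u i * t powi m' i)"
      unfolding x(2) by (auto simp: mult_Gm cochar_def t_def fun_eq_iff)
    have wG: "w \<in> carrier (Gm k)" using u0 t0 by (auto simp: w carrier_Gm)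
    have "laurent_eval p w = 0" if p: "p \<in> S" for p
    proof -
      \<comment> \<open>The factor gained by the monomial \<open>a\<close> in passing from
        \<open>u\<close> to \<open>w\<close>. It depends on \<open>a\<close> only through the
        pairing with \<open>m'\<close>, hence is constant on classes by orthogonality.\<close>
      define h where "h a = (\<Prod>i<k. t powi (m' i * lookup a i))" for a
      have keys: "keys a \<subseteq> {..<k}" if "a \<in> keys p" for a
        using S(1) p that by (auto simp: laurent_polys_def)
      have mon: "monomial a w = monomial a u * h a" if "a \<in> keys p" for a
        unfolding monomial_eq[OF keys[OF that]] h_def prod.distrib[symmetric]
        by (rule prod.cong) (auto simp: w power_int_mult_distrib power_int_mult)
      have "laurent_eval p w = (\<Sum>a\<in>keys p. (lookup p a * monomial a u) * h a)"
        by (subst laurent_eval_eq[of "keys p"]) (auto simp: mon mult.assoc)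
      also have "\<dots> = 0"
      proof (rule class_sums_vanish_weighted_sum[OF _ div_closed_rat_roots _ cs[OF p]])
        show "monomial a u \<noteq> 0" if "a \<in> keys p" for a
          unfolding monomial_eq[OF keys[OF that]] using u0 by simp
        fix a a' assume a: "a \<in> keys p" "a' \<in> keys p"
          "monomial a u / monomial a' u \<in> rat_roots M"
        have "g * (\<Sum>i<k. m' i * exponent_diff (a, a') i) = (\<Sum>i<k. m i * exponent_diff (a, a') i)"
          unfolding sum_distrib_left using g(1) by (intro sum.cong) auto
        also have "\<dots> = 0" by (rule orth[OF p a])
        finally have "(\<Sum>i<k. m' i * exponent_diff (a, a') i) = 0" using g(2) by simp
        then have "(\<Sum>i<k. m' i * lookup a i) = (\<Sum>i<k. m' i * lookup a' i)"
          by (simp add: exponent_diff_def right_diff_distrib sum_subtractf)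
        then show "h a = h a'" unfolding h_def by (simp flip: power_int_sum[OF t0])
      qed simp
      finally show ?thesis .
    qed
    then show "w \<in> V" using wG S(2) by simp
  qed
  ultimately show ?thesis by blast
qed

theorem theorem6p4:
  fixes k :: nat and V :: "(nat \<Rightarrow> complex) set"
  assumes "k \<ge> 1" and "subvariety k V"
  shows "\<exists>N::nat. N > 0 \<and>
    (\<forall>u \<in> V. \<forall>(n :: nat \<Rightarrow> nat) (x :: nat \<Rightarrow> rat).
      (\<forall>i<k. n i > 0 \<and> x i \<noteq> 0 \<and> u i ^ n i = of_rat (x i) \<and>
        (\<forall>p::nat. prime p \<and> p dvd n i \<longrightarrow> \<not> (\<exists>y::rat. y \<noteq> 0 \<and> x i = y ^ p))) \<longrightarrow>
      Max (n ` {..<k}) \<ge> N \<longrightarrow>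
      (\<exists>d W. d > 0 \<and> weakly_special k d W \<and> u \<in> W \<and> W \<subseteq> V))"
proof -
  obtain S where S: "finite S" "S \<subseteq> laurent_polys k" "V = {u \<in> carrier (Gm k). \<forall>p\<in>S. laurent_eval p u = 0}"
    using assms(2) unfolding subvariety_def by blast
  have keys: "keys a \<subseteq> {..<k}" if "p \<in> S" "a \<in> keys p" for p a
    using S(2) that by (auto simp: laurent_polys_def)
  have "\<forall>p\<in>S. \<exists>M>0. \<forall>v. (\<forall>a\<in>keys p. v a \<noteq> 0 \<and> (\<exists>m>0. v a ^ m \<in> \<rat>)) \<longrightarrow>
      (\<Sum>a\<in>keys p. lookup p a * v a) = 0 \<longrightarrow>
      class_sums_vanish (rat_roots M) (keys p) v (\<lambda>a. lookup p a * v a)"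
    by (intro ballI radical_class_sums_vanish) simp
  then obtain Mp where Mp: "\<forall>p\<in>S. Mp p > 0 \<and> (\<forall>v. (\<forall>a\<in>keys p. v a \<noteq> 0 \<and> (\<exists>m>0. v a ^ m \<in> \<rat>)) \<longrightarrow>
      (\<Sum>a\<in>keys p. lookup p a * v a) = 0 \<longrightarrow>
      class_sums_vanish (rat_roots (Mp p)) (keys p) v (\<lambda>a. lookup p a * v a))"
    by (rule bchoice[THEN exE])
  \<comment> \<open>One exponent for all equations; passing to a multiple only coarsens the
    classes.\<close>
  define M where "M = (\<Prod>p\<in>S. Mp p)"
  have M0: "M > 0" unfolding M_def using Mp by (intro prod_pos) auto
  have MpM: "rat_roots (Mp p) \<subseteq> rat_roots M" if "p \<in> S" for p
  proof -
    have "Mp p dvd M" unfolding M_def using S(1) that by (intro dvd_prodI)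
    then show ?thesis using rat_roots_mult by (auto elim!: dvdE)
  qed
  \<comment> \<open>All differences that can occur at any point: the set \<open>T\<close> attached
    to a particular \<open>u\<close> is a subset of \<open>\<Delta>\<close>, which makes the bound
    independent of \<open>u\<close>.\<close>
  define \<Delta> where "\<Delta> = exponent_diff ` (\<Union>p\<in>S. keys p \<times> keys p)"
  have fin\<Delta>: "finite \<Delta>" using S(1) by (simp add: \<Delta>_def)
  define spans where "spans T i D \<longleftrightarrow> (\<exists>R z. finite R \<and> R \<subseteq> T \<and>
      (\<forall>j. (\<Sum>t\<in>R. z t * t j) = (if j = i then int D else 0)))" for T :: "(nat \<Rightarrow> int) set" and i and D :: nat
  \<comment> \<open>Meaningful only where some positive \<open>D\<close> spans; the other pairs get
    an arbitrary value, which can only enlarge \<open>N\<close>.\<close>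
  define D where "D Ti = (SOME D. D > 0 \<and> spans (fst Ti) (snd Ti) D)" for Ti
  \<comment> \<open>The sum bounds every single \<open>D Ti * M\<close>, and the summand 1 makes the
    bound strict.\<close>
  define N where "N = 1 + (\<Sum>Ti\<in>Pow \<Delta> \<times> {..<k}. D Ti * M)"
  have main: "\<exists>W. weakly_special k 1 W \<and> u \<in> W \<and> W \<subseteq> V"
    if u: "u \<in> V" and nx: "\<forall>i<k. n i > 0 \<and> x i \<noteq> 0 \<and> u i ^ n i = of_rat (x i) \<and>
        (\<forall>p::nat. prime p \<and> p dvd n i \<longrightarrow> \<not> (\<exists>y::rat. y \<noteq> 0 \<and> x i = y ^ p))"
      and N: "Max (n ` {..<k}) \<ge> N" for u :: "nat \<Rightarrow> complex" and n :: "nat \<Rightarrow> nat" and x :: "nat \<Rightarrow> rat"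
  proof -
    have uG: "u \<in> carrier (Gm k)" and pu: "\<And>p. p \<in> S \<Longrightarrow> laurent_eval p u = 0" using u S(3) by auto
    have u0: "u i \<noteq> 0" if "i < k" for i using Gm_nonzero[OF uG that] .
    have urad: "\<exists>m>0. u i ^ m \<in> \<rat>" if "i < k" for i using nx that by (metis Rats_of_rat)
    have cs: "class_sums_vanish (rat_roots M) (keys p) (\<lambda>a. monomial a u)
        (\<lambda>a. lookup p a * monomial a u)" if p: "p \<in> S" for p
    proof -
      have mon: "monomial a u \<noteq> 0 \<and> (\<exists>m>0. monomial a u ^ m \<in> \<rat>)" if a: "a \<in> keys p" for a
        unfolding monomial_eq[OF keys[OF p a]] using u0 urad
        by (intro conjI radical_prod radical_power_int) auto
      have rel: "(\<Sum>a\<in>keys p. lookup p a * monomial a u) = 0"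
        using pu[OF p] laurent_eval_eq[of "keys p" p u] by simp
      have "\<forall>a\<in>keys p. monomial a u \<noteq> 0 \<and> (\<exists>m>0. monomial a u ^ m \<in> \<rat>)"
        using mon by (rule ballI)
      from conjunct2[OF bspec[OF Mp p], THEN spec, of "\<lambda>a. monomial a u", THEN mp, OF this, THEN mp, OF rel]
      show ?thesis
      proof (rule class_sums_vanish_coarsen[OF _ div_closed_rat_roots div_closed_rat_roots MpM[OF p], rotated -1])
        show "monomial a u \<noteq> 0" if "a \<in> keys p" for a using mon[OF that] by blast
      qed simp
    qed
    define P where "P = {(a, a'). \<exists>p\<in>S. a \<in> keys p \<and> a' \<in> keys p \<and>
        monomial a u / monomial a' u \<in> rat_roots M}"
    define T where "T = exponent_diff ` P"
    have PS: "P \<subseteq> (\<Union>p\<in>S. keys p \<times> keys p)" by (auto simp: P_def)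
    have T\<Delta>: "T \<subseteq> \<Delta>" unfolding T_def \<Delta>_def using PS by (rule image_mono)
    have T0: "t i = 0" if t: "t \<in> T" and i: "i \<ge> k" for t i
    proof -
      obtain p a a' where "p \<in> S" "a \<in> keys p" "a' \<in> keys p" "t = exponent_diff (a, a')"
        using t PS unfolding T_def by auto
      moreover from this have "i \<notin> keys a" "i \<notin> keys a'" using keys[of p] i by fastforce+
      ultimately show ?thesis by (simp add: exponent_diff_def in_keys_iff)
    qed
    have Troots: "(\<Prod>i<k. u i powi t i) \<in> rat_roots M" if "t \<in> T" for t
    proof -
      obtain p a a' where a: "p \<in> S" "a \<in> keys p" "a' \<in> keys p"
        "monomial a u / monomial a' u \<in> rat_roots M" "t = exponent_diff (a, a')"
        using \<open>t \<in> T\<close> unfolding T_def P_def by auto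
      then show ?thesis using monomial_quotient[OF keys[OF a(1,2)] keys[OF a(1,3)] u0] by simp
    qed
    show ?thesis
    proof (rule orthogonal_vector_or_spanning[of T k])
      show "t i = 0" if "t \<in> T" "i \<ge> k" for t i by (rule T0[OF that])
    next
      fix m :: "nat \<Rightarrow> int"
      assume orthogonal: "\<exists>i<k. m i \<noteq> 0" "\<And>t. t \<in> T \<Longrightarrow> (\<Sum>i<k. m i * t i) = 0"
      show ?thesis
      proof (rule coset_subset_of_orthogonal[OF S(2,3) u cs])
        show "\<exists>i<k. m i \<noteq> 0" by (rule orthogonal(1))
        fix p a a' assume "p \<in> S" "a \<in> keys p" "a' \<in> keys p"
          "monomial a u / monomial a' u \<in> rat_roots M"
        then have "exponent_diff (a, a') \<in> T" unfolding T_def P_def by blast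
        then show "(\<Sum>i<k. m i * exponent_diff (a, a') i) = 0" by (rule orthogonal(2))
      qed
    next
      assume spanning: "\<forall>i<k. \<exists>D::nat. D > 0 \<and> (\<exists>S z. finite S \<and> S \<subseteq> T \<and>
          (\<forall>j. (\<Sum>t\<in>S. z t * t j) = (if j = i then int D else 0)))"
      have "n ` {..<k} \<noteq> {}" using assms(1) by (auto simp: lessThan_empty_iff)
      then have "Max (n ` {..<k}) \<in> n ` {..<k}" by (intro Max_in) auto
      \<comment> \<open>A coordinate with the largest exponent; the contradiction will be that
        \<open>n i\<close> divides a number smaller than \<open>N\<close>.\<close>
      then obtain i where i: "i < k" "n i \<ge> N" using N by auto
      define d where "d = D (T, i)"
      have "\<exists>d. d > 0 \<and> spans T i d" using spanning i unfolding spans_def by blast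
      then have "d > 0 \<and> spans T i d"
        unfolding d_def D_def fst_conv snd_conv by (rule someI_ex)
      then have d: "d > 0" "spans T i d" by blast+
      obtain R z where R: "finite R" "R \<subseteq> T" "\<And>j. (\<Sum>t\<in>R. z t * t j) = (if j = i then int d else 0)"
        using d(2) unfolding spans_def by blast
      \<comment> \<open>Multiplicatively, the expression of \<open>d\<close> times the
        \<open>i\<close>-th unit vector by vectors of \<open>T\<close> writes \<open>u i ^ d\<close>
        as a product of powers of quotients of monomials in a common class, whose
        \<open>M\<close>-th powers are rational.\<close>
      have "u i ^ d = (\<Prod>j<k. if j = i then u i powi int d else 1)" using i by simp
      also have "\<dots> = (\<Prod>j<k. u j powi (\<Sum>t\<in>R. z t * t j))" by (rule prod.cong) (auto simp: R(3))
      also have "\<dots> = (\<Prod>j<k. \<Prod>t\<in>R. u j powi (z t * t j))" using u0 by (intro prod.cong power_int_sum) auto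
      also have "\<dots> = (\<Prod>t\<in>R. \<Prod>j<k. (u j powi t j) powi z t)"
        by (subst prod.swap) (simp add: power_int_mult[symmetric] mult.commute)
      also have "\<dots> = (\<Prod>t\<in>R. (\<Prod>j<k. u j powi t j) powi z t)" by (simp add: prod_power_int)
      finally have "u i ^ (d * M) = (\<Prod>t\<in>R. (\<Prod>j<k. u j powi t j) powi z t) ^ M"
        by (simp only: power_mult)
      also have "\<dots> = (\<Prod>t\<in>R. ((\<Prod>j<k. u j powi t j) ^ M) powi z t)"
        by (simp only: prod_power_distrib power_int_power_commute)
      also have "\<dots> \<in> \<rat>"
      proof (rule subring_prod[OF csubring_Rats])
        fix t assume "t \<in> R"
        then have "(\<Prod>j<k. u j powi t j) ^ M \<in> \<rat>" using Troots R(2) by (auto simp: rat_roots_def)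
        then show "((\<Prod>j<k. u j powi t j) ^ M) powi z t \<in> \<rat>" by (simp add: power_int_def)
      qed
      finally have K: "u i ^ (d * M) \<in> \<rat>" .
      have "n i dvd d * M"
        by (rule radical_exponent_dvd[OF u0[OF i(1)] _ _ K, where x = "x i"]) (use nx i(1) in auto)
      then have "n i \<le> d * M" using d(1) M0 by (intro dvd_imp_le) auto
      also have "d * M \<le> (\<Sum>Ti\<in>Pow \<Delta> \<times> {..<k}. D Ti * M)"
        unfolding d_def using T\<Delta> i(1) fin\<Delta> by (intro member_le_sum) auto
      also have "\<dots> < N" by (simp add: N_def)
      finally show ?thesis using i(2) by simp
    qed
  qed
  show ?thesis
  proof (rule exI[of _ N], intro conjI ballI allI impI)
    show "N > 0" by (simp add: N_def)
    fix u n x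
    assume "u \<in> V" and "\<forall>i<k. n i > 0 \<and> x i \<noteq> 0 \<and> u i ^ n i = of_rat (x i) \<and>
        (\<forall>p::nat. prime p \<and> p dvd n i \<longrightarrow> \<not> (\<exists>y::rat. y \<noteq> 0 \<and> x i = y ^ p))"
      and "Max (n ` {..<k}) \<ge> N"
    from main[OF this] obtain W where "weakly_special k 1 W \<and> u \<in> W \<and> W \<subseteq> V" by blast
    then show "\<exists>d W. d > 0 \<and> weakly_special k d W \<and> u \<in> W \<and> W \<subseteq> V"
      by (intro exI[of _ "1::nat"] exI[of _ W]) simp
  qed
qed

end
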